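(* For the Lagrangian compressible Euler equations with the two-contact entropy profile described in the context, and rarefactive initial data prescribed on $(x_0,x_1)$ (constant outside that interval), there are three possible long-time behaviors: asymptotic vacuum; infinitely reflected waves which converge to the vacuum state; and infinitely reflected waves with non-vanishing wavespeed and density. The long-time behavior is determined by the expression $\zeta=z_1-\eta\,z_0$, with a bifurcation at $\zeta=0$.
   Context: Equations. Fix constants $\gamma>1$, $K>0$, $c_v>0$. The Lagrangian compressible Euler equations are $$\tau_t-u_x=0,\quad u_t+p_x=0,\quad (\tfrac12u^2+e)_t+(up)_x=0,$$ with specific volume $\tau=1/\rho$ ($\rho$ the density), velocity $u$, pressure $p=Ke^{S/c_v}\tau^{-\gamma}$, entropy $S$, and $e=p\tau/(\gamma-1)$. For classical solutions the third equation can be replaced by $S_t=0$. Set $d=\frac{\gamma+1}{\gamma-1}$, $C_z=(d-1)^{1/(1-d)}$, $C_m=\sqrt{K\gamma}\,C_z^{-d}$, $m=C_me^{S/2c_v}$ (the entropy variable) and $z=C_z\tau^{-(\gamma-1)/2}$. Then the Lagrangian sound speed is $c=\sqrt{-p_\tau}=mz^d$, and $p=\frac{m^2z^{1+d}}{d+1}$, $\tau=\frac{z^{1-d}}{d-1}$; the vacuum is $z=0$. Entropy profile: $m(x)$ is piecewise constant with two jumps (contacts, across which $u$ and $p$ are unchanged), an increasing one at $x_0$ and a decreasing one at $x_1>x_0$. Measuring the strength of a jump with left and right values $m_l,m_r$ by $(m_r/m_l)^{(d-1)/(d+1)}$, the strength at $x_0$ is $Q>1$ and the strength at $x_1$ is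 $1/Q$. Set $\eta=\frac{Q-1}{Q+1}\in(0,1)$. Data and solution: $C^2$ data are prescribed in $(x_0,x_1)$ and are constant outside that interval, so there are no incoming waves from either side. Rarefactive data means that the waves in the data are rarefactions: with $\alpha=u_x+p_x/c$ and $\beta=u_x-p_x/c$, forward waves are rarefactive iff $\alpha>0$ and compressive iff $\alpha<0$, backward waves are rarefactive iff $\beta>0$ and compressive iff $\beta<0$. Characteristics are curves with $dx/dt=c$ (forward) or $dx/dt=-c$ (backward). An asymptotic vacuum is a characteristic with a vertical asymptote in the $(x,t)$-plane. Starting from the corner $(x_1,0)$, trace the reflected characteristic through the solution in the strip $x_0<x<x_1$: backward to $x_0$, then forward to $x_1$, and so on, and let $t_k$ be the time of its $k$-th intersection with the boundary of the strip. Then $z_0=z(x_1-,0+)$ and $z_1=z(x_0+,t_1)$ are the interior values of $z$ at the starting corner and at the first intersection. Infinitely reflected waves are waves that reflect back and forth between $x_0$ and $x_1$ for all times. *)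

theory Defs
  imports "HOL-Analysis.Analysis"
begin

section \<open>Polytropic ideal gas in Lagrangian coordinates\<close>

definition pressure :: "real \<Rightarrow> real \<Rightarrow> real \<Rightarrow> real \<Rightarrow> real \<Rightarrow> real" where
  "pressure K \<gamma> cv s \<tau> = K * exp (s / cv) * \<tau> powr (- \<gamma>)"

definition internal_energy :: "real \<Rightarrow> real \<Rightarrow> real \<Rightarrow> real \<Rightarrow> real \<Rightarrow> real" where
  "internal_energy K \<gamma> cv s \<tau> = pressure K \<gamma> cv s \<tau> * \<tau> / (\<gamma> - 1)"

definition sound_speed :: "real \<Rightarrow> real \<Rightarrow> real \<Rightarrow> real \<Rightarrow> real \<Rightarrow> real" where
  "sound_speed K \<gamma> cv s \<tau> = sqrt (- deriv (pressure K \<gamma> cv s) \<tau>)"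

definition d_exp :: "real \<Rightarrow> real" where
  "d_exp \<gamma> = (\<gamma> + 1) / (\<gamma> - 1)"

definition C_z :: "real \<Rightarrow> real" where
  "C_z \<gamma> = (d_exp \<gamma> - 1) powr (1 / (1 - d_exp \<gamma>))"

definition C_m :: "real \<Rightarrow> real \<Rightarrow> real" where
  "C_m K \<gamma> = sqrt (K * \<gamma>) * C_z \<gamma> powr (- d_exp \<gamma>)"

definition entropy_var :: "real \<Rightarrow> real \<Rightarrow> real \<Rightarrow> real \<Rightarrow> real" where
  "entropy_var K \<gamma> cv s = C_m K \<gamma> * exp (s / (2 * cv))"

definition z_var :: "real \<Rightarrow> real \<Rightarrow> real" where
  "z_var \<gamma> \<tau> = C_z \<gamma> * \<tau> powr (- (\<gamma> - 1) / 2)"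

text \<open>The three relations between \<open>p\<close>, \<open>\<tau>\<close>, \<open>c\<close> and \<open>m\<close>, \<open>z\<close>, which confirm the
  normalising constants above.\<close>

lemma d_exp_gt_1: "\<gamma> > 1 \<Longrightarrow> d_exp \<gamma> > 1"
  by (simp add: d_exp_def field_simps)

lemma C_z_pos: "\<gamma> > 1 \<Longrightarrow> C_z \<gamma> > 0"
  using d_exp_gt_1[of \<gamma>] by (simp add: C_z_def)

lemma z_var_pos: "\<gamma> > 1 \<Longrightarrow> \<tau> > 0 \<Longrightarrow> z_var \<gamma> \<tau> > 0"
  by (simp add: z_var_def C_z_pos)

lemma specific_volume_eq:
  assumes "\<gamma> > 1" "\<tau> > 0"
  shows "\<tau> = z_var \<gamma> \<tau> powr (1 - d_exp \<gamma>) / (d_exp \<gamma> - 1)"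
proof -
  have d: "d_exp \<gamma> > 1" using assms d_exp_gt_1 by simp
  have e: "(- (\<gamma> - 1) / 2) * (1 - d_exp \<gamma>) = 1"
    using assms by (simp add: d_exp_def field_simps)
  have "z_var \<gamma> \<tau> powr (1 - d_exp \<gamma>)
      = C_z \<gamma> powr (1 - d_exp \<gamma>) * \<tau> powr ((- (\<gamma> - 1) / 2) * (1 - d_exp \<gamma>))"
    using C_z_pos[OF assms(1)] by (simp add: z_var_def powr_mult powr_powr)
  also have "\<dots> = (d_exp \<gamma> - 1) * \<tau>"
    unfolding e using d assms by (simp add: C_z_def powr_powr)
  finally show ?thesis using d by simp
qed

lemma sound_speed_sqr:
  assumes "\<tau> > 0"
  shows "- deriv (pressure K \<gamma> cv s) \<tau> = K * \<gamma> * exp (s / cv) * \<tau> powr (- \<gamma> - 1)"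
proof -
  have "(pressure K \<gamma> cv s has_real_derivative K * exp (s / cv) * (- \<gamma> * \<tau> powr (- \<gamma> - 1))) (at \<tau>)"
    unfolding pressure_def[abs_def] using assms
    by (auto intro!: derivative_eq_intros)
  then show ?thesis by (simp add: DERIV_imp_deriv)
qed

lemma sound_speed_eq:
  assumes "\<gamma> > 1" "K > 0" "\<tau> > 0"
  shows "sound_speed K \<gamma> cv s \<tau> = entropy_var K \<gamma> cv s * z_var \<gamma> \<tau> powr d_exp \<gamma>"
proof -
  have e: "(- (\<gamma> - 1) / 2) * d_exp \<gamma> = (- \<gamma> - 1) / 2"
    using assms by (simp add: d_exp_def field_simps)
  have h: "exp (s / cv) = (exp (s / (2 * cv)))\<^sup>2"
    by (simp flip: exp_double)
  have t: "\<tau> powr (- \<gamma> - 1) = (\<tau> powr ((- \<gamma> - 1) / 2))\<^sup>2"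
    by (simp add: power2_eq_square flip: powr_add)
  have "z_var \<gamma> \<tau> powr d_exp \<gamma> = C_z \<gamma> powr d_exp \<gamma> * \<tau> powr ((- \<gamma> - 1) / 2)"
    using C_z_pos[OF assms(1)] by (simp add: z_var_def powr_mult powr_powr flip: e)
  then have "entropy_var K \<gamma> cv s * z_var \<gamma> \<tau> powr d_exp \<gamma>
      = sqrt (K * \<gamma>) * exp (s / (2 * cv)) * \<tau> powr ((- \<gamma> - 1) / 2)
        * (C_z \<gamma> powr (- d_exp \<gamma>) * C_z \<gamma> powr d_exp \<gamma>)"
    by (simp add: entropy_var_def C_m_def)
  also have "C_z \<gamma> powr (- d_exp \<gamma>) * C_z \<gamma> powr d_exp \<gamma> = 1"
    using C_z_pos[OF assms(1)] by (simp flip: powr_add)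
  finally show ?thesis
    unfolding sound_speed_def sound_speed_sqr[OF assms(3)] h t
    by (simp add: real_sqrt_mult)
qed

lemma pressure_eq:
  assumes "\<gamma> > 1" "K > 0" "\<tau> > 0"
  shows "pressure K \<gamma> cv s \<tau>
    = (entropy_var K \<gamma> cv s)\<^sup>2 * z_var \<gamma> \<tau> powr (1 + d_exp \<gamma>) / (d_exp \<gamma> + 1)"
proof -
  define z where "z = z_var \<gamma> \<tau>"
  define d where "d = d_exp \<gamma>"
  have d: "d > 1" "\<gamma> = (d + 1) / (d - 1)" using assms d_exp_gt_1[of \<gamma>]
    by (simp_all add: d_def d_exp_def field_simps)
  have z: "z > 0" using z_var_pos assms by (simp add: z_def)
  have "(sound_speed K \<gamma> cv s \<tau>)\<^sup>2 = K * \<gamma> * exp (s / cv) * \<tau> powr (- \<gamma> - 1)"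
    unfolding sound_speed_def sound_speed_sqr[OF assms(3)] using assms by simp
  also have "\<dots> * \<tau> = \<gamma> * pressure K \<gamma> cv s \<tau>"
    using assms by (simp add: pressure_def powr_diff)
  finally have 1: "\<gamma> * pressure K \<gamma> cv s \<tau> = (sound_speed K \<gamma> cv s \<tau>)\<^sup>2 * \<tau>" by simp
  have tau: "\<tau> = z powr (1 - d) / (d - 1)"
    using specific_volume_eq[OF assms(1,3)] by (simp add: z_def d_def)
  have "(sound_speed K \<gamma> cv s \<tau>)\<^sup>2 * \<tau> = (entropy_var K \<gamma> cv s * z powr d)\<^sup>2 * \<tau>"
    by (simp add: sound_speed_eq[OF assms] z_def d_def)
  also have "\<dots> = (entropy_var K \<gamma> cv s * z powr d)\<^sup>2 * (z powr (1 - d) / (d - 1))"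
    by (rule arg_cong[OF tau])
  also have "\<dots> = (entropy_var K \<gamma> cv s)\<^sup>2 * ((z powr d)\<^sup>2 * z powr (1 - d)) / (d - 1)"
    by (simp add: power_mult_distrib)
  also have "(z powr d)\<^sup>2 * z powr (1 - d) = z powr (1 + d)"
    by (simp add: power2_eq_square add.commute flip: powr_add)
  finally have "(d + 1) / (d - 1) * pressure K \<gamma> cv s \<tau>
      = (entropy_var K \<gamma> cv s)\<^sup>2 * z powr (1 + d) / (d - 1)"
    using 1 d(2) by simp
  then show ?thesis using d(1) unfolding z_def d_def by (simp add: field_simps)
qed


section \<open>Entropy profile and solutions\<close>

definition entropy_profile :: "real \<Rightarrow> real \<Rightarrow> real \<Rightarrow> real \<Rightarrow> real \<Rightarrow> real \<Rightarrow> real" where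
  "entropy_profile x0 x1 Sl Sm Sr x = (if x < x0 then Sl else if x < x1 then Sm else Sr)"

definition contact_strength :: "real \<Rightarrow> real \<Rightarrow> real \<Rightarrow> real" where
  "contact_strength \<gamma> ml mr = (mr / ml) powr ((d_exp \<gamma> - 1) / (d_exp \<gamma> + 1))"

text \<open>Integral form of \<open>w\<^sub>t + f\<^sub>x = 0\<close>.  Values on the lines \<open>x \<in> D\<close>, where the fields jump, are
  not used.  Shrinking the rectangles to a line \<open>x \<in> D\<close> shows that \<open>f\<close> is unchanged
  across it; so the laws below contain the contact conditions \<open>[u] = [p] = 0\<close>.\<close>

definition conservation_law ::
    "real set \<Rightarrow> (real \<Rightarrow> real \<Rightarrow> real) \<Rightarrow> (real \<Rightarrow> real \<Rightarrow> real) \<Rightarrow> bool" where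
  "conservation_law D w f \<longleftrightarrow>
    (\<forall>a b s t. a < b \<and> a \<notin> D \<and> b \<notin> D \<and> 0 \<le> s \<and> s < t \<longrightarrow>
      integral {a..b} (\<lambda>x. w x t) - integral {a..b} (\<lambda>x. w x s)
        = integral {s..t} (\<lambda>r. f a r) - integral {s..t} (\<lambda>r. f b r))"

text \<open>Local Lipschitz continuity in \<open>(x,t)\<close> on each side of the contacts, up to the contacts and up
  to \<open>t = 0\<close>, but not at the corners \<open>(x0,0)\<close>, \<open>(x1,0)\<close>.  Derivative jumps along
  characteristics and rarefaction fans centered at the corners are thus allowed; both
  occur for general data that are smooth in \<open>(x0,x1)\<close> and constant outside.\<close>

definition piecewise_lipschitz :: "real \<Rightarrow> real \<Rightarrow> (real \<Rightarrow> real \<Rightarrow> real) \<Rightarrow> bool" where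
  "piecewise_lipschitz x0 x1 f \<longleftrightarrow>
    (\<forall>I \<in> {{..<x0}, {x0<..<x1}, {x1<..}}.
      \<forall>C. compact C \<and> C \<subseteq> closure I \<times> {0..} - {(x0, 0), (x1, 0)} \<longrightarrow>
        (\<exists>L. L-lipschitz_on (C \<inter> I \<times> {0..}) (\<lambda>(x, t). f x t)))"

definition euler_solution ::
    "real \<Rightarrow> real \<Rightarrow> real \<Rightarrow> real \<Rightarrow> real \<Rightarrow> (real \<Rightarrow> real) \<Rightarrow>
      (real \<Rightarrow> real \<Rightarrow> real) \<Rightarrow> (real \<Rightarrow> real \<Rightarrow> real) \<Rightarrow> bool" where
  "euler_solution K \<gamma> cv x0 x1 S \<tau> u \<longleftrightarrow>
    piecewise_lipschitz x0 x1 \<tau> \<and> piecewise_lipschitz x0 x1 u \<and>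
    (\<forall>T. \<exists>M>0. \<forall>x t. x \<notin> {x0, x1} \<and> 0 \<le> t \<and> t \<le> T \<longrightarrow>
      1 / M \<le> \<tau> x t \<and> \<tau> x t \<le> M \<and> \<bar>u x t\<bar> \<le> M) \<and>
    conservation_law {x0, x1} \<tau> (\<lambda>x t. - u x t) \<and>
    conservation_law {x0, x1} u (\<lambda>x t. pressure K \<gamma> cv (S x) (\<tau> x t)) \<and>
    conservation_law {x0, x1}
      (\<lambda>x t. (u x t)\<^sup>2 / 2 + internal_energy K \<gamma> cv (S x) (\<tau> x t))
      (\<lambda>x t. u x t * pressure K \<gamma> cv (S x) (\<tau> x t))"


section \<open>Initial data\<close>

definition C2_on :: "real set \<Rightarrow> (real \<Rightarrow> real) \<Rightarrow> bool" where
  "C2_on I f \<longleftrightarrow> (\<exists>f' f''. (\<forall>x\<in>I. (f has_real_derivative f' x) (at x) \<and>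
      (f' has_real_derivative f'' x) (at x)) \<and> continuous_on I f'')"

definition smooth_data_between ::
    "real \<Rightarrow> real \<Rightarrow> (real \<Rightarrow> real) \<Rightarrow> (real \<Rightarrow> real) \<Rightarrow> bool" where
  "smooth_data_between x0 x1 \<tau>0 u0 \<longleftrightarrow>
    C2_on {x0<..<x1} \<tau>0 \<and> C2_on {x0<..<x1} u0 \<and>
    \<tau>0 constant_on {..<x0} \<and> u0 constant_on {..<x0} \<and>
    \<tau>0 constant_on {x1<..} \<and> u0 constant_on {x1<..}"

text \<open>No compressive wave in the data: \<open>\<alpha> \<ge> 0\<close> and \<open>\<beta> \<ge> 0\<close>, with equality
  where a wave is absent.\<close>

definition rarefactive_data ::
    "real \<Rightarrow> real \<Rightarrow> real \<Rightarrow> real \<Rightarrow> real \<Rightarrow> (real \<Rightarrow> real) \<Rightarrow>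
      (real \<Rightarrow> real) \<Rightarrow> (real \<Rightarrow> real) \<Rightarrow> bool" where
  "rarefactive_data K \<gamma> cv x0 x1 S \<tau>0 u0 \<longleftrightarrow>
    (\<forall>x. x0 < x \<and> x < x1 \<longrightarrow>
      (let ux = deriv u0 x;
           px = deriv (\<lambda>y. pressure K \<gamma> cv (S y) (\<tau>0 y)) x;
           c = sound_speed K \<gamma> cv (S x) (\<tau>0 x)
       in ux + px / c \<ge> 0 \<and> ux - px / c \<ge> 0))"


section \<open>Characteristics and long-time behavior\<close>

text \<open>In the following \<open>c\<close> is the field of sound speeds \<open>c x t\<close>; \<open>\<sigma> = 1\<close> stands for forward and
  \<open>\<sigma> = - 1\<close> for backward characteristics.\<close>

definition characteristic ::
    "real \<Rightarrow> real \<Rightarrow> (real \<Rightarrow> real \<Rightarrow> real) \<Rightarrow> real \<Rightarrow> real set \<Rightarrow> (real \<Rightarrow> real) \<Rightarrow> bool" where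
  "characteristic x0 x1 c \<sigma> J X \<longleftrightarrow>
    (\<forall>t\<in>J. x0 < X t \<and> X t < x1 \<and> (X has_real_derivative \<sigma> * c (X t) t) (at t))"

definition corner_trace :: "real \<Rightarrow> (real \<Rightarrow> real \<Rightarrow> real) \<Rightarrow> real" where
  "corner_trace x1 f = Lim (at_right 0) (\<lambda>t. Lim (at_left x1) (\<lambda>x. f x t))"

text \<open>The curve \<open>X\<close> starts at the corner \<open>(x1,0)\<close> and consists of (at least) \<open>n\<close> legs between the
  contacts, with reflections at the times \<open>t 1, t 2, \<dots>\<close>.  If a rarefaction fan is centered at
  the corner, several characteristics start there; the last two clauses select
  the one which carries the state \<open>(x1-,0+)\<close>.  Without a fan they hold automatically.\<close>

definition reflected_characteristic ::
    "real \<Rightarrow> real \<Rightarrow> (real \<Rightarrow> real \<Rightarrow> real) \<Rightarrow> (real \<Rightarrow> real \<Rightarrow> real) \<Rightarrow> (real \<Rightarrow> real \<Rightarrow> real) \<Rightarrow>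
      nat \<Rightarrow> (real \<Rightarrow> real) \<Rightarrow> (nat \<Rightarrow> real) \<Rightarrow> bool" where
  "reflected_characteristic x0 x1 c \<tau> u n X t \<longleftrightarrow>
    t 0 = 0 \<and>
    (\<forall>k\<le>n. X (t k) = (if even k then x1 else x0)) \<and>
    (\<forall>k<n. t k < t (Suc k) \<and> continuous_on {t k..t (Suc k)} X \<and>
      characteristic x0 x1 c (if even k then - 1 else 1) {t k<..<t (Suc k)} X) \<and>
    ((\<lambda>s. \<tau> (X s) s) \<longlongrightarrow> corner_trace x1 \<tau>) (at_right 0) \<and>
    ((\<lambda>s. u (X s) s) \<longlongrightarrow> corner_trace x1 u) (at_right 0)"

definition infinitely_reflected ::
    "real \<Rightarrow> real \<Rightarrow> (real \<Rightarrow> real \<Rightarrow> real) \<Rightarrow> (real \<Rightarrow> real \<Rightarrow> real) \<Rightarrow> (real \<Rightarrow> real \<Rightarrow> real) \<Rightarrow> bool"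
  where
  "infinitely_reflected x0 x1 c \<tau> u \<longleftrightarrow>
    (\<exists>X t. (\<forall>n. reflected_characteristic x0 x1 c \<tau> u n X t) \<and> filterlim t at_top sequentially)"

definition asymptotic_vacuum :: "real \<Rightarrow> real \<Rightarrow> (real \<Rightarrow> real \<Rightarrow> real) \<Rightarrow> bool" where
  "asymptotic_vacuum x0 x1 c \<longleftrightarrow>
    (\<exists>\<sigma>\<in>{- 1, 1}. \<exists>X T xinf. T \<ge> 0 \<and> characteristic x0 x1 c \<sigma> {T<..} X \<and>
      (X \<longlongrightarrow> xinf) at_top)"

definition reflected_to_vacuum ::
    "real \<Rightarrow> real \<Rightarrow> (real \<Rightarrow> real \<Rightarrow> real) \<Rightarrow> (real \<Rightarrow> real \<Rightarrow> real) \<Rightarrow> (real \<Rightarrow> real \<Rightarrow> real) \<Rightarrow>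
      (real \<Rightarrow> real \<Rightarrow> real) \<Rightarrow> bool" where
  "reflected_to_vacuum x0 x1 c z \<tau> u \<longleftrightarrow>
    infinitely_reflected x0 x1 c \<tau> u \<and>
    uniform_limit {x0<..<x1} (\<lambda>t x. z x t) (\<lambda>x. 0) at_top"

definition reflected_nonvacuum ::
    "real \<Rightarrow> real \<Rightarrow> (real \<Rightarrow> real \<Rightarrow> real) \<Rightarrow> (real \<Rightarrow> real \<Rightarrow> real) \<Rightarrow> (real \<Rightarrow> real \<Rightarrow> real) \<Rightarrow> bool"
  where
  "reflected_nonvacuum x0 x1 c \<tau> u \<longleftrightarrow>
    infinitely_reflected x0 x1 c \<tau> u \<and>
    (\<exists>\<epsilon>>0. \<forall>x t. x0 < x \<and> x < x1 \<and> 0 \<le> t \<longrightarrow> \<epsilon> \<le> c x t \<and> \<epsilon> \<le> 1 / \<tau> x t)"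

end

theory Submission
  imports Defs
begin

text \<open>Between the contacts, \<open>s = u + m z\<close> is constant along forward and \<open>r = u - m z\<close> along
  backward characteristics.  Outside nothing comes in, so \<open>u + m z\<close> is a constant \<open>A\<close> on the left
  and \<open>u - m z\<close> is a constant \<open>B\<close> on the right; as \<open>u\<close> and \<open>p\<close> are continuous, \<open>m z\<close> jumps by
  the factor \<open>Q\<close>.  Hence the reflection laws \<open>s = - \<eta> r + (1 + \<eta>) A\<close> at \<open>x0\<close> and
  \<open>r = - \<eta> s + (1 + \<eta>) B\<close> at \<open>x1\<close>, and \<open>m \<zeta> = (1 + \<eta>) (A - B) / 2\<close>.

  Rarefactive data give \<open>s > A\<close> and \<open>r < B\<close> everywhere.  If \<open>A > B\<close>, then \<open>2 m z = s - r\<close> is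
  bounded below by \<open>A - B\<close>.  If \<open>A = B\<close>, every characteristic still crosses the strip in finite
  time, and each reflection multiplies the distance of \<open>s\<close> and \<open>r\<close> from \<open>A\<close> by \<open>\<eta>\<close>.  If \<open>A < B\<close>,
  repeated reflections would drive \<open>r\<close> at \<open>x0\<close> to the fixed point \<open>(B - \<eta> A) / (1 - \<eta>) > A\<close>,
  whereas \<open>z > 0\<close> forces \<open>r < A\<close> there; so some characteristic never arrives.\<close>


section \<open>Ordinary differential equations\<close>

text \<open>The wave pattern inside the strip does not enter \<open>\<zeta>\<close>: the first
  reflected leg carries its corner value of \<open>r\<close> unchanged to \<open>x0\<close>, so by
  the reflection laws \<open>m z0\<close> and \<open>m z1\<close> are
  \<open>(1 + \<eta>) / 2\<close> times \<open>s - B\<close> and \<open>A - r\<close> in the corner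
  values of \<open>s\<close> and \<open>r\<close>, and the law at \<open>x1\<close> cancels these in
  \<open>z1 - \<eta> z0\<close>.

  Two obstacles shape the rest. The fields are merely Lipschitz on each side of the contacts, so
  constancy of \<open>s\<close> and \<open>r\<close> has to be drawn from the integral laws. And the
  Lipschitz bounds end at the corners, where rarefaction fans may start: characteristics are built
  for \<open>t > 0\<close> only, and the one that leaves a corner is singled out as a limit. At a
  corner the boundary values are not tied to the monotone data, so \<open>s > A\<close> needs an
  argument: the reflection law and \<open>z > 0\<close> give it at \<open>x0\<close>, and a fan in
  which \<open>s\<close> decreases to the right cannot open, because its characteristics would
  converge.\<close>

lemma abs_diff_le_of_derivative_bound:
  fixes D \<phi> :: "real \<Rightarrow> real"
  assumes "a \<le> b"
    and D: "\<And>s. a \<le> s \<Longrightarrow> s \<le> b \<Longrightarrow> (D has_real_derivative D' s) (at s within {a..b})"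
    and P: "\<And>s. a \<le> s \<Longrightarrow> s \<le> b \<Longrightarrow> (\<phi> has_real_derivative \<phi>' s) (at s within {a..b})"
    and le: "\<And>s. a < s \<Longrightarrow> s < b \<Longrightarrow> \<bar>D' s\<bar> \<le> \<phi>' s"
  shows "\<bar>D b - D a\<bar> \<le> \<phi> b - \<phi> a"
proof (cases "a = b")
  case False
  then have "a < b" using assms by simp
  have "norm (D b - D a) \<le> \<phi> b - \<phi> a"
  proof (rule differentiable_bound_general[OF \<open>a < b\<close>, where f' = D' and \<phi>' = \<phi>'])
    show "continuous_on {a..b} D" "continuous_on {a..b} \<phi>"
      using D P by (auto intro!: DERIV_continuous_on)
    fix x assume x: "a < x" "x < b"
    then have "at x within {a..b} = at x" by (simp add: at_within_Icc_at)
    then show "(D has_vector_derivative D' x) (at x)" "(\<phi> has_vector_derivative \<phi>' x) (at x)"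
      using D[of x] P[of x] x by (simp_all add: has_real_derivative_iff_has_vector_derivative)
  qed (use le in auto)
  then show ?thesis by simp
qed simp

text \<open>\<open>(X - Y)\<^sup>2 e\<^bsup>2Lt\<^esup>\<close> increases and \<open>(X - Y)\<^sup>2 e\<^bsup>-2Lt\<^esup>\<close> decreases.\<close>

lemma gronwall:
  fixes X Y :: "real \<Rightarrow> real"
  assumes X: "\<And>t. t \<in> {a..b} \<Longrightarrow> (X has_real_derivative X' t) (at t within {a..b})"
    and Y: "\<And>t. t \<in> {a..b} \<Longrightarrow> (Y has_real_derivative Y' t) (at t within {a..b})"
    and L: "\<And>t. t \<in> {a..b} \<Longrightarrow> \<bar>X' t - Y' t\<bar> \<le> L * \<bar>X t - Y t\<bar>"
    and t: "t \<in> {a..b}" "t' \<in> {a..b}"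
  shows "\<bar>X t - Y t\<bar> \<le> exp (L * \<bar>t - t'\<bar>) * \<bar>X t' - Y t'\<bar>"
proof -
  let ?E = "\<lambda>s \<tau>. (X \<tau> - Y \<tau>)\<^sup>2 * exp (s * (2 * L * \<tau>))"
  have dE: "(?E s has_real_derivative
      (2 * (X \<tau> - Y \<tau>) * (X' \<tau> - Y' \<tau>) + s * 2 * L * (X \<tau> - Y \<tau>)\<^sup>2) * exp (s * (2 * L * \<tau>)))
      (at \<tau> within {a..b})" if "\<tau> \<in> {a..b}" for s \<tau>
    by (rule derivative_eq_intros X[OF that] Y[OF that] refl)+
      (simp add: algebra_simps power2_eq_square)
  have bnd: "\<bar>2 * (X \<tau> - Y \<tau>) * (X' \<tau> - Y' \<tau>)\<bar> \<le> 2 * L * (X \<tau> - Y \<tau>)\<^sup>2" if "\<tau> \<in> {a..b}" for \<tau>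
  proof -
    have "\<bar>X \<tau> - Y \<tau>\<bar> * \<bar>X' \<tau> - Y' \<tau>\<bar> \<le> \<bar>X \<tau> - Y \<tau>\<bar> * (L * \<bar>X \<tau> - Y \<tau>\<bar>)"
      by (rule mult_left_mono[OF L[OF that]]) simp
    also have "\<dots> = L * (X \<tau> - Y \<tau>)\<^sup>2"
      by (metis (no_types, opaque_lifting) mult.left_commute power2_abs power2_eq_square)
    finally have "\<bar>X \<tau> - Y \<tau>\<bar> * \<bar>X' \<tau> - Y' \<tau>\<bar> \<le> L * (X \<tau> - Y \<tau>)\<^sup>2" .
    moreover have "\<bar>2 * (X \<tau> - Y \<tau>) * (X' \<tau> - Y' \<tau>)\<bar> = 2 * (\<bar>X \<tau> - Y \<tau>\<bar> * \<bar>X' \<tau> - Y' \<tau>\<bar>)"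
      by (simp only: abs_mult abs_numeral mult.assoc)
    ultimately show ?thesis by linarith
  qed
  have dec: "?E (-1) q \<le> ?E (-1) p" "?E 1 p \<le> ?E 1 q" if "p \<in> {a..b}" "q \<in> {a..b}" "p \<le> q" for p q
  proof -
    have sub: "(?E s has_real_derivative
      (2 * (X \<tau> - Y \<tau>) * (X' \<tau> - Y' \<tau>) + s * 2 * L * (X \<tau> - Y \<tau>)\<^sup>2) * exp (s * (2 * L * \<tau>)))
      (at \<tau> within {p..q})" if "\<tau> \<in> {p..q}" for s \<tau>
      by (rule DERIV_subset[OF dE]) (use that \<open>p \<in> _\<close> \<open>q \<in> _\<close> in auto)
    have at: "at \<tau> within {a..b} = at \<tau>" if "p < \<tau>" "\<tau> < q" for \<tau>
      using that \<open>p \<in> _\<close> \<open>q \<in> _\<close> by (simp add: at_within_Icc_at)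
    have cont: "continuous_on {p..q} (?E s)" for s
      by (rule DERIV_continuous_on) (rule sub)
    have "?E 1 p \<le> ?E 1 q"
    proof (rule DERIV_nonneg_imp_increasing_open[OF \<open>p \<le> q\<close> _ cont])
      fix \<tau> assume \<tau>: "p < \<tau>" "\<tau> < q"
      then have in_ab: "\<tau> \<in> {a..b}" using \<open>p \<in> _\<close> \<open>q \<in> _\<close> by auto
      have "0 \<le> (2 * (X \<tau> - Y \<tau>) * (X' \<tau> - Y' \<tau>) + 1 * 2 * L * (X \<tau> - Y \<tau>)\<^sup>2) * exp (1 * (2 * L * \<tau>))"
        using bnd[OF in_ab] by (intro mult_nonneg_nonneg) (auto simp: abs_le_iff)
      then show "\<exists>y. (?E 1 has_real_derivative y) (at \<tau>) \<and> y \<ge> 0"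
        using dE[OF in_ab, of 1] unfolding at[OF \<tau>] by blast
    qed
    moreover have "?E (-1) q \<le> ?E (-1) p"
    proof (rule DERIV_nonpos_imp_decreasing_open[OF \<open>p \<le> q\<close> _ cont])
      fix \<tau> assume \<tau>: "p < \<tau>" "\<tau> < q"
      then have in_ab: "\<tau> \<in> {a..b}" using \<open>p \<in> _\<close> \<open>q \<in> _\<close> by auto
      have "(2 * (X \<tau> - Y \<tau>) * (X' \<tau> - Y' \<tau>) + (-1) * 2 * L * (X \<tau> - Y \<tau>)\<^sup>2) * exp ((-1) * (2 * L * \<tau>)) \<le> 0"
        using bnd[OF in_ab] by (intro mult_nonpos_nonneg) (auto simp: abs_le_iff)
      then show "\<exists>y. (?E (-1) has_real_derivative y) (at \<tau>) \<and> y \<le> 0"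
        using dE[OF in_ab, of "-1"] unfolding at[OF \<tau>] by blast
    qed
    ultimately show "?E (-1) q \<le> ?E (-1) p" "?E 1 p \<le> ?E 1 q" by simp_all
  qed
  have exp_eq: "exp (2 * L * p) * exp (- (2 * L * q)) = (exp (L * (p - q)))\<^sup>2" for p q
    by (simp add: algebra_simps flip: exp_add exp_double)
  have sq: "(X t - Y t)\<^sup>2 \<le> (exp (L * \<bar>t - t'\<bar>) * \<bar>X t' - Y t'\<bar>)\<^sup>2"
  proof (cases "t' \<le> t")
    case True
    have "(X t - Y t)\<^sup>2 = exp (2 * L * t) * ?E (-1) t"
      by (simp add: exp_minus)
    also have "\<dots> \<le> exp (2 * L * t) * ?E (-1) t'"
      by (intro mult_left_mono dec(1)[OF t(2,1) True]) auto
    also have "\<dots> = exp (2 * L * t) * exp (- (2 * L * t')) * (X t' - Y t')\<^sup>2" by simp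
    finally show ?thesis using True unfolding exp_eq by (simp add: power_mult_distrib)
  next
    case False
    then have le: "t \<le> t'" by simp
    have "(X t - Y t)\<^sup>2 = exp (- (2 * L * t)) * ?E 1 t"
      by (simp add: exp_minus)
    also have "\<dots> \<le> exp (- (2 * L * t)) * ?E 1 t'"
      by (intro mult_left_mono dec(2)[OF t le]) auto
    also have "\<dots> = exp (2 * L * t') * exp (- (2 * L * t)) * (X t' - Y t')\<^sup>2" by simp
    finally show ?thesis using False unfolding exp_eq by (simp add: power_mult_distrib)
  qed
  show ?thesis
    using power2_le_imp_le[of "\<bar>X t - Y t\<bar>" "exp (L * \<bar>t - t'\<bar>) * \<bar>X t' - Y t'\<bar>"] sq by simp
qed

lemma antiderivative_UNIV:
  fixes h :: "real \<Rightarrow> real"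
  assumes "continuous_on UNIV h"
  shows "\<exists>H. H t0 = 0 \<and> (\<forall>t. (H has_real_derivative h t) (at t))"
proof -
  obtain H where H: "(H has_vector_derivative h t) (at t)" for t
    using einterval_antiderivative[of "-\<infinity>" "\<infinity>" h] assms
    by (auto simp: continuous_on_eq_continuous_at)
  have "((\<lambda>s. H s - H t0) has_real_derivative h t) (at t)" for t
    using H[of t] by (auto intro!: derivative_eq_intros simp: has_real_derivative_iff_has_vector_derivative)
  then show ?thesis by (intro exI[of _ "\<lambda>s. H s - H t0"]) simp
qed

text \<open>Picard iteration is a contraction in the norm \<open>sup\<^sub>t e\<^bsup>-2L|t - t0|\<^esup> |X t|\<close>.\<close>

lemma ode_global_exists:
  fixes g :: "real \<Rightarrow> real \<Rightarrow> real"
  assumes lip: "\<And>x y t. \<bar>g x t - g y t\<bar> \<le> L * \<bar>x - y\<bar>"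
    and cont: "continuous_on UNIV (\<lambda>(x, t). g x t)"
    and bdd: "\<And>x t. \<bar>g x t\<bar> \<le> M"
  obtains X where "X t0 = x0" "\<And>t. (X has_real_derivative g (X t) t) (at t)"
proof -
  \<comment> \<open>At least \<open>1\<close>, so that the weight \<open>e\<close> below dominates
    \<open>\<bar>t - t0\<bar>\<close>; this makes the Picard image bounded whatever \<open>L\<close>
    is.\<close>
  define N where "N = max L 1"
  have "L * \<bar>x - y\<bar> \<le> N * \<bar>x - y\<bar>" for x y :: real
    by (rule mult_right_mono) (auto simp: N_def)
  then have N: "N \<ge> 1" "\<And>x y t. \<bar>g x t - g y t\<bar> \<le> N * \<bar>x - y\<bar>"
    using lip order.trans by (auto simp: N_def) blast
  have M: "M \<ge> 0" using bdd[of 0 0] by simp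
  define e where "e t = exp (2 * N * \<bar>t - t0\<bar>)" for t
  have e: "e t > 0" "continuous_on UNIV e" for t
    unfolding e_def by (auto intro!: continuous_intros)
  \<comment> \<open>The unknown is \<open>y = (X - x0) / e\<close>, a bounded continuous function,
    so that the plain sup norm of \<open>y\<close> is the weighted norm of
    \<open>X - x0\<close>.\<close>
  define h where "h y s = g (x0 + e s * apply_bcontfun y s) s" for y :: "real \<Rightarrow>\<^sub>C real" and s
  have hc: "continuous_on UNIV (h y)" for y
  proof -
    have "continuous_on UNIV (\<lambda>s. (x0 + e s * apply_bcontfun y s, s))"
      by (intro continuous_intros e) auto
    from continuous_on_compose2[OF cont this] show ?thesis by (simp add: h_def)
  qed
  define H where "H y = (SOME H. H t0 = 0 \<and> (\<forall>t. (H has_real_derivative h y t) (at t)))" for y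
  have H: "H y t0 = 0" "(H y has_real_derivative h y t) (at t)" for y t
    using someI_ex[OF antiderivative_UNIV[OF hc, of t0 y]] unfolding H_def by auto
  have Hb: "\<bar>H y t\<bar> \<le> M * \<bar>t - t0\<bar>" for y t
  proof -
    have "\<bar>H y q - H y p\<bar> \<le> M * q - M * p" if "p \<le> q" for p q
      by (rule abs_diff_le_of_derivative_bound[OF that, where D' = "h y" and \<phi>' = "\<lambda>_. M"])
        (auto intro!: has_field_derivative_at_within[OF H(2)[unfolded h_def]] derivative_eq_intros
          simp: h_def bdd)
    from this[of t t0] this[of t0 t] show ?thesis
      by (cases "t0 \<le> t") (auto simp: H(1) algebra_simps)
  qed
  have Pb: "(\<lambda>t. H y t / e t) \<in> bcontfun" for y
  proof -
    have c: "continuous_on UNIV (H y)"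
      by (rule DERIV_continuous_on) (rule H(2))
    have "\<bar>H y t / e t\<bar> \<le> M" for t
    proof -
      have "\<bar>t - t0\<bar> \<le> 2 * N * \<bar>t - t0\<bar>" using N(1) mult_right_mono[of 1 "2 * N" "\<bar>t - t0\<bar>"] by simp
      also have "\<dots> \<le> e t" unfolding e_def using exp_ge_add_one_self[of "2 * N * \<bar>t - t0\<bar>"] by linarith
      finally have "M * \<bar>t - t0\<bar> \<le> M * e t" using M by (rule mult_left_mono)
      with Hb[of y t] have "\<bar>H y t\<bar> \<le> M * e t" by linarith
      then show ?thesis using e(1)[of t] by (simp add: abs_divide divide_le_eq)
    qed
    moreover have "continuous_on UNIV (\<lambda>t. H y t / e t)"
      by (intro continuous_intros c e) (use e(1) in \<open>auto simp: less_imp_neq[symmetric]\<close>)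
    ultimately show ?thesis by (auto simp: bcontfun_def bounded_iff)
  qed
  define P where "P y = Bcontfun (\<lambda>t. H y t / e t)" for y
  have P: "apply_bcontfun (P y) t = H y t / e t" for y t
    unfolding P_def using Pb by (simp add: Bcontfun_inverse)
  \<comment> \<open>The factor \<open>1/2\<close> is the weight integrated at rate
    \<open>2 * N\<close>: a primitive of \<open>N * exp (2 * N * s)\<close> is
    \<open>exp (2 * N * s) / 2\<close>.\<close>
  have contr: "dist (P y1) (P y2) \<le> 1/2 * dist y1 y2" for y1 y2
  proof (rule dist_bound)
    fix t
    let ?D = "\<lambda>t. H y1 t - H y2 t" and ?d = "dist y1 y2"
    have dh: "\<bar>h y1 s - h y2 s\<bar> \<le> N * e s * ?d" for s
    proof -
      have "\<bar>h y1 s - h y2 s\<bar> \<le> N * \<bar>e s * apply_bcontfun y1 s - e s * apply_bcontfun y2 s\<bar>"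
        unfolding h_def using N(2) by (metis add_diff_cancel_left)
      also have "\<dots> = N * e s * dist (apply_bcontfun y1 s) (apply_bcontfun y2 s)"
        using e(1)[of s] by (simp add: dist_real_def abs_mult mult.assoc flip: right_diff_distrib)
      also have "\<dots> \<le> N * e s * ?d"
        using e(1)[of s] N(1) by (intro mult_left_mono dist_bounded) auto
      finally show ?thesis .
    qed
    have dD: "(?D has_real_derivative h y1 s - h y2 s) (at s within A)" for s A
      by (rule has_field_derivative_at_within) (rule DERIV_diff; rule H)
    have "\<bar>?D t\<bar> \<le> ?d / 2 * e t"
    proof (cases "t0 \<le> t")
      case True
      have "\<bar>?D t - ?D t0\<bar> \<le> ?d / 2 * exp (2 * N * (t - t0)) - ?d / 2 * exp (2 * N * (t0 - t0))"
      proof (rule abs_diff_le_of_derivative_bound[OF True dD, where \<phi>' = "\<lambda>s. N * ?d * exp (2 * N * (s - t0))"])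
        show "((\<lambda>s. ?d / 2 * exp (2 * N * (s - t0))) has_real_derivative N * ?d * exp (2 * N * (s - t0)))
            (at s within {t0..t})" for s
          by (auto intro!: derivative_eq_intros)
        show "\<bar>h y1 s - h y2 s\<bar> \<le> N * ?d * exp (2 * N * (s - t0))" if "t0 < s" for s
          using dh[of s] that by (simp add: e_def mult_ac)
      qed
      then have "\<bar>?D t\<bar> \<le> ?d / 2 * e t - ?d / 2" using True by (simp add: H(1) e_def)
      then show ?thesis using zero_le_dist[of y1 y2] by linarith
    next
      case False
      then have le: "t \<le> t0" by simp
      have "\<bar>?D t0 - ?D t\<bar> \<le> - ?d / 2 * exp (2 * N * (t0 - t0)) - - ?d / 2 * exp (2 * N * (t0 - t))"
      proof (rule abs_diff_le_of_derivative_bound[OF le dD, where \<phi>' = "\<lambda>s. N * ?d * exp (2 * N * (t0 - s))"])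
        show "((\<lambda>s. - ?d / 2 * exp (2 * N * (t0 - s))) has_real_derivative N * ?d * exp (2 * N * (t0 - s)))
            (at s within {t..t0})" for s
          by (auto intro!: derivative_eq_intros)
        show "\<bar>h y1 s - h y2 s\<bar> \<le> N * ?d * exp (2 * N * (t0 - s))" if "s < t0" for s
          using dh[of s] that by (simp add: e_def mult_ac)
      qed
      then have "\<bar>?D t\<bar> \<le> ?d / 2 * e t - ?d / 2" using False by (simp add: H(1) e_def)
      then show ?thesis using zero_le_dist[of y1 y2] by linarith
    qed
    moreover have "dist (apply_bcontfun (P y1) t) (apply_bcontfun (P y2) t) = \<bar>?D t\<bar> / e t"
      using e(1)[of t] by (simp add: P dist_real_def flip: diff_divide_distrib)
    ultimately show "dist (apply_bcontfun (P y1) t) (apply_bcontfun (P y2) t) \<le> 1/2 * ?d"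
      using e(1)[of t] by (simp add: divide_le_eq)
  qed
  obtain y where y: "P y = y"
    using banach_fix_type[of "1/2" P] contr by auto
  have H_eq: "H y t = e t * apply_bcontfun y t" for t
    using P[of y t] e(1)[of t] unfolding y by simp
  have "((\<lambda>t. x0 + H y t) has_real_derivative g (x0 + H y t) t) (at t)" for t
    using DERIV_add[OF DERIV_const[of x0] H(2)[of y t]] by (simp only: add_0 h_def H_eq[symmetric])
  then show thesis by (intro that[of "\<lambda>t. x0 + H y t"]) (simp_all add: H(1))
qed

text \<open>The Lipschitz constant may blow up as \<open>t\<close> tends to \<open>0\<close>. Hence
  time is clipped to \<open>{a n..b n}\<close>, where the global lemma applies, and the solutions
  \<open>Y n\<close> are pasted together; they agree on common intervals by
  \<open>gronwall\<close>.\<close>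

lemma ode_exists:
  fixes f :: "real \<Rightarrow> real \<Rightarrow> real"
  assumes lip: "\<And>a b. 0 < a \<Longrightarrow> a \<le> b \<Longrightarrow>
      \<exists>L. \<forall>x y. \<forall>s\<in>{a..b}. \<forall>t\<in>{a..b}. \<bar>f x s - f y t\<bar> \<le> L * (\<bar>x - y\<bar> + \<bar>s - t\<bar>)"
    and bdd: "\<And>b. \<exists>M. \<forall>x. \<forall>t\<in>{0<..b}. \<bar>f x t\<bar> \<le> M"
    and t0: "0 < t0"
  obtains X where "X t0 = x0" "\<And>t. 0 < t \<Longrightarrow> (X has_real_derivative f (X t) t) (at t)"
proof -
  define a where "a n = min t0 (1 / real (Suc n))" for n
  define b where "b n = max t0 (real (Suc n))" for n
  define clip where "clip n t = max (a n) (min (b n) t)" for n t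
  have ab: "0 < a n" "a n \<le> t0" "t0 \<le> b n" "a n \<le> b n" for n
    using t0 by (auto simp: a_def b_def)
  have clip_in: "clip n t \<in> {a n..b n}" for n t using ab[of n] by (auto simp: clip_def)
  have clip_lip: "\<bar>clip n s - clip n t\<bar> \<le> \<bar>s - t\<bar>" for n s t by (auto simp: clip_def)
  have "\<exists>X. X t0 = x0 \<and> (\<forall>t. (X has_real_derivative f (X t) (clip n t)) (at t))" for n
  proof -
    obtain L where L: "\<bar>f x s - f y t\<bar> \<le> L * (\<bar>x - y\<bar> + \<bar>s - t\<bar>)"
      if "s \<in> {a n..b n}" "t \<in> {a n..b n}" for x y s t using lip[OF ab(1,4), of n] by blast
    have "0 \<le> L" using L[of t0 t0 0 1] ab[of n] by auto
    obtain M where M: "\<bar>f x t\<bar> \<le> M" if "t \<in> {0<..b n}" for x t using bdd[of "b n"] by blast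
    have L': "\<bar>f x (clip n s) - f y (clip n t)\<bar> \<le> L * (\<bar>x - y\<bar> + \<bar>s - t\<bar>)" for x y s t
    proof (rule order.trans[OF L[OF clip_in clip_in]])
      show "L * (\<bar>x - y\<bar> + \<bar>clip n s - clip n t\<bar>) \<le> L * (\<bar>x - y\<bar> + \<bar>s - t\<bar>)"
        using clip_lip[of n s t] \<open>0 \<le> L\<close> by (intro mult_left_mono) auto
    qed
    have cont: "continuous_on UNIV (\<lambda>(x, t). f x (clip n t))"
    proof (rule lipschitz_on_continuous_on)
      show "(2 * L)-lipschitz_on UNIV (\<lambda>(x, t). f x (clip n t))"
      proof (rule lipschitz_onI; clarify?)
        fix x s y t :: real
        have "\<bar>x - y\<bar> \<le> dist (x, s) (y, t)" "\<bar>s - t\<bar> \<le> dist (x, s) (y, t)"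
          by (metis dist_fst_le dist_real_def fst_conv, metis dist_snd_le dist_real_def snd_conv)
        then have "L * (\<bar>x - y\<bar> + \<bar>s - t\<bar>) \<le> L * (2 * dist (x, s) (y, t))"
          using \<open>0 \<le> L\<close> by (intro mult_left_mono) auto
        with L'[of x s y t] show "dist (f x (clip n s)) (f y (clip n t)) \<le> 2 * L * dist (x, s) (y, t)"
          by (simp add: dist_real_def)
      qed (use \<open>0 \<le> L\<close> in simp)
    qed
    have M': "\<bar>f x (clip n t)\<bar> \<le> M" for x t
    proof -
      have "clip n t \<in> {0<..b n}" using clip_in[of n t] ab(1)[of n] by auto
      then show ?thesis by (rule M)
    qed
    show ?thesis
      by (rule ode_global_exists[of "\<lambda>x t. f x (clip n t)" L M t0 x0])
        (use L'[of _ t _ t for t] cont M' in auto)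
  qed
  then obtain Y where Y: "Y n t0 = x0" "(Y n has_real_derivative f (Y n t) (clip n t)) (at t)" for n t
    by metis
  have clip_id: "clip n t = t" if "t \<in> {a n..b n}" for n t using that by (auto simp: clip_def)
  have mono: "{a m..b m} \<subseteq> {a n..b n}" if "m \<le> n" for m n
    using that t0 by (auto simp: a_def b_def frac_le intro: min.coboundedI2 max.coboundedI2)
  have agree: "Y m t = Y n t" if "m \<le> n" "t \<in> {a m..b m}" for m n t
  proof -
    obtain L where L: "\<bar>f x s - f y t\<bar> \<le> L * (\<bar>x - y\<bar> + \<bar>s - t\<bar>)"
      if "s \<in> {a m..b m}" "t \<in> {a m..b m}" for x y s t using lip[OF ab(1,4), of m] by blast
    have "\<bar>Y m t - Y n t\<bar> \<le> exp (L * \<bar>t - t0\<bar>) * \<bar>Y m t0 - Y n t0\<bar>"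
    proof (rule gronwall[where a = "a m" and b = "b m", OF has_field_derivative_at_within has_field_derivative_at_within])
      show "(Y m has_real_derivative f (Y m s) s) (at s)" "(Y n has_real_derivative f (Y n s) s) (at s)"
        if "s \<in> {a m..b m}" for s
        using Y(2)[of m s] Y(2)[of n s] clip_id[of s] that mono[OF \<open>m \<le> n\<close>] by auto
      show "\<bar>f (Y m s) s - f (Y n s) s\<bar> \<le> L * \<bar>Y m s - Y n s\<bar>" if "s \<in> {a m..b m}" for s
        using L[OF that that, of "Y m s" "Y n s"] by simp
    qed (use that ab[of m] in auto)
    then show ?thesis by (simp add: Y(1))
  qed
  \<comment> \<open>Index with \<open>t \<le> N t\<close> and \<open>1 / t \<le> N t\<close>. The
    next interval has \<open>t\<close> in its interior, as differentiation at \<open>t\<close>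
    requires.\<close>
  define N where "N t = nat \<lceil>max t (1 / t)\<rceil>" for t :: real
  have N: "t \<in> {a (N t)..b (N t)}" "t \<in> {a (Suc (N t))<..<b (Suc (N t))}" if "0 < t" for t :: real
  proof -
    have *: "t \<le> real (N t)" "1 / t \<le> real (N t)" unfolding N_def by linarith+
    from *(2) that have "1 \<le> t * real (N t)" by (simp add: divide_le_eq mult.commute)
    then have "1 < t * real (Suc (N t))" "1 < t * real (Suc (Suc (N t)))"
      using that by (simp_all add: algebra_simps)
    then have "1 / real (Suc (N t)) < t" "1 / real (Suc (Suc (N t))) < t"
      by (simp_all only: divide_less_eq of_nat_0_less_iff zero_less_Suc if_True)
    then show "t \<in> {a (N t)..b (N t)}" "t \<in> {a (Suc (N t))<..<b (Suc (N t))}"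
      using *(1) by (auto simp: a_def b_def)
  qed
  define X where "X t = Y (N t) t" for t
  have XY: "X t = Y n t" if "t \<in> {a n..b n}" for n t
  proof -
    have "0 < t" using that ab(1)[of n] by auto
    then show ?thesis
      unfolding X_def using agree[OF _ that, of "N t"] agree[OF _ N(1), of t n]
      by (metis nle_le)
  qed
  show thesis
  proof (rule that)
    show "X t0 = x0" using XY[of t0 0] ab[of 0] Y(1) by simp
    fix t :: real assume "0 < t"
    note t = N(2)[OF this]
    let ?n = "Suc (N t)"
    have "(Y ?n has_real_derivative f (X t) t) (at t)"
      using Y(2)[of ?n t] XY[of t ?n] clip_id[of t ?n] t
      by (simp only: greaterThanLessThan_iff atLeastAtMost_iff less_imp_le simp_thms)
    then show "(X has_real_derivative f (X t) t) (at t)"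
      by (rule has_field_derivative_transform_within_open[where S = "{a ?n<..<b ?n}"])
        (use t XY[of _ ?n] in \<open>simp_all only: open_greaterThanLessThan greaterThanLessThan_iff
            atLeastAtMost_iff less_imp_le simp_thms\<close>)
  qed
qed


section \<open>Riemann invariants of Lipschitz solutions\<close>

definition lipschitz_rect :: "real \<Rightarrow> real set \<Rightarrow> real set \<Rightarrow> (real \<Rightarrow> real \<Rightarrow> real) \<Rightarrow> bool" where
  "lipschitz_rect L A T f \<longleftrightarrow>
    (\<forall>x\<in>A. \<forall>y\<in>A. \<forall>s\<in>T. \<forall>t\<in>T. \<bar>f x s - f y t\<bar> \<le> L * (\<bar>x - y\<bar> + \<bar>s - t\<bar>))"

definition balance_rect :: "real set \<Rightarrow> real set \<Rightarrow> (real \<Rightarrow> real \<Rightarrow> real) \<Rightarrow> (real \<Rightarrow> real \<Rightarrow> real) \<Rightarrow> bool" where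
  "balance_rect A T w f \<longleftrightarrow> (\<forall>x\<in>A. \<forall>y\<in>A. \<forall>s\<in>T. \<forall>t\<in>T. x < y \<longrightarrow> s < t \<longrightarrow>
      integral {x..y} (\<lambda>y. w y t) - integral {x..y} (\<lambda>y. w y s)
        = integral {s..t} (f x) - integral {s..t} (f y))"

lemma lipschitz_rectD:
  "lipschitz_rect L A T f \<Longrightarrow> x \<in> A \<Longrightarrow> y \<in> A \<Longrightarrow> s \<in> T \<Longrightarrow> t \<in> T \<Longrightarrow>
    \<bar>f x s - f y t\<bar> \<le> L * (\<bar>x - y\<bar> + \<bar>s - t\<bar>)"
  by (auto simp: lipschitz_rect_def)

lemma lipschitz_on_of_rect:
  assumes "lipschitz_rect L A T f"
  shows "(2 * \<bar>L\<bar>)-lipschitz_on (A \<times> T) (\<lambda>(x, t). f x t)"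
proof (rule lipschitz_onI; clarify?)
  fix x s y t assume *: "x \<in> A" "s \<in> T" "y \<in> A" "t \<in> T"
  have "\<bar>x - y\<bar> \<le> dist (x, s) (y, t)" "\<bar>s - t\<bar> \<le> dist (x, s) (y, t)"
    by (metis dist_fst_le dist_real_def fst_conv, metis dist_snd_le dist_real_def snd_conv)
  then have "\<bar>L\<bar> * (\<bar>x - y\<bar> + \<bar>s - t\<bar>) \<le> \<bar>L\<bar> * (2 * dist (x, s) (y, t))"
    by (intro mult_left_mono) auto
  moreover have "L * (\<bar>x - y\<bar> + \<bar>s - t\<bar>) \<le> \<bar>L\<bar> * (\<bar>x - y\<bar> + \<bar>s - t\<bar>)"
    by (intro mult_right_mono) auto
  ultimately show "dist (f x s) (f y t) \<le> 2 * \<bar>L\<bar> * dist (x, s) (y, t)"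
    using lipschitz_rectD[OF assms *(1,3,2,4)] by (simp add: dist_real_def)
qed simp

lemma continuous_on_lipschitz_rect:
  "lipschitz_rect L A T f \<Longrightarrow> continuous_on (A \<times> T) (\<lambda>(x, t). f x t)"
  using lipschitz_on_continuous_on[OF lipschitz_on_of_rect] by blast

text \<open>The integral law says that the form \<open>w dx - f dt\<close> has integral zero around
  every subrectangle, so it is exact; continuity of \<open>w\<close> and \<open>f\<close> makes the
  potential differentiable jointly in \<open>(x, t)\<close>.\<close>

lemma potential_exists:
  assumes ab: "a < b" "t1 < t2"
    and w: "continuous_on ({a..b} \<times> {t1..t2}) (\<lambda>(x, t). w x t)"
    and f: "continuous_on ({a..b} \<times> {t1..t2}) (\<lambda>(x, t). f x t)"
    and bal: "balance_rect {a..b} {t1..t2} w f"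
  obtains \<Phi> where "\<And>x t. x \<in> {a..b} \<Longrightarrow> t \<in> {t1..t2} \<Longrightarrow>
    ((\<lambda>(x, t). \<Phi> x t) has_derivative (\<lambda>(h, k). w x t * h - f x t * k)) (at (x, t) within {a..b} \<times> {t1..t2})"
proof -
  define \<Phi> where "\<Phi> x t = integral {a..x} (\<lambda>y. w y t) - integral {t1..t} (f a)" for x t
  have wc: "continuous_on {a..b} (\<lambda>y. w y t)" if "t \<in> {t1..t2}" for t
  proof -
    have "continuous_on {a..b} (\<lambda>y. (y, t))" by (intro continuous_intros)
    moreover have "(\<lambda>y. (y, t)) ` {a..b} \<subseteq> {a..b} \<times> {t1..t2}" using that by auto
    ultimately show ?thesis using continuous_on_compose2[OF w] by fastforce
  qed
  have fc: "continuous_on {t1..t2} (f x)" if "x \<in> {a..b}" for x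
  proof -
    have "continuous_on {t1..t2} (\<lambda>t. (x, t))" by (intro continuous_intros)
    moreover have "(\<lambda>t. (x, t)) ` {t1..t2} \<subseteq> {a..b} \<times> {t1..t2}" using that by auto
    ultimately show ?thesis using continuous_on_compose2[OF f] by fastforce
  qed
  have \<Phi>x: "((\<lambda>x. \<Phi> x t) has_real_derivative w x t) (at x within {a..b})"
    if "x \<in> {a..b}" "t \<in> {t1..t2}" for x t
    unfolding \<Phi>_def using integral_has_real_derivative[OF wc[OF that(2)] that(1)]
    by (auto intro!: derivative_eq_intros)
  \<comment> \<open>The same value reached by the other way round the rectangle; it gives the
    derivative in \<open>t\<close>.\<close>
  have \<Phi>_eq: "\<Phi> x t = \<Phi> x t1 - integral {t1..t} (f x)" if "x \<in> {a..b}" "t \<in> {t1..t2}" for x t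
  proof (cases "a < x \<and> t1 < t")
    case True
    then have "integral {a..x} (\<lambda>y. w y t) - integral {a..x} (\<lambda>y. w y t1)
        = integral {t1..t} (f a) - integral {t1..t} (f x)"
      using bal that ab by (simp add: balance_rect_def)
    then show ?thesis by (simp add: \<Phi>_def)
  next
    case False
    then have "x = a \<or> t = t1" using that by auto
    then show ?thesis by (auto simp: \<Phi>_def)
  qed
  have \<Phi>t: "(\<Phi> x has_real_derivative - f x t) (at t within {t1..t2})"
    if "x \<in> {a..b}" "t \<in> {t1..t2}" for x t
  proof (rule has_field_derivative_transform_within[OF _ zero_less_one that(2)])
    show "((\<lambda>t. \<Phi> x t1 - integral {t1..t} (f x)) has_real_derivative - f x t) (at t within {t1..t2})"
      using DERIV_diff[OF DERIV_const integral_has_real_derivative[OF fc[OF that(1)] that(2)]] by simp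
  qed (rule \<Phi>_eq[OF that(1), symmetric])
  show thesis
  proof (rule that)
    fix x t assume xt: "x \<in> {a..b}" "t \<in> {t1..t2}"
    have "((\<lambda>(x, t). \<Phi> x t) has_derivative
        (\<lambda>(tx, ty). w x t * tx + blinfun_apply (blinfun_scaleR_left (- f x t)) ty))
        (at (x, t) within {a..b} \<times> {t1..t2})"
    proof (rule has_derivative_partialsI[where fy = "\<lambda>x t. blinfun_scaleR_left (- f x t)"])
      show "((\<lambda>x. \<Phi> x t) has_derivative (*) (w x t)) (at x within {a..b})"
        using \<Phi>x[OF xt] by (simp add: has_field_derivative_def)
      show "(\<Phi> x has_derivative blinfun_apply (blinfun_scaleR_left (- f x t))) (at t within {t1..t2})"
        if "x \<in> {a..b}" "t \<in> {t1..t2}" for x t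
      proof -
        have "blinfun_apply (blinfun_scaleR_left (- f x t)) = (*) (- f x t)"
          by (auto simp: fun_eq_iff)
        with \<Phi>t[OF that] show ?thesis by (simp only: has_field_derivative_def)
      qed
      have "continuous_on ({a..b} \<times> {t1..t2}) (\<lambda>p. blinfun_scaleR_left (- (case p of (x, t) \<Rightarrow> f x t)) :: real \<Rightarrow>\<^sub>L real)"
        by (intro continuous_intros f)
      then show "continuous (at (x, t) within {a..b} \<times> {t1..t2}) (\<lambda>(x, t). blinfun_scaleR_left (- f x t))"
        using xt by (auto simp: continuous_on_eq_continuous_within case_prod_unfold)
    qed (use xt in auto)
    then show "((\<lambda>(x, t). \<Phi> x t) has_derivative (\<lambda>(h, k). w x t * h - f x t * k)) (at (x, t) within {a..b} \<times> {t1..t2})"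
      by (simp add: mult.commute)
  qed
qed

text \<open>The derivative is the net flux through the moving curve, here shifted by a fixed
  \<open>h\<close>. Comparing different shifts of one characteristic later isolates the
  density.\<close>

lemma has_derivative_along_curve:
  fixes X :: "real \<Rightarrow> real"
  assumes \<Phi>: "((\<lambda>(x, t). \<Phi> x t) has_derivative (\<lambda>(h, k). w * h - f * k)) (at (X s + h, s) within {a..b} \<times> {t1..t2})"
    and X: "(X has_real_derivative V) (at s)"
    and s: "t1 < s" "s < t2" "a < X s + h" "X s + h < b"
  shows "((\<lambda>s. \<Phi> (X s + h) s) has_real_derivative w * V - f) (at s)"
proof -
  have int: "(X s + h, s) \<in> interior ({a..b} \<times> {t1..t2})"
    using s by (simp add: interior_Times)
  then have *: "((\<lambda>(x, t). \<Phi> x t) has_derivative (\<lambda>(h, k). w * h - f * k)) (at (X s + h, s))"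
    using \<Phi> by (simp only: at_within_interior)
  have "((\<lambda>s. (X s + h, s)) has_derivative (\<lambda>k. (V * k, k))) (at s)"
    using X by (auto intro!: derivative_eq_intros simp: has_field_derivative_def)
  from has_derivative_in_compose[OF this has_derivative_at_withinI[OF *]]
  have "((\<lambda>s. \<Phi> (X s + h) s) has_derivative (\<lambda>k. w * (V * k) - f * k)) (at s)" by simp
  moreover have "(\<lambda>k. w * (V * k) - f * k) = (*) (w * V - f)"
    by (auto simp: fun_eq_iff algebra_simps)
  ultimately show ?thesis by (simp add: has_field_derivative_def)
qed

lemma has_derivative_zero_of_quadratic_bound:
  fixes g :: "real \<Rightarrow> real"
  assumes t: "t \<in> {t1<..<t2}" and K: "\<And>s. s \<in> {t1<..<t2} \<Longrightarrow> \<bar>g s - g t\<bar> \<le> K * (s - t)\<^sup>2"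
  shows "(g has_real_derivative 0) (at t)"
proof -
  have "((\<lambda>s. (g s - g t) / (s - t)) \<longlongrightarrow> 0) (at t)"
  proof (rule Lim_null_comparison)
    have "\<forall>\<^sub>F s in at t. s \<in> {t1<..<t2}"
      using t by (intro eventually_at_in_open') auto
    then show "\<forall>\<^sub>F s in at t. norm ((g s - g t) / (s - t)) \<le> K * \<bar>s - t\<bar>"
    proof eventually_elim
      case (elim s)
      show ?case
      proof (cases "s = t")
        case False
        have "(s - t)\<^sup>2 = \<bar>s - t\<bar> * \<bar>s - t\<bar>" by (simp add: power2_eq_square)
        with K[OF elim] have "\<bar>g s - g t\<bar> \<le> K * \<bar>s - t\<bar> * \<bar>s - t\<bar>" by (simp only: mult.assoc)
        then show ?thesis using False by (simp add: abs_divide pos_divide_le_eq)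
      qed simp
    qed
    show "((\<lambda>s. K * \<bar>s - t\<bar>) \<longlongrightarrow> 0) (at t)"
      by (rule tendsto_eq_intros refl | simp)+
  qed
  then show ?thesis by (simp add: has_field_derivative_iff)
qed

text \<open>Along the characteristic through \<open>(X t0, t0)\<close> with speed \<open>\<sigma> c\<close>, the combination
  \<open>q = u - \<sigma> c0 \<tau>\<close> with frozen \<open>c0\<close> varies only quadratically in \<open>t - t0\<close>: the flux of the
  corresponding balance law through the curve, \<open>P + c0 c \<tau>\<close> up to a small multiple of \<open>u\<close>, is
  stationary in \<open>\<tau>\<close>.  So no differentiability of \<open>u\<close> and \<open>\<tau>\<close> is needed.\<close>

lemma invariant_along_characteristic:
  fixes \<tau> u :: "real \<Rightarrow> real \<Rightarrow> real" and P W cs X :: "real \<Rightarrow> real"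
  assumes ab: "a < b" and t0: "t0 \<in> {t1<..<t2}" and \<epsilon>: "\<epsilon> > 0" and \<sigma>: "\<sigma> \<in> {-1, 1}"
    and lip: "lipschitz_rect L {a..b} {t1..t2} \<tau>" "lipschitz_rect L {a..b} {t1..t2} u"
    and rng: "\<And>x t. x \<in> {a..b} \<Longrightarrow> t \<in> {t1..t2} \<Longrightarrow> \<tau> x t \<in> {m..M}"
    and bal: "balance_rect {a..b} {t1..t2} \<tau> (\<lambda>x t. - u x t)"
      "balance_rect {a..b} {t1..t2} u (\<lambda>x t. P (\<tau> x t))"
    and P: "\<And>v. v \<in> {m..M} \<Longrightarrow> (P has_real_derivative - (cs v)\<^sup>2) (at v)"
    and W: "\<And>v. v \<in> {m..M} \<Longrightarrow> (W has_real_derivative - cs v) (at v)"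
    and cs: "\<And>v w. v \<in> {m..M} \<Longrightarrow> w \<in> {m..M} \<Longrightarrow> \<bar>cs v - cs w\<bar> \<le> B * \<bar>v - w\<bar>"
      "\<And>v. v \<in> {m..M} \<Longrightarrow> \<bar>cs v\<bar> \<le> C"
    and X: "\<And>t. t \<in> {t1<..<t2} \<Longrightarrow> (X has_real_derivative \<sigma> * cs (\<tau> (X t) t)) (at t)"
      "\<And>t. t \<in> {t1<..<t2} \<Longrightarrow> a + \<epsilon> \<le> X t \<and> X t \<le> b - \<epsilon>"
  shows "((\<lambda>t. u (X t) t + \<sigma> * W (\<tau> (X t) t)) has_real_derivative 0) (at t0)"
proof -
  have \<sigma>2: "\<sigma> * \<sigma> = 1" "\<bar>\<sigma>\<bar> = 1" using \<sigma> by auto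
  have t12: "t1 < t2" using t0 by simp
  have L0: "0 \<le> L"
  proof -
    have "0 \<le> L * (\<bar>a - b\<bar> + \<bar>t1 - t1\<bar>)"
      using lipschitz_rectD[OF lip(1), of a b t1 t1] ab t12 by auto
    then show ?thesis using ab by (simp add: zero_le_mult_iff)
  qed
  have inI: "t \<in> {t1..t2}" "X t \<in> {a..b}" "\<tau> (X t) t \<in> {m..M}" if "t \<in> {t1<..<t2}" for t
  proof -
    show *: "t \<in> {t1..t2}" using that by auto
    show **: "X t \<in> {a..b}" using X(2)[OF that] \<epsilon> by auto
    show "\<tau> (X t) t \<in> {m..M}" by (rule rng[OF ** *])
  qed
  have C0: "0 \<le> C" using cs(2)[OF inI(3)[OF t0]] by linarith
  have mM: "m \<le> M" using inI(3)[OF t0] by simp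
  have B0: "0 \<le> \<bar>B\<bar>" by simp
  have csB: "\<bar>cs v - cs w\<bar> \<le> \<bar>B\<bar> * \<bar>v - w\<bar>" if "v \<in> {m..M}" "w \<in> {m..M}" for v w
    using cs(1)[OF that] mult_right_mono[of B "\<bar>B\<bar>" "\<bar>v - w\<bar>"] by linarith
  have mvt: "\<exists>\<xi>\<in>{m..M}. \<bar>\<xi> - v\<bar> \<le> \<bar>w - v\<bar> \<and> F w - F v = F' \<xi> * (w - v)"
    if F: "\<And>v. v \<in> {m..M} \<Longrightarrow> (F has_real_derivative F' v) (at v)"
      and vw: "v \<in> {m..M}" "w \<in> {m..M}" for F F' :: "real \<Rightarrow> real" and v w
  proof (cases v w rule: linorder_cases)
    case less
    have "DERIV F z :> F' z" if "v \<le> z" "z \<le> w" for z using F[of z] vw that by auto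
    from MVT2[OF less this] obtain z where "v < z" "z < w" "F w - F v = (w - v) * F' z" by auto
    then show ?thesis using vw by (intro bexI[of _ z]) auto
  next
    case greater
    have "DERIV F z :> F' z" if "w \<le> z" "z \<le> v" for z using F[of z] vw that by auto
    from MVT2[OF greater this] obtain z where "w < z" "z < v" "F v - F w = (v - w) * F' z" by auto
    then show ?thesis using vw by (intro bexI[of _ z]) (auto simp: algebra_simps)
  qed (use vw in auto)
  define c0 where "c0 = cs (\<tau> (X t0) t0)"
  define q where "q x t = u x t - \<sigma> * c0 * \<tau> x t" for x t
  have X_lip: "\<bar>X t - X t0\<bar> \<le> C * \<bar>t - t0\<bar>" if t: "t \<in> {t1<..<t2}" for t
  proof -
    have *: "\<bar>X e - X d\<bar> \<le> C * e - C * d" if "d \<le> e" "d \<in> {t1<..<t2}" "e \<in> {t1<..<t2}" for d e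
    proof (rule abs_diff_le_of_derivative_bound[OF \<open>d \<le> e\<close>, where \<phi>' = "\<lambda>_. C"])
      show "(X has_real_derivative \<sigma> * cs (\<tau> (X s) s)) (at s within {d..e})" if "d \<le> s" "s \<le> e" for s
        by (rule has_field_derivative_at_within[OF X(1)]) (use that \<open>d \<in> _\<close> \<open>e \<in> _\<close> in auto)
      show "\<bar>\<sigma> * cs (\<tau> (X s) s)\<bar> \<le> C" if "d < s" "s < e" for s
        using cs(2)[OF inI(3)[of s]] that \<open>d \<in> _\<close> \<open>e \<in> _\<close> by (auto simp: abs_mult \<sigma>2)
    qed (auto intro!: derivative_eq_intros)
    show ?thesis
      using *[of t0 t] *[of t t0] t t0 by (cases "t0 \<le> t") (auto simp: algebra_simps abs_minus_commute)
  qed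
  define D where "D = L * (C + 1)"
  have D0: "0 \<le> D" using L0 C0 by (simp add: D_def)
  have along: "\<bar>\<tau> (X t) t - \<tau> (X t0) t0\<bar> \<le> D * \<bar>t - t0\<bar>" if "t \<in> {t1<..<t2}" for t
  proof -
    have "\<bar>\<tau> (X t) t - \<tau> (X t0) t0\<bar> \<le> L * (\<bar>X t - X t0\<bar> + \<bar>t - t0\<bar>)"
      by (rule lipschitz_rectD[OF lip(1)]) (use inI that t0 in blast)+
    also have "\<dots> \<le> L * (C * \<bar>t - t0\<bar> + \<bar>t - t0\<bar>)"
      using X_lip[OF that] L0 by (intro mult_left_mono) auto
    finally show ?thesis by (simp add: D_def algebra_simps)
  qed
  define \<kappa> where "\<kappa> = \<bar>B\<bar> * D"
  have \<kappa>0: "0 \<le> \<kappa>" using D0 by (simp add: \<kappa>_def)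
  have cs_along: "\<bar>cs (\<tau> (X t) t) - c0\<bar> \<le> \<kappa> * \<bar>t - t0\<bar>" if "t \<in> {t1<..<t2}" for t
    using csB[OF inI(3)[OF that] inI(3)[OF t0]] mult_left_mono[OF along[OF that] B0]
    by (simp add: c0_def \<kappa>_def mult.assoc)

  obtain \<Phi> where \<Phi>: "((\<lambda>(x, t). \<Phi> x t) has_derivative (\<lambda>(h, k). u x t * h - P (\<tau> x t) * k))
      (at (x, t) within {a..b} \<times> {t1..t2})" if "x \<in> {a..b}" "t \<in> {t1..t2}" for x t
  proof (rule potential_exists[OF ab t12 _ _ bal(2)])
    have "continuous_on {m..M} P"
      by (rule DERIV_continuous_on) (use P has_field_derivative_at_within in blast)
    then have "continuous_on ({a..b} \<times> {t1..t2}) (\<lambda>p. P ((\<lambda>(x, t). \<tau> x t) p))"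
      by (rule continuous_on_compose2[OF _ continuous_on_lipschitz_rect[OF lip(1)]]) (use rng in auto)
    then show "continuous_on ({a..b} \<times> {t1..t2}) (\<lambda>(x, t). P (\<tau> x t))"
      by (simp add: case_prod_unfold)
  qed (use continuous_on_lipschitz_rect[OF lip(2)] in auto)
  obtain \<Psi> where \<Psi>: "((\<lambda>(x, t). \<Psi> x t) has_derivative (\<lambda>(h, k). \<tau> x t * h - (- u x t) * k))
      (at (x, t) within {a..b} \<times> {t1..t2})" if "x \<in> {a..b}" "t \<in> {t1..t2}" for x t
  proof (rule potential_exists[OF ab t12 _ _ bal(1)])
    show "continuous_on ({a..b} \<times> {t1..t2}) (\<lambda>(x, t). - u x t)"
      using continuous_on_minus[OF continuous_on_lipschitz_rect[OF lip(2)]] by (simp add: case_prod_unfold)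
  qed (use continuous_on_lipschitz_rect[OF lip(1)] in auto)
  \<comment> \<open>A potential of the balance law with density \<open>q\<close>: its derivative in
    \<open>x\<close> is \<open>q\<close>, and \<open>E\<close> is its derivative along the
    characteristic shifted by \<open>h\<close>.\<close>
  define \<Theta> where "\<Theta> x t = \<Phi> x t - \<sigma> * c0 * \<Psi> x t" for x t
  define E where "E h s = \<sigma> * (cs (\<tau> (X s) s) - c0) * u (X s + h) s
      - c0 * cs (\<tau> (X s) s) * \<tau> (X s + h) s - P (\<tau> (X s + h) s)" for h s
  have shift: "X s + h \<in> {a<..<b}" if "\<bar>h\<bar> < \<epsilon>" "s \<in> {t1<..<t2}" for h s
    using X(2)[OF that(2)] that(1) by (auto simp: abs_less_iff)
  have d\<Theta>: "((\<lambda>s. \<Theta> (X s + h) s) has_real_derivative E h s) (at s)"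
    if h: "\<bar>h\<bar> < \<epsilon>" "s \<in> {t1<..<t2}" for h s
  proof -
    have in1: "X s + h \<in> {a..b}" using shift[OF h] by auto
    have in2: "t1 < s" "s < t2" "a < X s + h" "X s + h < b" using h shift[OF h] by auto
    have "((\<lambda>s. \<Phi> (X s + h) s - \<sigma> * c0 * \<Psi> (X s + h) s) has_real_derivative
        (u (X s + h) s * (\<sigma> * cs (\<tau> (X s) s)) - P (\<tau> (X s + h) s))
        - \<sigma> * c0 * (\<tau> (X s + h) s * (\<sigma> * cs (\<tau> (X s) s)) - (- u (X s + h) s))) (at s)"
      by (intro DERIV_diff DERIV_cmult has_derivative_along_curve[OF \<Phi> X(1)]
          has_derivative_along_curve[OF \<Psi> X(1)] in1 in2 h inI(1))
    also have "(u (X s + h) s * (\<sigma> * cs (\<tau> (X s) s)) - P (\<tau> (X s + h) s))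
        - \<sigma> * c0 * (\<tau> (X s + h) s * (\<sigma> * cs (\<tau> (X s) s)) - (- u (X s + h) s))
      = \<sigma> * (cs (\<tau> (X s) s) - c0) * u (X s + h) s
        - (\<sigma> * \<sigma>) * c0 * cs (\<tau> (X s) s) * \<tau> (X s + h) s - P (\<tau> (X s + h) s)"
      by (simp add: algebra_simps)
    finally show ?thesis by (simp add: \<Theta>_def E_def \<sigma>2)
  qed
  define K where "K = L * \<kappa> + 2 * C * \<bar>B\<bar> * L * L + C * \<kappa> * L"
  have K0: "0 \<le> K" using L0 C0 \<kappa>0 by (simp add: K_def)
  \<comment> \<open>\<open>P\<close> has slope \<open>- (cs \<xi>)\<^sup>2\<close>, which
    \<open>c0 * cc\<close> matches up to order \<open>\<bar>h\<bar> + \<bar>s - t0\<bar>\<close>,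
    because the sound speed varies by at most that much along and across the curve; the increment of
    \<tau> supplies the further factor \<open>\<bar>h\<bar>\<close>.\<close>
  have dE: "\<bar>E h s - E 0 s\<bar> \<le> K * \<bar>h\<bar> * (\<bar>h\<bar> + \<bar>s - t0\<bar>)" if h: "\<bar>h\<bar> < \<epsilon>" and s: "s \<in> {t1<..<t2}" for h s
  proof -
    define cc th tt where defs: "cc = cs (\<tau> (X s) s)" "th = \<tau> (X s + h) s" "tt = \<tau> (X s) s"
    have in1: "X s + h \<in> {a..b}" using shift[OF h s] by auto
    have lu: "\<bar>u (X s + h) s - u (X s) s\<bar> \<le> L * \<bar>h\<bar>"
      using lipschitz_rectD[OF lip(2) in1 inI(2)[OF s] inI(1)[OF s] inI(1)[OF s]] by simp
    have lt: "\<bar>th - tt\<bar> \<le> L * \<bar>h\<bar>"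
      using lipschitz_rectD[OF lip(1) in1 inI(2)[OF s] inI(1)[OF s] inI(1)[OF s]] by (simp add: defs)
    have rg: "tt \<in> {m..M}" "th \<in> {m..M}"
      unfolding defs using rng[OF in1 inI(1)[OF s]] inI(3)[OF s] by auto
    obtain \<xi> where \<xi>: "\<xi> \<in> {m..M}" "\<bar>\<xi> - tt\<bar> \<le> \<bar>th - tt\<bar>" "P th - P tt = - (cs \<xi>)\<^sup>2 * (th - tt)"
      using mvt[OF P rg] by blast
    have 1: "\<bar>cs \<xi> - cc\<bar> \<le> \<bar>B\<bar> * (L * \<bar>h\<bar>)"
    proof -
      have "\<bar>cs \<xi> - cc\<bar> \<le> \<bar>B\<bar> * \<bar>\<xi> - tt\<bar>" using csB[OF \<xi>(1) rg(1)] by (simp add: defs)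
      also have "\<dots> \<le> \<bar>B\<bar> * (L * \<bar>h\<bar>)" using \<xi>(2) lt by (intro mult_left_mono) auto
      finally show ?thesis .
    qed
    have 2: "\<bar>cc - c0\<bar> \<le> \<kappa> * \<bar>s - t0\<bar>" using cs_along[OF s] by (simp add: defs)
    have 12: "\<bar>cs \<xi> - c0\<bar> \<le> \<bar>B\<bar> * (L * \<bar>h\<bar>) + \<kappa> * \<bar>s - t0\<bar>" using 1 2 by linarith
    have 3: "\<bar>cs \<xi>\<bar> \<le> C" "\<bar>cc\<bar> \<le> C" using cs(2) \<xi>(1) rg(1) by (auto simp: defs)
    have "\<bar>(cs \<xi>)\<^sup>2 - c0 * cc\<bar> \<le> C * (\<bar>B\<bar> * (L * \<bar>h\<bar>)) + C * (\<bar>B\<bar> * (L * \<bar>h\<bar>) + \<kappa> * \<bar>s - t0\<bar>)"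
    proof -
      have "(cs \<xi>)\<^sup>2 - c0 * cc = cs \<xi> * (cs \<xi> - cc) + cc * (cs \<xi> - c0)"
        by (simp add: power2_eq_square algebra_simps)
      also have "\<bar>\<dots>\<bar> \<le> \<bar>cs \<xi>\<bar> * \<bar>cs \<xi> - cc\<bar> + \<bar>cc\<bar> * \<bar>cs \<xi> - c0\<bar>"
        using abs_triangle_ineq by (simp flip: abs_mult)
      also have "\<dots> \<le> C * (\<bar>B\<bar> * (L * \<bar>h\<bar>)) + C * (\<bar>B\<bar> * (L * \<bar>h\<bar>) + \<kappa> * \<bar>s - t0\<bar>)"
        using 1 12 3 C0 by (intro add_mono mult_mono) auto
      finally show ?thesis .
    qed
    then have 4: "\<bar>(cs \<xi>)\<^sup>2 - c0 * cc\<bar> * \<bar>th - tt\<bar>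
        \<le> (C * (\<bar>B\<bar> * (L * \<bar>h\<bar>)) + C * (\<bar>B\<bar> * (L * \<bar>h\<bar>) + \<kappa> * \<bar>s - t0\<bar>)) * (L * \<bar>h\<bar>)"
      using lt by (rule mult_mono) (use C0 L0 \<kappa>0 in auto)
    have 5: "\<bar>cc - c0\<bar> * \<bar>u (X s + h) s - u (X s) s\<bar> \<le> (\<kappa> * \<bar>s - t0\<bar>) * (L * \<bar>h\<bar>)"
      using 2 lu by (rule mult_mono) (use \<kappa>0 in auto)
    have "E h s - E 0 s = \<sigma> * ((cc - c0) * (u (X s + h) s - u (X s) s))
        + ((cs \<xi>)\<^sup>2 - c0 * cc) * (th - tt)"
      using \<xi>(3) unfolding E_def by (simp add: defs algebra_simps)
    also have "\<bar>\<dots>\<bar> \<le> \<bar>cc - c0\<bar> * \<bar>u (X s + h) s - u (X s) s\<bar> + \<bar>(cs \<xi>)\<^sup>2 - c0 * cc\<bar> * \<bar>th - tt\<bar>"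
      by (rule order.trans[OF abs_triangle_ineq]) (simp add: abs_mult \<sigma>2)
    also have "\<dots> \<le> (\<kappa> * \<bar>s - t0\<bar>) * (L * \<bar>h\<bar>)
        + (C * (\<bar>B\<bar> * (L * \<bar>h\<bar>)) + C * (\<bar>B\<bar> * (L * \<bar>h\<bar>) + \<kappa> * \<bar>s - t0\<bar>)) * (L * \<bar>h\<bar>)"
      using 4 5 by linarith
    also have "\<dots> = (2 * C * \<bar>B\<bar> * L * L) * (\<bar>h\<bar> * \<bar>h\<bar>) + (L * \<kappa> + C * \<kappa> * L) * (\<bar>h\<bar> * \<bar>s - t0\<bar>)"
      by (simp add: algebra_simps)
    also have "\<dots> \<le> K * (\<bar>h\<bar> * \<bar>h\<bar>) + K * (\<bar>h\<bar> * \<bar>s - t0\<bar>)"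
      unfolding K_def using L0 C0 \<kappa>0 by (intro add_mono mult_right_mono) auto
    finally show ?thesis by (simp add: algebra_simps)
  qed
  define G where "G h t = \<Theta> (X t + h) t - \<Theta> (X t) t" for h t
  have dG: "(G h has_real_derivative E h s - E 0 s) (at s within A)"
    if "\<bar>h\<bar> < \<epsilon>" "s \<in> {t1<..<t2}" for h s A
    unfolding G_def
    by (rule has_field_derivative_at_within, rule DERIV_diff) (use d\<Theta>[OF that] d\<Theta>[of 0 s] that(2) \<epsilon> in auto)
  have G: "\<bar>G h t - G h t0\<bar> \<le> K * \<bar>h\<bar> * (\<bar>h\<bar> + \<bar>t - t0\<bar>) * \<bar>t - t0\<bar>" if h: "\<bar>h\<bar> < \<epsilon>" and t: "t \<in> {t1<..<t2}" for h t
  proof -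
    let ?k = "K * \<bar>h\<bar> * (\<bar>h\<bar> + \<bar>t - t0\<bar>)"
    have *: "\<bar>G h d - G h e\<bar> \<le> ?k * d - ?k * e"
      if "e \<le> d" and de: "e \<in> {t1<..<t2}" "d \<in> {t1<..<t2}"
        "\<And>s. e \<le> s \<Longrightarrow> s \<le> d \<Longrightarrow> \<bar>s - t0\<bar> \<le> \<bar>t - t0\<bar>" for d e
    proof (rule abs_diff_le_of_derivative_bound[OF \<open>e \<le> d\<close> dG, where \<phi>' = "\<lambda>_. ?k"])
      show "((*) ?k has_real_derivative ?k) (at s within {e..d})" for s
        by (auto intro!: derivative_eq_intros)
      show "\<bar>E h s - E 0 s\<bar> \<le> ?k" if "e < s" "s < d" for s
      proof (rule order.trans[OF dE[OF h]])
        show "s \<in> {t1<..<t2}" using that de by auto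
        show "K * \<bar>h\<bar> * (\<bar>h\<bar> + \<bar>s - t0\<bar>) \<le> ?k"
          using de(3)[of s] that K0 by (intro mult_left_mono) auto
      qed
    qed (use h de in auto)
    show ?thesis
    proof (cases "t0 \<le> t")
      case True
      have "\<bar>G h t - G h t0\<bar> \<le> ?k * t - ?k * t0"
        by (rule *[OF True t0 t]) (use True in auto)
      also have "\<dots> = ?k * \<bar>t - t0\<bar>" using True by (simp add: algebra_simps)
      finally show ?thesis .
    next
      case False
      then have le: "t \<le> t0" by simp
      have "\<bar>G h t0 - G h t\<bar> \<le> ?k * t0 - ?k * t"
        by (rule *[OF le t t0]) (use le in auto)
      also have "\<dots> = ?k * \<bar>t - t0\<bar>" using le by (simp add: right_diff_distrib)
      finally show ?thesis by (simp add: abs_minus_commute)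
    qed
  qed
  \<comment> \<open>The increments of \<open>G h\<close> are time integrals of
    \<open>E h - E 0\<close>. Dividing by \<open>h\<close> and letting \<open>h\<close> tend to
    \<open>0\<close> recovers \<open>q\<close> on the curve and removes \<open>\<bar>h\<bar>\<close>
    from the bound, which leaves a bound quadratic in \<open>t - t0\<close>.\<close>
  have lim_G: "((\<lambda>h. G h t / h) \<longlongrightarrow> q (X t) t) (at 0)" if t: "t \<in> {t1<..<t2}" for t
  proof -
    have X_in: "X t \<in> {a<..<b}" using shift[of 0 t] t \<epsilon> by simp
    have int: "(X t, t) \<in> interior ({a..b} \<times> {t1..t2})"
      using X_in t by (simp add: interior_Times)
    have line: "((\<lambda>x. (x, t)) has_derivative (\<lambda>k. (k, 0))) (at (X t))"
      by (auto intro!: derivative_eq_intros)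
    have "((\<lambda>x. \<Phi> x t) has_real_derivative u (X t) t) (at (X t))"
      using has_derivative_compose[OF line \<Phi>[OF inI(2)[OF t] inI(1)[OF t], unfolded at_within_interior[OF int]]]
      by (simp add: has_field_derivative_def)
    moreover have "((\<lambda>x. \<Psi> x t) has_real_derivative \<tau> (X t) t) (at (X t))"
      using has_derivative_compose[OF line \<Psi>[OF inI(2)[OF t] inI(1)[OF t], unfolded at_within_interior[OF int]]]
      by (simp add: has_field_derivative_def)
    ultimately have "((\<lambda>x. \<Theta> x t) has_real_derivative q (X t) t) (at (X t))"
      unfolding \<Theta>_def q_def by (intro DERIV_diff DERIV_cmult)
    then show ?thesis by (simp add: DERIV_def G_def)
  qed
  have dq: "\<bar>q (X t) t - q (X t0) t0\<bar> \<le> K * (t - t0)\<^sup>2" if t: "t \<in> {t1<..<t2}" for t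
  proof (rule tendsto_le)
    show "((\<lambda>h. \<bar>G h t / h - G h t0 / h\<bar>) \<longlongrightarrow> \<bar>q (X t) t - q (X t0) t0\<bar>) (at 0)"
      by (intro tendsto_rabs tendsto_diff lim_G t t0)
    show "((\<lambda>h. K * (\<bar>h\<bar> + \<bar>t - t0\<bar>) * \<bar>t - t0\<bar>) \<longlongrightarrow> K * (t - t0)\<^sup>2) (at 0)"
      by (rule tendsto_eq_intros refl | simp add: power2_eq_square mult.assoc)+
    have "\<forall>\<^sub>F h in at (0::real). \<bar>h\<bar> < \<epsilon> \<and> h \<noteq> 0"
      using eventually_at_in_open[of "{-\<epsilon><..<\<epsilon>}" "0::real"] \<epsilon> by (auto elim!: eventually_mono)
    then show "\<forall>\<^sub>F h in at 0. \<bar>G h t / h - G h t0 / h\<bar> \<le> K * (\<bar>h\<bar> + \<bar>t - t0\<bar>) * \<bar>t - t0\<bar>"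
    proof eventually_elim
      case (elim h)
      then have "\<bar>G h t / h - G h t0 / h\<bar> = \<bar>G h t - G h t0\<bar> / \<bar>h\<bar>"
        by (simp add: abs_divide flip: diff_divide_distrib)
      also have "\<dots> \<le> K * \<bar>h\<bar> * (\<bar>h\<bar> + \<bar>t - t0\<bar>) * \<bar>t - t0\<bar> / \<bar>h\<bar>"
        using G[OF _ t] elim by (intro divide_right_mono) auto
      finally show ?case using elim by simp
    qed
  qed simp
  show ?thesis
  proof (rule has_derivative_zero_of_quadratic_bound[OF t0])
    fix t assume t: "t \<in> {t1<..<t2}"
    define v w where vw: "v = \<tau> (X t0) t0" "w = \<tau> (X t) t"
    have rg: "v \<in> {m..M}" "w \<in> {m..M}" using inI(3) t t0 by (auto simp: vw)
    obtain \<xi> where \<xi>: "\<xi> \<in> {m..M}" "\<bar>\<xi> - v\<bar> \<le> \<bar>w - v\<bar>" "W w - W v = - cs \<xi> * (w - v)"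
      using mvt[OF W rg] by blast
    have wv: "\<bar>w - v\<bar> \<le> D * \<bar>t - t0\<bar>" using along[OF t] by (simp add: vw)
    have "\<bar>c0 - cs \<xi>\<bar> \<le> \<bar>B\<bar> * \<bar>w - v\<bar>"
      using csB[OF rg(1) \<xi>(1)] mult_left_mono[OF \<xi>(2) B0] by (simp add: c0_def vw abs_minus_commute)
    then have "\<bar>c0 - cs \<xi>\<bar> * \<bar>w - v\<bar> \<le> (\<bar>B\<bar> * \<bar>w - v\<bar>) * \<bar>w - v\<bar>"
      by (rule mult_right_mono) simp
    also have "\<dots> \<le> (\<bar>B\<bar> * (D * \<bar>t - t0\<bar>)) * (D * \<bar>t - t0\<bar>)"
      using wv D0 by (intro mult_mono) auto
    also have "\<dots> = \<bar>B\<bar> * D\<^sup>2 * (t - t0)\<^sup>2"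
      by (simp add: power2_eq_square mult_ac)
    finally have 1: "\<bar>c0 - cs \<xi>\<bar> * \<bar>w - v\<bar> \<le> \<bar>B\<bar> * D\<^sup>2 * (t - t0)\<^sup>2" .
    \<comment> \<open>Unfreezing \<open>c0\<close>: as \<open>W\<close> has slope
      \<open>- cs\<close>, the increment of \<open>W\<close> is \<open>- c0 * (w - v)\<close> up to
      a multiple of \<open>(w - v)\<^sup>2\<close>.\<close>
    have "(u (X t) t + \<sigma> * W (\<tau> (X t) t)) - (u (X t0) t0 + \<sigma> * W (\<tau> (X t0) t0))
        = (q (X t) t - q (X t0) t0) + \<sigma> * ((W w - W v) + c0 * (w - v))"
      by (simp add: q_def vw algebra_simps)
    also have "\<dots> = (q (X t) t - q (X t0) t0) + \<sigma> * ((c0 - cs \<xi>) * (w - v))"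
      unfolding \<xi>(3) by (simp add: algebra_simps)
    also have "\<bar>\<dots>\<bar> \<le> \<bar>q (X t) t - q (X t0) t0\<bar> + \<bar>c0 - cs \<xi>\<bar> * \<bar>w - v\<bar>"
      by (rule order.trans[OF abs_triangle_ineq]) (simp add: abs_mult \<sigma>2)
    also have "\<dots> \<le> (K + \<bar>B\<bar> * D\<^sup>2) * (t - t0)\<^sup>2"
      using dq[OF t] 1 by (simp add: algebra_simps)
    finally show "\<bar>(u (X t) t + \<sigma> * W (\<tau> (X t) t)) - (u (X t0) t0 + \<sigma> * W (\<tau> (X t0) t0))\<bar>
        \<le> (K + \<bar>B\<bar> * D\<^sup>2) * (t - t0)\<^sup>2" .
  qed
qed


section \<open>The strip in Riemann invariants\<close>

text \<open>The strip between the contacts in terms of the Riemann invariants \<open>s = u + m z\<close> and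
  \<open>r = u - m z\<close>, where the sound speed is \<open>F (s - r)\<close>.  Both are extended to all \<open>x\<close> by their
  boundary values, so that characteristics never end.  The exchange
  \<open>x \<leftrightarrow> x0 + x1 - x\<close>, \<open>s \<leftrightarrow> - r\<close> is a symmetry; results are stated for forward
  characteristics and transferred by it.\<close>

locale strip =
  fixes x0 x1 \<eta> A B :: real and F :: "real \<Rightarrow> real" and s r :: "real \<Rightarrow> real \<Rightarrow> real"
  assumes x01: "x0 < x1" and \<eta>: "0 < \<eta>" "\<eta> < 1"
    and F_pos: "0 < y \<Longrightarrow> 0 < F y"
    and F_less: "0 < y \<Longrightarrow> y < y' \<Longrightarrow> F y < F y'"
    and F_lip: "0 < a \<Longrightarrow> \<exists>L. \<forall>y\<in>{a..b}. \<forall>y'\<in>{a..b}. \<bar>F y - F y'\<bar> \<le> L * \<bar>y - y'\<bar>"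
    and lip: "0 < a \<Longrightarrow> a \<le> b \<Longrightarrow> \<exists>L. lipschitz_rect L UNIV {a..b} s \<and> lipschitz_rect L UNIV {a..b} r"
    and gap: "\<exists>k>0. \<forall>x. \<forall>t\<in>{0<..T}. k \<le> s x t - r x t"
    and bdd: "\<exists>M. \<forall>x. \<forall>t\<in>{0<..T}. \<bar>s x t\<bar> \<le> M \<and> \<bar>r x t\<bar> \<le> M"
    and init_s: "x \<in> {x0<..<x1} \<Longrightarrow> ((\<lambda>(y, t). s y t) \<longlongrightarrow> s x 0) (at (x, 0) within UNIV \<times> {0<..})"
    and init_r: "x \<in> {x0<..<x1} \<Longrightarrow> ((\<lambda>(y, t). r y t) \<longlongrightarrow> r x 0) (at (x, 0) within UNIV \<times> {0<..})"
    and init_mono: "x0 < x \<Longrightarrow> x \<le> y \<Longrightarrow> y < x1 \<Longrightarrow> s x 0 \<le> s y 0 \<and> r x 0 \<le> r y 0"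
    and inv_s: "0 \<le> a \<Longrightarrow>
      (\<And>\<tau>. \<tau> \<in> {a<..<b} \<Longrightarrow> x0 < X \<tau> \<and> X \<tau> < x1 \<and>
        (X has_real_derivative F (s (X \<tau>) \<tau> - r (X \<tau>) \<tau>)) (at \<tau>)) \<Longrightarrow>
      t \<in> {a<..<b} \<Longrightarrow> ((\<lambda>\<tau>. s (X \<tau>) \<tau>) has_real_derivative 0) (at t)"
    and inv_r: "0 \<le> a \<Longrightarrow>
      (\<And>\<tau>. \<tau> \<in> {a<..<b} \<Longrightarrow> x0 < X \<tau> \<and> X \<tau> < x1 \<and>
        (X has_real_derivative - F (s (X \<tau>) \<tau> - r (X \<tau>) \<tau>)) (at \<tau>)) \<Longrightarrow>
      t \<in> {a<..<b} \<Longrightarrow> ((\<lambda>\<tau>. r (X \<tau>) \<tau>) has_real_derivative 0) (at t)"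
    and bc0: "0 < t \<Longrightarrow> s x0 t = - \<eta> * r x0 t + (1 + \<eta>) * A"
    and bc1: "0 < t \<Longrightarrow> r x1 t = - \<eta> * s x1 t + (1 + \<eta>) * B"
begin

definition c where "c x t = F (s x t - r x t)"

definition fwd :: "(real \<Rightarrow> real) \<Rightarrow> bool" where
  "fwd X \<longleftrightarrow> (\<forall>t>0. (X has_real_derivative c (X t) t) (at t))"

text \<open>The part of a curve on which \<open>s\<close> is invariant. Only the interior is asked
  to be characteristic, so a leg between two reflections also qualifies, although the reflected
  curve turns round at its ends.\<close>

definition arc :: "(real \<Rightarrow> real) \<Rightarrow> real \<Rightarrow> real \<Rightarrow> bool" where
  "arc X t1 t2 \<longleftrightarrow> continuous_on {t1..t2} X \<and>
    (\<forall>t\<in>{t1<..<t2}. x0 < X t \<and> X t < x1 \<and> (X has_real_derivative c (X t) t) (at t))"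

text \<open>As \<open>A\<close> and \<open>B\<close> become \<open>- B\<close> and
  \<open>- A\<close>, the difference \<open>A - B\<close> and hence the case at hand are
  preserved.\<close>

lemma mirror: "strip x0 x1 \<eta> (- B) (- A) F (\<lambda>x t. - r (x0 + x1 - x) t) (\<lambda>x t. - s (x0 + x1 - x) t)"
proof -
  have refl_lim: "filterlim (\<lambda>(y, t). (x0 + x1 - y, t)) (at (x0 + x1 - x, 0) within UNIV \<times> {0<..})
      (at (x, 0) within UNIV \<times> {0::real<..})" for x :: real
  proof (rule filterlim_at_withinI)
    have "((\<lambda>p. (x0 + x1 - fst p, snd p)) \<longlongrightarrow> (x0 + x1 - fst (x, 0::real), snd (x, 0::real)))
        (at (x, 0) within UNIV \<times> {0<..})"
      by (intro tendsto_intros)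
    then show "((\<lambda>(y, t). (x0 + x1 - y, t)) \<longlongrightarrow> (x0 + x1 - x, 0)) (at (x, 0) within UNIV \<times> {0::real<..})"
      by (simp add: case_prod_unfold)
    show "\<forall>\<^sub>F p in at (x, 0) within UNIV \<times> {0::real<..}. (case p of (y, t) \<Rightarrow> (x0 + x1 - y, t)) \<in> UNIV \<times> {0<..} - {(x0 + x1 - x, 0)}"
      unfolding eventually_at_filter by (rule always_eventually) auto
  qed
  have lim: "((\<lambda>(y, t). - f (x0 + x1 - y) t) \<longlongrightarrow> - f (x0 + x1 - x) 0) (at (x, 0) within UNIV \<times> {0<..})"
    if "((\<lambda>(y, t). f y t) \<longlongrightarrow> f (x0 + x1 - x) 0) (at (x0 + x1 - x, 0) within UNIV \<times> {0<..})"
    for f :: "real \<Rightarrow> real \<Rightarrow> real" and x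
    using tendsto_minus[OF filterlim_compose[OF that refl_lim]] by (simp add: case_prod_unfold)
  have lr: "lipschitz_rect L UNIV T (\<lambda>x t. - f (x0 + x1 - x) t)" if "lipschitz_rect L UNIV T f" for L T f
    unfolding lipschitz_rect_def
  proof (intro ballI)
    fix x y s t assume "s \<in> T" "t \<in> T"
    from lipschitz_rectD[OF that UNIV_I UNIV_I this, of "x0 + x1 - x" "x0 + x1 - y"]
    show "\<bar>- f (x0 + x1 - x) s - - f (x0 + x1 - y) t\<bar> \<le> L * (\<bar>x - y\<bar> + \<bar>s - t\<bar>)"
      by (simp add: abs_minus_commute)
  qed
  show ?thesis
  proof
    show "\<exists>L. lipschitz_rect L UNIV {a..b} (\<lambda>x t. - r (x0 + x1 - x) t) \<and> lipschitz_rect L UNIV {a..b} (\<lambda>x t. - s (x0 + x1 - x) t)"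
      if "0 < a" "a \<le> b" for a b using lip[OF that] lr by blast
    show "\<exists>k>0. \<forall>x. \<forall>t\<in>{0<..T}. k \<le> - r (x0 + x1 - x) t - - s (x0 + x1 - x) t" for T
      using gap[of T] by (simp add: algebra_simps) blast
    show "\<exists>M. \<forall>x. \<forall>t\<in>{0<..T}. \<bar>- r (x0 + x1 - x) t\<bar> \<le> M \<and> \<bar>- s (x0 + x1 - x) t\<bar> \<le> M" for T
      using bdd[of T] by simp blast
    show "((\<lambda>(y, t). - r (x0 + x1 - y) t) \<longlongrightarrow> - r (x0 + x1 - x) 0) (at (x, 0) within UNIV \<times> {0<..})"
      "((\<lambda>(y, t). - s (x0 + x1 - y) t) \<longlongrightarrow> - s (x0 + x1 - x) 0) (at (x, 0) within UNIV \<times> {0<..})"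
      if "x \<in> {x0<..<x1}" for x
      using that by (auto intro!: lim init_s init_r)
    show "- r (x0 + x1 - x) 0 \<le> - r (x0 + x1 - y) 0 \<and> - s (x0 + x1 - x) 0 \<le> - s (x0 + x1 - y) 0"
      if "x0 < x" "x \<le> y" "y < x1" for x y
      using init_mono[of "x0 + x1 - y" "x0 + x1 - x"] that by simp
    show "((\<lambda>\<tau>. - r (x0 + x1 - X \<tau>) \<tau>) has_real_derivative 0) (at t)"
      if "0 \<le> a" and X: "\<And>\<tau>. \<tau> \<in> {a<..<b} \<Longrightarrow> x0 < X \<tau> \<and> X \<tau> < x1 \<and>
        (X has_real_derivative F (- r (x0 + x1 - X \<tau>) \<tau> - - s (x0 + x1 - X \<tau>) \<tau>)) (at \<tau>)"
        and "t \<in> {a<..<b}" for a b X t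
    proof -
      have "((\<lambda>\<tau>. r (x0 + x1 - X \<tau>) \<tau>) has_real_derivative 0) (at t)"
      proof (rule inv_r[OF \<open>0 \<le> a\<close> _ \<open>t \<in> _\<close>])
        fix \<tau> assume "\<tau> \<in> {a<..<b}"
        from X[OF this] show "x0 < x0 + x1 - X \<tau> \<and> x0 + x1 - X \<tau> < x1 \<and>
          ((\<lambda>\<tau>. x0 + x1 - X \<tau>) has_real_derivative - F (s (x0 + x1 - X \<tau>) \<tau> - r (x0 + x1 - X \<tau>) \<tau>)) (at \<tau>)"
          by (auto intro!: derivative_eq_intros)
      qed
      from DERIV_minus[OF this] show ?thesis by simp
    qed
    show "((\<lambda>\<tau>. - s (x0 + x1 - X \<tau>) \<tau>) has_real_derivative 0) (at t)"
      if "0 \<le> a" and X: "\<And>\<tau>. \<tau> \<in> {a<..<b} \<Longrightarrow> x0 < X \<tau> \<and> X \<tau> < x1 \<and>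
        (X has_real_derivative - F (- r (x0 + x1 - X \<tau>) \<tau> - - s (x0 + x1 - X \<tau>) \<tau>)) (at \<tau>)"
        and "t \<in> {a<..<b}" for a b X t
    proof -
      have "((\<lambda>\<tau>. s (x0 + x1 - X \<tau>) \<tau>) has_real_derivative 0) (at t)"
      proof (rule inv_s[OF \<open>0 \<le> a\<close> _ \<open>t \<in> _\<close>])
        fix \<tau> assume "\<tau> \<in> {a<..<b}"
        from X[OF this] show "x0 < x0 + x1 - X \<tau> \<and> x0 + x1 - X \<tau> < x1 \<and>
          ((\<lambda>\<tau>. x0 + x1 - X \<tau>) has_real_derivative F (s (x0 + x1 - X \<tau>) \<tau> - r (x0 + x1 - X \<tau>) \<tau>)) (at \<tau>)"
          by (auto intro!: derivative_eq_intros)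
      qed
      from DERIV_minus[OF this] show ?thesis by simp
    qed
    show "- r (x0 + x1 - x0) t = - \<eta> * - s (x0 + x1 - x0) t + (1 + \<eta>) * - B" if "0 < t" for t
      using bc1[OF that] by simp
    show "- s (x0 + x1 - x1) t = - \<eta> * - r (x0 + x1 - x1) t + (1 + \<eta>) * - A" if "0 < t" for t
      using bc0[OF that] by simp
  qed (use x01 \<eta> F_pos F_less F_lip in auto)
qed

lemma gap_pos:
  assumes "0 < t"
  shows "r x t < s x t"
proof -
  obtain k where "0 < k" "\<And>x \<tau>. \<tau> \<in> {0<..t} \<Longrightarrow> k \<le> s x \<tau> - r x \<tau>" using gap[of t] by blast
  from this(1) this(2)[of t x] assms show ?thesis by simp
qed

lemma c_pos: "0 < t \<Longrightarrow> 0 < c x t"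
  using F_pos gap_pos by (simp add: c_def)

lemma c_bdd: "\<exists>C>0. \<forall>x. \<forall>t\<in>{0<..T}. c x t \<le> C"
proof -
  obtain M where M: "\<bar>s x t\<bar> \<le> M \<and> \<bar>r x t\<bar> \<le> M" if "t \<in> {0<..T}" for x t using bdd[of T] by blast
  have "c x t \<le> F (2 * \<bar>M\<bar> + 1)" if "t \<in> {0<..T}" for x t
  proof -
    have "s x t - r x t < 2 * \<bar>M\<bar> + 1" using M[OF that, of x] by linarith
    then show ?thesis unfolding c_def using F_less gap_pos[of t x] that by (simp add: less_imp_le)
  qed
  moreover have "0 < F (2 * \<bar>M\<bar> + 1)" by (intro F_pos) simp
  ultimately show ?thesis by blast
qed

text \<open>\<open>gap\<close> and \<open>bdd\<close> confine \<open>s - r\<close> to a compact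
  interval of positive numbers, where \<open>F\<close> is Lipschitz. Times near \<open>0\<close> are
  excluded, since a fan may open there.\<close>

lemma c_lip:
  assumes "0 < a" "a \<le> b"
  shows "\<exists>L. lipschitz_rect L UNIV {a..b} c"
proof -
  obtain L where L: "lipschitz_rect L UNIV {a..b} s" "lipschitz_rect L UNIV {a..b} r"
    using lip[OF assms] by blast
  obtain k where k: "0 < k" "\<And>x t. t \<in> {0<..b} \<Longrightarrow> k \<le> s x t - r x t" using gap[of b] by blast
  obtain M where M: "\<bar>s x t\<bar> \<le> M \<and> \<bar>r x t\<bar> \<le> M" if "t \<in> {0<..b}" for x t using bdd[of b] by blast
  obtain N where N: "\<bar>F y - F y'\<bar> \<le> N * \<bar>y - y'\<bar>" if "y \<in> {k..2 * M}" "y' \<in> {k..2 * M}" for y y'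
    using F_lip[OF k(1), of "2 * M"] by blast
  have "lipschitz_rect (2 * \<bar>N\<bar> * L) UNIV {a..b} c"
    unfolding lipschitz_rect_def
  proof (intro ballI)
    fix x y t t' assume t: "t \<in> {a..b}" "t' \<in> {a..b}"
    have t': "t \<in> {0<..b}" "t' \<in> {0<..b}" using t assms by auto
    have in1: "s x t - r x t \<in> {k..2 * M}" using M[OF t'(1), of x] k(2)[OF t'(1), of x]
      by (auto simp: abs_le_iff)
    have in2: "s y t' - r y t' \<in> {k..2 * M}" using M[OF t'(2), of y] k(2)[OF t'(2), of y]
      by (auto simp: abs_le_iff)
    have *: "\<bar>(s x t - r x t) - (s y t' - r y t')\<bar> \<le> 2 * (L * (\<bar>x - y\<bar> + \<bar>t - t'\<bar>))"
      using lipschitz_rectD[OF L(1) UNIV_I UNIV_I t, of x y] lipschitz_rectD[OF L(2) UNIV_I UNIV_I t, of x y]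
      by linarith
    have "\<bar>c x t - c y t'\<bar> \<le> N * \<bar>(s x t - r x t) - (s y t' - r y t')\<bar>"
      unfolding c_def by (rule N[OF in1 in2])
    also have "\<dots> \<le> \<bar>N\<bar> * \<bar>(s x t - r x t) - (s y t' - r y t')\<bar>"
      by (intro mult_right_mono) auto
    also have "\<dots> \<le> \<bar>N\<bar> * (2 * (L * (\<bar>x - y\<bar> + \<bar>t - t'\<bar>)))"
      by (intro mult_left_mono *) auto
    finally show "\<bar>c x t - c y t'\<bar> \<le> 2 * \<bar>N\<bar> * L * (\<bar>x - y\<bar> + \<bar>t - t'\<bar>)" by (simp add: mult_ac)
  qed
  then show ?thesis by blast
qed

section \<open>Forward characteristics of the extended field\<close>

lemma fwd_exists:
  assumes "0 < t0"
  obtains X where "fwd X" "X t0 = x"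
proof (rule ode_exists[of c t0 x])
  show "\<exists>L. \<forall>x y. \<forall>s\<in>{a..b}. \<forall>t\<in>{a..b}. \<bar>c x s - c y t\<bar> \<le> L * (\<bar>x - y\<bar> + \<bar>s - t\<bar>)"
    if "0 < a" "a \<le> b" for a b
    using c_lip[OF that] by (auto simp: lipschitz_rect_def)
  show "\<exists>M. \<forall>x. \<forall>t\<in>{0<..b}. \<bar>c x t\<bar> \<le> M" for b
    using c_bdd[of b] c_pos by (metis abs_of_pos greaterThanAtMost_iff)
qed (use assms that in \<open>auto simp: fwd_def\<close>)

lemma fwd_DERIV: "fwd X \<Longrightarrow> 0 < t \<Longrightarrow> (X has_real_derivative c (X t) t) (at t)"
  by (simp add: fwd_def)

lemma fwd_isCont: "fwd X \<Longrightarrow> 0 < t \<Longrightarrow> isCont X t"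
  using fwd_DERIV DERIV_isCont by blast

lemma fwd_cont: "fwd X \<Longrightarrow> T \<subseteq> {0<..} \<Longrightarrow> continuous_on T X"
  by (meson continuous_at_imp_continuous_on fwd_isCont greaterThan_iff subsetD)

lemma fwd_less:
  assumes "fwd X" "0 < t" "t < t'"
  shows "X t < X t'"
proof (rule DERIV_pos_imp_increasing[OF \<open>t < t'\<close>])
  fix \<tau> assume "t \<le> \<tau>" "\<tau> \<le> t'"
  then have "0 < \<tau>" using assms by simp
  then show "\<exists>y. (X has_real_derivative y) (at \<tau>) \<and> 0 < y"
    using fwd_DERIV[OF assms(1)] c_pos by blast
qed

lemma fwd_le: "fwd X \<Longrightarrow> 0 < t \<Longrightarrow> t \<le> t' \<Longrightarrow> X t \<le> X t'"
  using fwd_less[of X t t'] by (cases "t = t'") auto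

text \<open>One \<open>L\<close> serves all pairs of characteristics; this uniformity lets a
  sequence of characteristics that converges to a characteristic at one time do so at the
  others.\<close>

lemma fwd_gronwall:
  assumes "0 < a" "a \<le> b"
  shows "\<exists>L. \<forall>X Y. fwd X \<longrightarrow> fwd Y \<longrightarrow> (\<forall>t\<in>{a..b}. \<forall>t'\<in>{a..b}.
    \<bar>X t - Y t\<bar> \<le> exp (L * \<bar>t - t'\<bar>) * \<bar>X t' - Y t'\<bar>)"
proof -
  obtain L where L: "lipschitz_rect L UNIV {a..b} c" using c_lip[OF assms] by blast
  show ?thesis
  proof (intro exI[of _ L] allI impI ballI)
    fix X Y t t' assume XY: "fwd X" "fwd Y" and t: "t \<in> {a..b}" "t' \<in> {a..b}"
    show "\<bar>X t - Y t\<bar> \<le> exp (L * \<bar>t - t'\<bar>) * \<bar>X t' - Y t'\<bar>"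
    proof (rule gronwall[OF _ _ _ t])
      show "(X has_real_derivative c (X \<tau>) \<tau>) (at \<tau> within {a..b})"
        "(Y has_real_derivative c (Y \<tau>) \<tau>) (at \<tau> within {a..b})" if "\<tau> \<in> {a..b}" for \<tau>
        by (rule has_field_derivative_at_within, rule fwd_DERIV, use that assms XY in auto)+
      show "\<bar>c (X \<tau>) \<tau> - c (Y \<tau>) \<tau>\<bar> \<le> L * \<bar>X \<tau> - Y \<tau>\<bar>" if "\<tau> \<in> {a..b}" for \<tau>
        using lipschitz_rectD[OF L UNIV_I UNIV_I that that] by simp
    qed
  qed
qed

lemma fwd_unique:
  assumes "fwd X" "fwd Y" "0 < t" "0 < t'" "X t' = Y t'"
  shows "X t = Y t"
proof -
  obtain L where "\<bar>X t - Y t\<bar> \<le> exp (L * \<bar>t - t'\<bar>) * \<bar>X t' - Y t'\<bar>"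
    using fwd_gronwall[of "min t t'" "max t t'"] assms by fastforce
  then show ?thesis using assms by simp
qed

lemma fwd_noncrossing:
  assumes XY: "fwd X" "fwd Y" and t: "0 < t" "0 < t'" and less: "X t' < Y t'"
  shows "X t < Y t"
proof (rule ccontr)
  assume "\<not> X t < Y t"
  have conn: "connected {min t t'..max t t'}" by simp
  have cont: "continuous_on {min t t'..max t t'} (\<lambda>\<tau>. Y \<tau> - X \<tau>)"
    by (intro continuous_on_diff fwd_cont XY) (use t in auto)
  have "connected ((\<lambda>\<tau>. Y \<tau> - X \<tau>) ` {min t t'..max t t'})"
    by (rule connected_continuous_image[OF cont conn])
  moreover have "Y t - X t \<in> (\<lambda>\<tau>. Y \<tau> - X \<tau>) ` {min t t'..max t t'}"
    "Y t' - X t' \<in> (\<lambda>\<tau>. Y \<tau> - X \<tau>) ` {min t t'..max t t'}" by auto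
  ultimately have "0 \<in> (\<lambda>\<tau>. Y \<tau> - X \<tau>) ` {min t t'..max t t'}"
    using less \<open>\<not> X t < Y t\<close> connectedD_interval by (smt (verit, best))
  then obtain \<tau> where "\<tau> \<in> {min t t'..max t t'}" "X \<tau> = Y \<tau>" by auto
  then have "X t' = Y t'" using fwd_unique[OF XY t(2), of \<tau>] t by auto
  with less show False by simp
qed

lemma fwd_speed:
  assumes "fwd X" "\<And>x t. t \<in> {0<..T} \<Longrightarrow> c x t \<le> C" "0 < t" "t \<le> t'" "t' \<le> T"
  shows "X t' - X t \<le> C * (t' - t)"
proof -
  have "\<bar>X t' - X t\<bar> \<le> C * t' - C * t"
  proof (rule abs_diff_le_of_derivative_bound[OF \<open>t \<le> t'\<close>, where \<phi>' = "\<lambda>_. C" and D' = "\<lambda>t. c (X t) t"])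
    show "(X has_real_derivative c (X \<tau>) \<tau>) (at \<tau> within {t..t'})" if "t \<le> \<tau>" for \<tau>
      by (rule has_field_derivative_at_within, rule fwd_DERIV) (use that assms in auto)
    show "\<bar>c (X \<tau>) \<tau>\<bar> \<le> C" if "t < \<tau>" "\<tau> < t'" for \<tau>
      using assms(2)[of \<tau> "X \<tau>"] c_pos[of \<tau> "X \<tau>"] that assms(3-) by auto
  qed (auto intro!: derivative_eq_intros)
  then show ?thesis by (simp add: algebra_simps)
qed

lemma cont_along:
  assumes "continuous_on {t1..t2} X" "0 < t1"
  shows "continuous_on {t1..t2} (\<lambda>t. s (X t) t)" "continuous_on {t1..t2} (\<lambda>t. r (X t) t)"
proof -
  have *: "continuous_on {t1..t2} (\<lambda>t. f (X t) t)" if "lipschitz_rect L UNIV {t1..t2} f" for f L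
  proof -
    have "continuous_on {t1..t2} (\<lambda>t. (X t, t))" by (intro continuous_intros assms)
    then have "continuous_on {t1..t2} (\<lambda>t. (\<lambda>(x, t). f x t) (X t, t))"
      by (rule continuous_on_compose2[OF continuous_on_lipschitz_rect[OF that]]) auto
    then show ?thesis by simp
  qed
  show "continuous_on {t1..t2} (\<lambda>t. s (X t) t)" "continuous_on {t1..t2} (\<lambda>t. r (X t) t)"
    using lip[of t1 t2] * assms by (cases "t1 \<le> t2"; force)+
qed

text \<open>\<open>inv_s\<close> applies in the open interval; continuity carries the constant to
  the ends, which may lie on the contacts.\<close>

lemma arc_const:
  assumes "arc X t1 t2" "0 < t1" "t \<in> {t1..t2}"
  shows "s (X t) t = s (X t1) t1"
proof (cases "t = t1")
  case False
  then have "t1 < t" using assms by simp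
  moreover have "continuous_on {t1..t} (\<lambda>t. s (X t) t)"
    by (rule cont_along(1)[OF continuous_on_subset]) (use assms in \<open>auto simp: arc_def\<close>)
  moreover have "((\<lambda>\<tau>. s (X \<tau>) \<tau>) has_real_derivative 0) (at \<tau>)" if "t1 < \<tau>" "\<tau> < t" for \<tau>
    by (rule inv_s[where a = t1 and b = t]) (use assms that in \<open>auto simp: arc_def c_def\<close>)
  ultimately show ?thesis by (intro DERIV_isconst_end) auto
qed simp

lemma fwd_arc:
  assumes "fwd X" "0 < t1" "t1 \<le> t2" "x0 \<le> X t1" "X t2 \<le> x1"
  shows "arc X t1 t2"
  unfolding arc_def
proof (intro conjI ballI)
  show "continuous_on {t1..t2} X" by (rule fwd_cont) (use assms in auto)
  fix t assume t: "t \<in> {t1<..<t2}"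
  show "x0 < X t" "X t < x1" "(X has_real_derivative c (X t) t) (at t)"
    using fwd_less[OF assms(1), of t1 t] fwd_less[OF assms(1), of t t2] fwd_DERIV[OF assms(1), of t] assms t
    by auto
qed

lemma fwd_const:
  assumes "fwd X" "0 < t1" "t1 \<le> t2" "x0 \<le> X t1" "X t2 \<le> x1"
  shows "s (X t2) t2 = s (X t1) t1"
  by (rule arc_const[OF fwd_arc[OF assms]]) (use assms in auto)

text \<open>The speed is bounded and positive down to \<open>t = 0\<close>, even though Lipschitz
  bounds may fail there, so a forward curve is monotone and has a foot \<open>\<xi>\<close>. The
  last clause bounds the domain of dependence by the speed.\<close>

lemma fwd_lim0:
  assumes X: "fwd X"
  obtains \<xi> where "(X \<longlongrightarrow> \<xi>) (at_right 0)" "\<And>t. 0 < t \<Longrightarrow> \<xi> < X t"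
    "\<And>T C t. \<forall>x. \<forall>t\<in>{0<..T}. c x t \<le> C \<Longrightarrow> t \<in> {0<..T} \<Longrightarrow> X t - C * t \<le> \<xi>"
proof -
  obtain C1 where C1: "C1 > 0" "\<And>x t. t \<in> {0<..1} \<Longrightarrow> c x t \<le> C1" using c_bdd[of 1] by blast
  define \<xi> where "\<xi> = Inf (X ` {0<..1})"
  have lower: "X t - C * t \<le> X \<tau>" if "\<And>x t. t \<in> {0<..T} \<Longrightarrow> c x t \<le> C" "t \<in> {0<..T}" "0 < \<tau>" for T C t \<tau>
  proof (cases "\<tau> \<le> t")
    case True
    have "0 \<le> C" using that(1)[OF that(2), of 0] c_pos[of t 0] that(2) by auto
    then have "C * (t - \<tau>) \<le> C * t" using that(3) by (intro mult_left_mono) auto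
    with fwd_speed[OF X that(1), of T \<tau> t] True that show ?thesis by auto
  next
    case False
    have "0 \<le> C" using that(1)[OF that(2), of 0] c_pos[of t 0] that(2) by auto
    then have "0 \<le> C * t" using that(2) by auto
    moreover have "X t \<le> X \<tau>" using fwd_le[OF X, of t \<tau>] False that(2) by auto
    ultimately show ?thesis by linarith
  qed
  have bb: "bdd_below (X ` {0<..1})"
    using lower[of 1 C1 1] C1 by (intro bdd_belowI[of _ "X 1 - C1 * 1"]) auto
  have le: "\<xi> \<le> X t" if "0 < t" for t
  proof -
    have "\<xi> \<le> X (min t 1)" unfolding \<xi>_def by (rule cInf_lower[OF _ bb]) (use that in auto)
    also have "\<dots> \<le> X t" by (rule fwd_le[OF X]) (use that in auto)
    finally show ?thesis .
  qed
  show thesis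
  proof (rule that)
    show "\<xi> < X t" if "0 < t" for t
      using le[of "t / 2"] fwd_less[OF X, of "t / 2" t] that by auto
    show "X t - C * t \<le> \<xi>" if "\<forall>x. \<forall>t\<in>{0<..T}. c x t \<le> C" "t \<in> {0<..T}" for t T C
      unfolding \<xi>_def by (rule cInf_greatest) (use lower[of T C t] that in auto)
    show "(X \<longlongrightarrow> \<xi>) (at_right 0)"
    proof (rule tendstoI)
      fix e :: real assume "0 < e"
      then have "\<xi> < \<xi> + e" by simp
      then obtain \<tau> where \<tau>: "\<tau> \<in> {0<..1}" "X \<tau> < \<xi> + e"
        unfolding \<xi>_def by (subst (asm) cInf_less_iff[OF _ bb]) auto
      have "\<forall>\<^sub>F t in at_right 0. t \<in> {0<..<\<tau>}"
        using \<tau> by (intro eventually_at_right_real) auto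
      then show "\<forall>\<^sub>F t in at_right 0. dist (X t) \<xi> < e"
      proof eventually_elim
        case (elim t)
        then have "X t \<le> X \<tau>" "\<xi> \<le> X t" using fwd_le[OF X, of t \<tau>] le by auto
        then show ?case using \<tau>(2) by (simp add: dist_real_def)
      qed
    qed
  qed
qed

text \<open>With \<open>x0 < \<xi>\<close> the foot of the characteristic avoids the corner, so the
  data are attained there continuously, and \<open>s\<close> is constant on the way.\<close>

lemma trace_to_data:
  assumes X: "fwd X" and \<xi>: "(X \<longlongrightarrow> \<xi>) (at_right 0)" "x0 < \<xi>" and t: "0 < t" "X t \<le> x1"
  shows "s (X t) t = s \<xi> 0"
proof -
  obtain \<xi>' where \<xi>': "(X \<longlongrightarrow> \<xi>') (at_right 0)" "\<And>t. 0 < t \<Longrightarrow> \<xi>' < X t"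
    using fwd_lim0[OF X] by metis
  have "\<xi>' = \<xi>" by (rule tendsto_unique[OF trivial_limit_at_right_real \<xi>'(1) \<xi>(1)])
  then have above: "\<xi> < X \<tau>" if "0 < \<tau>" for \<tau> using \<xi>'(2) that by simp
  have "\<xi> \<in> {x0<..<x1}" using \<xi>(2) above[OF t(1)] t(2) by auto
  note lim = init_s[OF this]
  have "filterlim (\<lambda>\<tau>. (X \<tau>, \<tau>)) (at (\<xi>, 0) within UNIV \<times> {0<..}) (at_right 0)"
    by (rule filterlim_at_withinI)
      (auto intro!: tendsto_Pair \<xi>(1) always_eventually simp: eventually_at_filter)
  from filterlim_compose[OF lim this] have lim1: "((\<lambda>\<tau>. s (X \<tau>) \<tau>) \<longlongrightarrow> s \<xi> 0) (at_right 0)" by simp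
  have "\<forall>\<^sub>F \<tau> in at_right 0. \<tau> \<in> {0<..<t}"
    using t(1) by (intro eventually_at_right_real) auto
  then have "\<forall>\<^sub>F \<tau> in at_right 0. s (X \<tau>) \<tau> = s (X t) t"
  proof eventually_elim
    case (elim \<tau>)
    then have "s (X t) t = s (X \<tau>) \<tau>"
      by (intro fwd_const[OF X]) (use above[of \<tau>] \<xi>(2) t in auto)
    then show ?case by (rule sym)
  qed
  then have "((\<lambda>\<tau>. s (X \<tau>) \<tau>) \<longlongrightarrow> s (X t) t) (at_right 0)" by (rule tendsto_eventually)
  then show ?thesis by (rule tendsto_unique[OF trivial_limit_at_right_real _ lim1])
qed

end


section \<open>Lower bounds from rarefactive data\<close>

context strip
begin

text \<open>Points ahead of the fastest possible signal from the corner \<open>(x0, 0)\<close> trace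
  back to the data; \<open>C\<close> bounds the speed up to \<open>T\<close>.\<close>

lemma trace_below:
  "\<exists>C>0. \<forall>t\<in>{0<..T}. \<forall>x\<le>x1. x0 < x - C * t \<longrightarrow> (\<exists>\<xi>\<ge>x - C * t. \<xi> < x \<and> s x t = s \<xi> 0)"
proof -
  obtain C where C: "C > 0" "\<forall>x. \<forall>t\<in>{0<..T}. c x t \<le> C" using c_bdd[of T] by blast
  have "\<exists>\<xi>\<ge>x - C * t. \<xi> < x \<and> s x t = s \<xi> 0" if t: "t \<in> {0<..T}" and x: "x \<le> x1" "x0 < x - C * t" for t x
  proof -
    have "0 < t" using t by simp
    then obtain X where X: "fwd X" "X t = x" using fwd_exists by blast
    obtain \<xi> where \<xi>: "(X \<longlongrightarrow> \<xi>) (at_right 0)" "\<And>t. 0 < t \<Longrightarrow> \<xi> < X t"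
      "\<And>T C t. \<forall>x. \<forall>t\<in>{0<..T}. c x t \<le> C \<Longrightarrow> t \<in> {0<..T} \<Longrightarrow> X t - C * t \<le> \<xi>"
      using fwd_lim0[OF X(1)] by metis
    have "x - C * t \<le> \<xi>" using \<xi>(3)[OF C(2) t] X(2) by simp
    moreover have "\<xi> < x" using \<xi>(2)[OF \<open>0 < t\<close>] X(2) by simp
    moreover have "s (X t) t = s \<xi> 0"
      by (rule trace_to_data[OF X(1) \<xi>(1) _ \<open>0 < t\<close>]) (use calculation x X(2) in auto)
    ultimately show ?thesis using X(2) by auto
  qed
  with C(1) show ?thesis by blast
qed

lemma data_bdd:
  obtains M where "\<And>x. x \<in> {x0<..<x1} \<Longrightarrow> \<bar>s x 0\<bar> \<le> M"
proof -
  obtain M where M: "\<bar>s x t\<bar> \<le> M \<and> \<bar>r x t\<bar> \<le> M" if "t \<in> {0<..1}" for x t using bdd[of 1] by blast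
  have "\<bar>s x 0\<bar> \<le> M" if "x \<in> {x0<..<x1}" for x
  proof -
    have "filterlim (\<lambda>t. (x, t)) (at (x, 0) within UNIV \<times> {0<..}) (at_right 0)"
      by (rule filterlim_at_withinI)
        (auto intro!: tendsto_intros always_eventually simp: eventually_at_filter)
    from filterlim_compose[OF init_s[OF that] this]
    have "((\<lambda>t. \<bar>s x t\<bar>) \<longlongrightarrow> \<bar>s x 0\<bar>) (at_right 0)" by (auto intro: tendsto_rabs)
    moreover have "\<forall>\<^sub>F t in at_right 0. t \<in> {0<..<1::real}" by (intro eventually_at_right_real) auto
    then have "\<forall>\<^sub>F t in at_right 0. \<bar>s x t\<bar> \<le> M"
      by eventually_elim (use M in auto)
    ultimately show ?thesis by (rule tendsto_upperbound) simp
  qed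
  then show thesis by (rule that)
qed

text \<open>At the right corner forward characteristics arrive from the data, so a fan there
  involves \<open>r\<close> alone. Monotone bounded data have a limit at \<open>x1\<close>, their
  supremum, and \<open>s\<close> inherits it.\<close>

lemma s_corner:
  "\<exists>sc. \<forall>\<epsilon>>0. \<exists>\<delta>>0. \<forall>t\<in>{0<..<\<delta>}. \<forall>x\<in>{x1 - \<delta><..x1}. \<bar>s x t - sc\<bar> < \<epsilon>"
proof -
  obtain M where M: "\<And>x. x \<in> {x0<..<x1} \<Longrightarrow> \<bar>s x 0\<bar> \<le> M"
    using data_bdd by metis
  define sc where "sc = (SUP x\<in>{x0<..<x1}. s x 0)"
  have ne: "{x0<..<x1} \<noteq> {}" using x01 by simp
  have ba: "bdd_above ((\<lambda>x. s x 0) ` {x0<..<x1})" using M by (intro bdd_aboveI[of _ M]) (auto simp: abs_le_iff)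
  obtain C where C: "C > 0"
    "\<And>t x. t \<in> {0<..1} \<Longrightarrow> x \<le> x1 \<Longrightarrow> x0 < x - C * t \<Longrightarrow> \<exists>\<xi>\<ge>x - C * t. \<xi> < x \<and> s x t = s \<xi> 0"
    using trace_below[of 1] by blast
  have "\<exists>\<delta>>0. \<forall>t\<in>{0<..<\<delta>}. \<forall>x\<in>{x1 - \<delta><..x1}. \<bar>s x t - sc\<bar> < \<epsilon>" if "0 < \<epsilon>" for \<epsilon>
  proof -
    have "sc - \<epsilon> < sc" using that by simp
    then obtain y where y: "y \<in> {x0<..<x1}" "sc - \<epsilon> < s y 0"
      unfolding sc_def using less_cSUP_iff[OF ne ba] by blast
    \<comment> \<open>For \<open>t < \<delta>\<close> and \<open>x > x1 - \<delta>\<close> this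
      leaves \<open>x - C * t > y\<close>, so the foot of the characteristic lies to the right of
      \<open>y\<close>.\<close>
    define \<delta> where "\<delta> = min 1 ((x1 - y) / (1 + C))"
    have \<delta>: "0 < \<delta>" "\<delta> \<le> 1" using y C(1) by (auto simp: \<delta>_def)
    have "\<delta> \<le> (x1 - y) / (1 + C)" by (simp add: \<delta>_def)
    then have \<delta>y: "\<delta> * (1 + C) \<le> x1 - y" using C(1) by (simp add: pos_le_divide_eq)
    have "\<bar>s x t - sc\<bar> < \<epsilon>" if t: "t \<in> {0<..<\<delta>}" and x: "x \<in> {x1 - \<delta><..x1}" for t x
    proof -
      have "C * t \<le> C * \<delta>" using t C(1) by simp
      with \<delta>y x have low: "y < x - C * t" by (auto simp: algebra_simps)
      have "t \<in> {0<..1}" "x \<le> x1" "x0 < x - C * t" using t x \<delta> low y by auto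
      from C(2)[OF this] obtain \<xi> where \<xi>: "x - C * t \<le> \<xi>" "\<xi> < x" "s x t = s \<xi> 0" by blast
      have "s y 0 \<le> s \<xi> 0" using init_mono[of y \<xi>] y \<xi> low x by auto
      moreover have "s \<xi> 0 \<le> sc" unfolding sc_def
        by (rule cSUP_upper[OF _ ba]) (use \<xi> low y x in auto)
      ultimately show ?thesis using y(2) \<xi>(3) \<open>0 < \<epsilon>\<close> by auto
    qed
    with \<delta>(1) show ?thesis by blast
  qed
  then show ?thesis by blast
qed

lemma r_corner:
  "\<exists>rc. \<forall>\<epsilon>>0. \<exists>\<delta>>0. \<forall>t\<in>{0<..<\<delta>}. \<forall>x\<in>{x0..<x0 + \<delta>}. \<bar>r x t - rc\<bar> < \<epsilon>"
proof -
  interpret M: strip x0 x1 \<eta> "- B" "- A" F "\<lambda>x t. - r (x0 + x1 - x) t" "\<lambda>x t. - s (x0 + x1 - x) t"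
    by (rule mirror)
  obtain sc where sc: "\<And>\<epsilon>. \<epsilon> > 0 \<Longrightarrow> \<exists>\<delta>>0. \<forall>t\<in>{0<..<\<delta>}. \<forall>x\<in>{x1 - \<delta><..x1}. \<bar>- r (x0 + x1 - x) t - sc\<bar> < \<epsilon>"
    using M.s_corner by blast
  have "\<exists>\<delta>>0. \<forall>t\<in>{0<..<\<delta>}. \<forall>x\<in>{x0..<x0 + \<delta>}. \<bar>r x t - (- sc)\<bar> < \<epsilon>" if \<epsilon>: "\<epsilon> > 0" for \<epsilon>
  proof -
    obtain \<delta> where \<delta>: "\<delta> > 0"
      "\<And>t x. t \<in> {0<..<\<delta>} \<Longrightarrow> x \<in> {x1 - \<delta><..x1} \<Longrightarrow> \<bar>- r (x0 + x1 - x) t - sc\<bar> < \<epsilon>"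
      using sc[OF \<epsilon>] by blast
    have "\<bar>r x t - (- sc)\<bar> < \<epsilon>" if "t \<in> {0<..<\<delta>}" "x \<in> {x0..<x0 + \<delta>}" for t x
      using \<delta>(2)[OF that(1), of "x0 + x1 - x"] that(2) by (auto simp: abs_less_iff)
    with \<delta>(1) show ?thesis by blast
  qed
  then show ?thesis by blast
qed

text \<open>If \<open>s\<close> were smaller than \<open>a\<close> somewhere, then two characteristics carrying values
  \<open>v1 > v2\<close> below \<open>a\<close> would both come out of the corner \<open>(x0, 0)\<close>, the one with \<open>v1\<close> to the
  left.  But \<open>r\<close> is continuous at this corner, so it would be the faster one.\<close>

lemma s_lower:
  assumes a: "\<And>t. t \<in> {0<..T} \<Longrightarrow> a \<le> s x0 t"
    and xt: "x \<in> {x0..x1}" "t \<in> {0<..T}"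
  shows "a \<le> s x t"
proof (rule ccontr)
  define v where "v = s x t"
  assume "\<not> a \<le> s x t"
  then have va: "v < a" by (simp add: v_def)
  have t0: "0 < t" using xt by simp
  \<comment> \<open>Meeting \<open>x0\<close> at a positive time would give \<open>s\<close> a
    boundary value, which is at least \<open>a\<close>.\<close>
  have nohit: "x0 < X \<tau>" if X: "fwd X" and Xt: "x0 < X t" "X t \<le> x1" "s (X t) t < a" and \<tau>: "\<tau> \<in> {0<..t}" for X \<tau>
  proof (rule ccontr)
    assume "\<not> x0 < X \<tau>"
    then have "X \<tau> \<le> x0" by simp
    then obtain \<tau>' where \<tau>': "\<tau> \<le> \<tau>'" "\<tau>' \<le> t" "X \<tau>' = x0"
      using IVT'[of X \<tau> x0 t] Xt(1) \<tau> fwd_cont[OF X, of "{\<tau>..t}"] by (auto simp: less_imp_le subset_iff)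
    have "s (X t) t = s (X \<tau>') \<tau>'"
      by (rule fwd_const[OF X]) (use \<tau>' \<tau> Xt in auto)
    also have "a \<le> s (X \<tau>') \<tau>'" unfolding \<tau>'(3) by (rule a) (use \<tau>' \<tau> xt in auto)
    finally show False using Xt(3) by simp
  qed
  have lim_ge: "x0 \<le> \<xi>" if X: "fwd X" and Xt: "x0 < X t" "X t \<le> x1" "s (X t) t < a"
    and \<xi>: "(X \<longlongrightarrow> \<xi>) (at_right 0)" for X \<xi>
  proof (rule tendsto_lowerbound[OF \<xi>])
    have "\<forall>\<^sub>F \<tau> in at_right 0. \<tau> \<in> {0<..<t}" using t0 by (intro eventually_at_right_real) auto
    then show "\<forall>\<^sub>F \<tau> in at_right 0. x0 \<le> X \<tau>"
    proof eventually_elim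
      case (elim \<tau>)
      then show ?case using nohit[OF X Xt, of \<tau>] by simp
    qed
  qed simp
  have cont: "continuous_on {x0..y} (\<lambda>x. s x t)" for y
  proof -
    obtain L where L: "lipschitz_rect L UNIV {t..t} s" using lip[OF t0, of t] by auto
    have "continuous_on {x0..y} (\<lambda>x. (x, t))" by (intro continuous_intros)
    then have "continuous_on {x0..y} (\<lambda>x. (\<lambda>(x, t). s x t) (x, t))"
      by (rule continuous_on_compose2[OF continuous_on_lipschitz_rect[OF L]]) auto
    then show ?thesis by simp
  qed
  \<comment> \<open>Two values between \<open>v\<close> and \<open>a\<close>, each strictly above
    \<open>v\<close>: the curve \<open>Y\<close> with the value \<open>v\<close> is kept as a third
    one, to show that the other two start at the corner.\<close>
  define v1 v2 where "v1 = (v + 2 * a) / 3" and "v2 = (2 * v + a) / 3"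
  have v12: "v < v2" "v2 < v1" "v1 < a" using va by (auto simp: v1_def v2_def)
  have sx0: "a \<le> s x0 t" by (rule a[OF xt(2)])
  have x0x: "x0 < x" using xt sx0 va by (cases "x = x0") (auto simp: v_def)
  obtain y2 where y2: "x0 \<le> y2" "y2 \<le> x" "s y2 t = v2"
    using IVT2'[of "\<lambda>x. s x t" x v2 x0] cont v12 sx0 x0x by (auto simp: v_def)
  have y2': "x0 < y2" "y2 < x"
    using y2 v12 sx0 by (auto simp: v_def order.order_iff_strict)
  obtain y1 where y1: "x0 \<le> y1" "y1 \<le> y2" "s y1 t = v1"
    using IVT2'[of "\<lambda>x. s x t" y2 v1 x0] cont v12 sx0 y2 by auto
  have y1': "x0 < y1" "y1 < y2"
    using y1 y2 v12 sx0 by (auto simp: order.order_iff_strict)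
  obtain Y where Y: "fwd Y" "Y t = x" using fwd_exists[OF t0] by blast
  obtain X1 where X1: "fwd X1" "X1 t = y1" using fwd_exists[OF t0] by blast
  obtain X2 where X2: "fwd X2" "X2 t = y2" using fwd_exists[OF t0] by blast
  obtain \<xi> where \<xi>: "(Y \<longlongrightarrow> \<xi>) (at_right 0)" "\<And>t. 0 < t \<Longrightarrow> \<xi> < Y t"
    using fwd_lim0[OF Y(1)] by metis
  have \<xi>_x0: "x0 \<le> \<xi>" by (rule lim_ge[OF Y(1) _ _ _ \<xi>(1)]) (use Y x0x xt va in \<open>auto simp: v_def\<close>)
  have \<xi>_x1: "\<xi> < x1" using \<xi>(2)[OF t0] Y(2) xt by auto
  \<comment> \<open>A foot \<open>\<zeta>\<close> inside the data would not lie to the right of the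
    foot \<open>\<xi>\<close> of \<open>Y\<close>, and monotone data would give
    \<open>s y t \<le> v\<close>.\<close>
  have from_corner: "(X \<longlongrightarrow> x0) (at_right 0)"
    if X: "fwd X" "X t = y" and y: "x0 < y" "y < x" and sy: "v < s y t" "s y t < a" for X y
  proof -
    obtain \<zeta> where \<zeta>: "(X \<longlongrightarrow> \<zeta>) (at_right 0)" "\<And>t. 0 < t \<Longrightarrow> \<zeta> < X t"
      using fwd_lim0[OF X(1)] by metis
    have "x0 \<le> \<zeta>" by (rule lim_ge[OF X(1) _ _ _ \<zeta>(1)]) (use X y sy xt in auto)
    moreover have "\<not> x0 < \<zeta>"
    proof
      assume *: "x0 < \<zeta>"
      have "s y t = s \<zeta> 0" using trace_to_data[OF X(1) \<zeta>(1) * t0] X y xt by auto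
      moreover have le: "\<zeta> \<le> \<xi>"
      proof (rule tendsto_le[OF _ \<xi>(1) \<zeta>(1)])
        have "\<forall>\<^sub>F \<tau> in at_right 0. \<tau> \<in> {0<..<t}" using t0 by (intro eventually_at_right_real) auto
        then show "\<forall>\<^sub>F \<tau> in at_right 0. X \<tau> \<le> Y \<tau>"
        proof eventually_elim
          case (elim \<tau>)
          have "X \<tau> < Y \<tau>"
            by (rule fwd_noncrossing[OF X(1) Y(1) _ t0]) (use elim X Y y in auto)
          then show ?case by simp
        qed
      qed simp
      moreover have "v = s \<xi> 0"
        using trace_to_data[OF Y(1) \<xi>(1) _ t0] le * Y xt by (auto simp: v_def)
      moreover have "s \<zeta> 0 \<le> s \<xi> 0" using init_mono[OF * le \<xi>_x1] by simp
      ultimately show False using sy by simp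
    qed
    ultimately have "\<zeta> = x0" by simp
    with \<zeta>(1) show ?thesis by simp
  qed
  have lim1: "(X1 \<longlongrightarrow> x0) (at_right 0)"
    by (rule from_corner[OF X1]) (use y1 y1' y2' v12 in auto)
  have lim2: "(X2 \<longlongrightarrow> x0) (at_right 0)"
    by (rule from_corner[OF X2]) (use y2 y2' v12 in auto)
  obtain rc where rc: "\<And>\<epsilon>. \<epsilon> > 0 \<Longrightarrow> \<exists>\<delta>>0. \<forall>t\<in>{0<..<\<delta>}. \<forall>x\<in>{x0..<x0 + \<delta>}. \<bar>r x t - rc\<bar> < \<epsilon>"
    using r_corner by blast
  \<comment> \<open>Near the corner the values of \<open>r\<close> on the two curves then differ by
    less than \<open>v1 - v2\<close>, which fixes the order of the speeds.\<close>
  define \<epsilon> where "\<epsilon> = (v1 - v2) / 2"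
  obtain \<delta> where \<delta>: "\<delta> > 0" "\<And>t x. t \<in> {0<..<\<delta>} \<Longrightarrow> x \<in> {x0..<x0 + \<delta>} \<Longrightarrow> \<bar>r x t - rc\<bar> < \<epsilon>"
    using rc[of \<epsilon>] v12 by (auto simp: \<epsilon>_def)
  have "\<forall>\<^sub>F \<tau> in at_right 0. X1 \<tau> < x0 + \<delta> \<and> X2 \<tau> < x0 + \<delta> \<and> \<tau> \<in> {0<..<min t \<delta>}"
    using order_tendstoD(2)[OF lim1, of "x0 + \<delta>"] order_tendstoD(2)[OF lim2, of "x0 + \<delta>"]
      eventually_at_right_real[of 0 "min t \<delta>"] \<delta>(1) t0 by (intro eventually_conj) auto
  then obtain b where b: "b > 0"
    "\<And>\<tau>. 0 < \<tau> \<Longrightarrow> \<tau> < b \<Longrightarrow> X1 \<tau> < x0 + \<delta> \<and> X2 \<tau> < x0 + \<delta> \<and> \<tau> \<in> {0<..<min t \<delta>}"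
    unfolding eventually_at_right_field by blast
  have slower: "c (X2 \<tau>) \<tau> < c (X1 \<tau>) \<tau>" if \<tau>: "0 < \<tau>" "\<tau> < b" for \<tau>
  proof -
    note b' = b(2)[OF \<tau>]
    have 1: "x0 < X1 \<tau>" by (rule nohit[OF X1(1)]) (use X1 y1 y1' y2' xt v12 b' in auto)
    have 2: "x0 < X2 \<tau>" by (rule nohit[OF X2(1)]) (use X2 y2 y2' xt v12 b' in auto)
    have "s (X1 t) t = s (X1 \<tau>) \<tau>" by (rule fwd_const[OF X1(1)]) (use 1 \<tau> b' X1 y1' y2' xt in auto)
    then have s1: "s (X1 \<tau>) \<tau> = v1" using X1 y1 by simp
    have "s (X2 t) t = s (X2 \<tau>) \<tau>" by (rule fwd_const[OF X2(1)]) (use 2 \<tau> b' X2 y2' xt in auto)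
    then have s2: "s (X2 \<tau>) \<tau> = v2" using X2 y2 by simp
    have "\<bar>r (X1 \<tau>) \<tau> - rc\<bar> < \<epsilon>" "\<bar>r (X2 \<tau>) \<tau> - rc\<bar> < \<epsilon>" using b' 1 2 by (auto intro!: \<delta>(2))
    then have "r (X1 \<tau>) \<tau> < rc + \<epsilon>" "rc - \<epsilon> < r (X2 \<tau>) \<tau>" by (simp_all add: abs_less_iff)
    then have "v2 - r (X2 \<tau>) \<tau> < v1 - r (X1 \<tau>) \<tau>" unfolding \<epsilon>_def by (simp add: field_simps)
    moreover have "0 < v2 - r (X2 \<tau>) \<tau>" using gap_pos[OF \<tau>(1), of "X2 \<tau>"] s2 by simp
    ultimately show ?thesis unfolding c_def s1 s2 by (intro F_less)
  qed
  define D where "D \<tau> = X2 \<tau> - X1 \<tau>" for \<tau>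
  have D_dec: "D \<tau>' < D \<tau>" if "0 < \<tau>" "\<tau> < \<tau>'" "\<tau>' < b" for \<tau> \<tau>'
  proof (rule DERIV_neg_imp_decreasing[OF \<open>\<tau> < \<tau>'\<close>])
    fix q assume "\<tau> \<le> q" "q \<le> \<tau>'"
    then have q: "0 < q" "q < b" using that by auto
    show "\<exists>y. (D has_real_derivative y) (at q) \<and> y < 0"
      unfolding D_def using slower[OF q] DERIV_diff[OF fwd_DERIV[OF X2(1) q(1)] fwd_DERIV[OF X1(1) q(1)]]
      by (intro exI[of _ "c (X2 q) q - c (X1 q) q"]) auto
  qed
  have D_pos: "0 < D (b / 2)"
    using fwd_noncrossing[OF X1(1) X2(1) _ t0, of "b / 2"] X1 X2 y1' b(1) by (auto simp: D_def)
  have "(D \<longlongrightarrow> x0 - x0) (at_right 0)" unfolding D_def by (intro tendsto_diff lim1 lim2)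
  then have "D (b / 2) \<le> x0 - x0"
  proof (rule tendsto_lowerbound)
    have "\<forall>\<^sub>F \<tau> in at_right 0. \<tau> \<in> {0<..<b / 2}" using b(1) by (intro eventually_at_right_real) auto
    then show "\<forall>\<^sub>F \<tau> in at_right 0. D (b / 2) \<le> D \<tau>"
    proof eventually_elim
      case (elim \<tau>)
      then show ?case using D_dec[of \<tau> "b / 2"] b(1) by auto
    qed
  qed simp
  with D_pos show False by simp
qed

text \<open>The law at \<open>x0\<close> gives \<open>s - r = (1 + \<eta>) * (A - r)\<close> and
  \<open>s - A = \<eta> * (A - r)\<close> there, so the lower bound \<open>k\<close> on
  \<open>s - r\<close> becomes the margin \<open>\<kappa>\<close>, and \<open>s_lower\<close>
  spreads it over the strip. Crossing times are later bounded by means of \<open>F \<kappa>\<close>,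
  hence the uniform margin.\<close>

lemma strict_lower_s:
  "\<exists>\<kappa>>0. \<forall>t\<in>{0<..T}. \<forall>x\<in>{x0..x1}. A + \<kappa> \<le> s x t"
proof -
  obtain k where k: "0 < k" "\<And>x t. t \<in> {0<..T} \<Longrightarrow> k \<le> s x t - r x t" using gap[of T] by blast
  define \<kappa> where "\<kappa> = \<eta> * (k / (1 + \<eta>))"
  have "0 < \<kappa>" using k(1) \<eta> by (simp add: \<kappa>_def)
  moreover have "A + \<kappa> \<le> s x t" if "t \<in> {0<..T}" "x \<in> {x0..x1}" for x t
  proof (rule s_lower[OF _ that(2,1)])
    fix t assume t: "t \<in> {0<..T}"
    then have s0: "s x0 t = - \<eta> * r x0 t + (1 + \<eta>) * A" using bc0 by simp
    then have "s x0 t - r x0 t = (A - r x0 t) * (1 + \<eta>)" by (simp add: algebra_simps)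
    with k(2)[OF t, of x0] have "k / (1 + \<eta>) \<le> A - r x0 t" using \<eta> by (simp add: pos_divide_le_eq)
    then have "\<kappa> \<le> \<eta> * (A - r x0 t)" unfolding \<kappa>_def using \<eta> by (intro mult_left_mono) auto
    also have "\<dots> = s x0 t - A" unfolding s0 by (simp add: algebra_simps)
    finally show "A + \<kappa> \<le> s x0 t" by simp
  qed
  ultimately show ?thesis by blast
qed

lemma strict_bounds:
  obtains \<kappa> where "0 < \<kappa>" "\<And>x t. t \<in> {0<..T} \<Longrightarrow> x \<in> {x0..x1} \<Longrightarrow> A + \<kappa> \<le> s x t \<and> r x t \<le> B - \<kappa>"
proof -
  interpret M: strip x0 x1 \<eta> "- B" "- A" F "\<lambda>x t. - r (x0 + x1 - x) t" "\<lambda>x t. - s (x0 + x1 - x) t"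
    by (rule mirror)
  obtain k1 where k1: "0 < k1" "\<And>x t. t \<in> {0<..T} \<Longrightarrow> x \<in> {x0..x1} \<Longrightarrow> A + k1 \<le> s x t"
    using strict_lower_s[of T] by blast
  obtain k2 where k2: "0 < k2" "\<And>x t. t \<in> {0<..T} \<Longrightarrow> x \<in> {x0..x1} \<Longrightarrow> - B + k2 \<le> - r (x0 + x1 - x) t"
    using M.strict_lower_s[of T] by blast
  show thesis
  proof (rule that[of "min k1 k2"])
    fix x t assume *: "t \<in> {0<..T}" "x \<in> {x0..x1}"
    show "A + min k1 k2 \<le> s x t \<and> r x t \<le> B - min k1 k2"
      using k1(2)[OF *] k2(2)[OF *(1), of "x0 + x1 - x"] *(2) by auto
  qed (use k1 k2 in auto)
qed

lemma s_gt_A: "0 < t \<Longrightarrow> x \<in> {x0..x1} \<Longrightarrow> A < s x t"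
  and r_lt_B: "0 < t \<Longrightarrow> x \<in> {x0..x1} \<Longrightarrow> r x t < B"
  using strict_bounds[of t] by (smt (verit) greaterThanAtMost_iff order_refl)+

end


section \<open>Crossing times, decay and reflected characteristics\<close>

context strip
begin

lemma arc_ends:
  assumes "arc X t1 t2" "t1 < t2"
  shows "X t1 \<in> {x0..x1}" "X t2 \<in> {x0..x1}"
proof -
  have "X ` closure {t1<..<t2} \<subseteq> {x0..x1}"
    by (rule image_closure_subset) (use assms in \<open>auto simp: arc_def less_imp_le\<close>)
  then have "X ` {t1..t2} \<subseteq> {x0..x1}" using assms by simp
  moreover have "t1 \<in> {t1..t2}" "t2 \<in> {t1..t2}" using assms by auto
  ultimately show "X t1 \<in> {x0..x1}" "X t2 \<in> {x0..x1}" by blast+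
qed

lemma arc_mvt:
  assumes "arc X t1 t2" "t1 < t2"
  obtains \<tau> where "t1 < \<tau>" "\<tau> < t2" "X t2 - X t1 = (t2 - t1) * c (X \<tau>) \<tau>"
proof -
  have D: "(X has_real_derivative c (X \<tau>) \<tau>) (at \<tau>)" if "t1 < \<tau>" "\<tau> < t2" for \<tau>
    using assms that by (auto simp: arc_def)
  then obtain l \<tau> where "t1 < \<tau>" "\<tau> < t2" "(X has_real_derivative l) (at \<tau>)" "X t2 - X t1 = (t2 - t1) * l"
    using MVT[OF assms(2), of X] assms(1) by (auto simp: arc_def real_differentiable_def)
  with D[of \<tau>] DERIV_unique[of X l \<tau>] show thesis by (intro that[of \<tau>]) auto
qed

text \<open>The value of \<open>s\<close> at the start is at least \<open>A + \<kappa>\<close> and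
  is kept along the arc, while \<open>r < B \<le> A\<close> at all times; so the speed stays above
  \<open>F \<kappa>\<close>. The margin \<open>\<kappa>\<close>, and with it \<open>\<tau>\<close>,
  depends on the starting time only. This covers \<open>A = B\<close>, where the speed decays in
  time.\<close>

lemma arc_exit:
  assumes "B \<le> A" "0 < t0"
  obtains \<tau> where "0 < \<tau>" "\<And>X t1. t0 < t1 \<Longrightarrow> arc X t0 t1 \<Longrightarrow> t1 - t0 \<le> \<tau>"
proof -
  obtain \<kappa> where \<kappa>: "0 < \<kappa>" "\<And>x t. t \<in> {0<..t0} \<Longrightarrow> x \<in> {x0..x1} \<Longrightarrow> A + \<kappa> \<le> s x t \<and> r x t \<le> B - \<kappa>"
    using strict_bounds[of t0] by metis
  have F\<kappa>: "0 < F \<kappa>" by (rule F_pos[OF \<kappa>(1)])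
  have "t1 - t0 \<le> (x1 - x0) / F \<kappa>" if "t0 < t1" and arc: "arc X t0 t1" for X t1
  proof -
    obtain \<tau> where \<tau>: "t0 < \<tau>" "\<tau> < t1" "X t1 - X t0 = (t1 - t0) * c (X \<tau>) \<tau>"
      using arc_mvt[OF arc \<open>t0 < t1\<close>] by blast
    have "X \<tau> \<in> {x0..x1}" using arc \<tau> by (auto simp: arc_def less_imp_le)
    then have "r (X \<tau>) \<tau> < B" using \<tau>(1) assms(2) by (intro r_lt_B) auto
    moreover have "s (X \<tau>) \<tau> = s (X t0) t0" by (rule arc_const[OF arc assms(2)]) (use \<tau> in auto)
    moreover have "A + \<kappa> \<le> s (X t0) t0"
      using \<kappa>(2)[OF _ arc_ends(1)[OF arc \<open>t0 < t1\<close>], of t0] assms(2) by simp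
    ultimately have "\<kappa> < s (X \<tau>) \<tau> - r (X \<tau>) \<tau>" using assms(1) by linarith
    then have "F \<kappa> \<le> c (X \<tau>) \<tau>" using F_less[OF \<kappa>(1)] by (simp add: c_def less_imp_le)
    then have "(t1 - t0) * F \<kappa> \<le> X t1 - X t0" unfolding \<tau>(3) using \<open>t0 < t1\<close> by (intro mult_left_mono) auto
    also have "\<dots> \<le> x1 - x0" using arc_ends[OF arc \<open>t0 < t1\<close>] by auto
    finally show ?thesis using F\<kappa> by (simp add: pos_le_divide_eq)
  qed
  moreover have "0 < (x1 - x0) / F \<kappa>" using x01 F\<kappa> by simp
  ultimately show thesis using that by metis
qed

lemma fwd_hits_or_trapped:
  assumes X: "fwd X" and t0: "0 < t0" and "x0 \<le> X t0" "X t0 < x1"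
  shows "(\<exists>t1>t0. X t1 = x1) \<or> (\<forall>t>t0. x0 < X t \<and> X t < x1)"
proof (rule disjCI)
  assume no: "\<not> (\<forall>t>t0. x0 < X t \<and> X t < x1)"
  then obtain t where t: "t0 < t" "\<not> (x0 < X t \<and> X t < x1)" by blast
  have "x0 < X t" using fwd_less[OF X t0 t(1)] assms by simp
  then have "x1 \<le> X t" using t by simp
  then obtain t1 where "t0 \<le> t1" "t1 \<le> t" "X t1 = x1"
    using IVT'[of X t0 x1 t] assms t(1) fwd_cont[OF X, of "{t0..t}"] by (auto simp: subset_iff less_imp_le)
  moreover from this assms have "t1 \<noteq> t0" by auto
  ultimately show "\<exists>t1>t0. X t1 = x1" by (intro exI[of _ t1]) auto
qed

lemma fwd_hits:
  assumes "B \<le> A" and X: "fwd X" and t0: "0 < t0" and "x0 \<le> X t0" "X t0 < x1"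
  obtains t1 where "t0 < t1" "X t1 = x1"
proof -
  obtain \<tau> where \<tau>: "0 < \<tau>" "\<And>X t1. t0 < t1 \<Longrightarrow> arc X t0 t1 \<Longrightarrow> t1 - t0 \<le> \<tau>"
    using arc_exit[OF assms(1) t0] by metis
  have False if "\<forall>t>t0. x0 < X t \<and> X t < x1"
  proof -
    have "arc X t0 (t0 + \<tau> + 1)"
      by (rule fwd_arc[OF X t0]) (use that assms \<tau>(1) in \<open>auto simp: less_imp_le\<close>)
    then show False using \<tau>(2)[of "t0 + \<tau> + 1" X] \<tau>(1) by simp
  qed
  then show thesis using fwd_hits_or_trapped[OF X t0 assms(4,5)] that by blast
qed

text \<open>The second alternative keeps the arc itself, so that \<open>arc_exit\<close> can exclude
  it once \<open>t - T\<close> exceeds the crossing time.\<close>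

lemma trace_back:
  assumes "0 < T" "T \<le> t" "x \<in> {x0..x1}"
  shows "(\<exists>t'\<in>{T..t}. s x t = s x0 t') \<or> (\<exists>X. arc X T t \<and> X T \<in> {x0..x1} \<and> s x t = s (X T) T)"
proof -
  have "0 < t" using assms by simp
  then obtain X where X: "fwd X" "X t = x" using fwd_exists by blast
  show ?thesis
  proof (cases "x0 \<le> X T")
    case True
    have le: "X T \<le> x1" using fwd_le[OF X(1) assms(1,2)] X(2) assms(3) by simp
    have "s (X t) t = s (X T) T" "arc X T t"
      using fwd_const[OF X(1) assms(1,2) True] fwd_arc[OF X(1) assms(1,2) True] X(2) assms(3) by auto
    then show ?thesis using True le X(2) by auto
  next
    case False
    then obtain t' where t': "T \<le> t'" "t' \<le> t" "X t' = x0"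
      using IVT'[of X T x0 t] X(2) assms fwd_cont[OF X(1), of "{T..t}"] by (auto simp: subset_iff)
    then have "s (X t) t = s (X t') t'"
      by (intro fwd_const[OF X(1)]) (use X(2) assms in auto)
    then show ?thesis using t' X(2) by auto
  qed
qed

text \<open>By the law at \<open>x0\<close>, a lower deviation \<open>e\<close> of \<open>r\<close>
  returns as an upper deviation \<open>\<eta> * e\<close> of \<open>s\<close>; \<open>e1\<close>
  accounts for values present at time \<open>T\<close> that have not been reflected since.\<close>

lemma s_bound_step:
  assumes "0 < T" and x: "x \<in> {x0..x1}" and t: "t \<in> {T..T'}"
    and r: "\<And>t. t \<in> {T..T'} \<Longrightarrow> A - e \<le> r x0 t"
    and s: "\<And>y. y \<in> {x0..x1} \<Longrightarrow> s y T \<le> A + e1"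
  shows "s x t \<le> A + max e1 (\<eta> * e)"
proof -
  have "s x0 t' \<le> A + \<eta> * e" if "t' \<in> {T..t}" for t'
  proof -
    have "s x0 t' = A + \<eta> * (A - r x0 t')" using bc0[of t'] that assms(1) by (simp add: algebra_simps)
    moreover have "\<eta> * (A - r x0 t') \<le> \<eta> * e" using r[of t'] that t \<eta> by (intro mult_left_mono) auto
    ultimately show ?thesis by simp
  qed
  then show ?thesis
    using trace_back[OF assms(1) _ x, of t] t s by fastforce
qed

text \<open>After a full crossing time every value of \<open>s\<close> in the strip has been
  reflected at \<open>x0\<close> since \<open>T\<close>, so the term \<open>e1\<close> of the
  previous step disappears.\<close>

lemma s_decay_step:
  assumes "B \<le> A" "0 < T" and r: "\<And>t. T \<le> t \<Longrightarrow> A - e \<le> r x0 t"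
  obtains T' where "T \<le> T'" "\<And>t x. T' \<le> t \<Longrightarrow> x \<in> {x0..x1} \<Longrightarrow> s x t \<le> A + \<eta> * e"
proof -
  obtain \<tau> where \<tau>: "0 < \<tau>" "\<And>X t1. T < t1 \<Longrightarrow> arc X T t1 \<Longrightarrow> t1 - T \<le> \<tau>"
    using arc_exit[OF assms(1,2)] by metis
  have "s x t \<le> A + \<eta> * e" if t: "T + \<tau> + 1 \<le> t" and x: "x \<in> {x0..x1}" for x t
  proof -
    have "\<not> arc X T t" for X using \<tau>(2)[of t X] \<tau>(1) t by auto
    then obtain t' where t': "t' \<in> {T..t}" "s x t = s x0 t'"
      using trace_back[OF assms(2) _ x, of t] t \<tau>(1) by auto
    have "s x0 t' = A + \<eta> * (A - r x0 t')" using bc0[of t'] t' assms(2) by (simp add: algebra_simps)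
    moreover have "\<eta> * (A - r x0 t') \<le> \<eta> * e" using r[of t'] t' \<eta> by (intro mult_left_mono) auto
    ultimately show ?thesis using t'(2) by simp
  qed
  then show thesis using \<tau>(1) by (intro that[of "T + \<tau> + 1"]) auto
qed

text \<open>The a priori bounds hold on bounded time intervals, with constants that may grow. On
  \<open>{1..T}\<close> such a bound \<open>e0\<close> is improved again and again by the factor
  \<open>\<eta>\<close> until it falls to \<open>e1\<close>, a bound for the deviation at time
  \<open>1\<close>, which does not depend on \<open>T\<close>.\<close>

lemma deviation_bdd:
  assumes "A = B"
  obtains e where "0 < e" "\<And>t x. 1 \<le> t \<Longrightarrow> x \<in> {x0..x1} \<Longrightarrow> s x t \<le> A + e \<and> A - e \<le> r x t"
proof -
  interpret M: strip x0 x1 \<eta> "- B" "- A" F "\<lambda>x t. - r (x0 + x1 - x) t" "\<lambda>x t. - s (x0 + x1 - x) t"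
    by (rule mirror)
  obtain M1 where M1: "\<bar>s x t\<bar> \<le> M1 \<and> \<bar>r x t\<bar> \<le> M1" if "t \<in> {0<..1}" for x t using bdd[of 1] by blast
  define e1 where "e1 = \<bar>M1\<bar> + \<bar>A\<bar> + 1"
  have e1: "0 < e1" by (simp add: e1_def)
  have start: "s x 1 \<le> A + e1" "A - e1 \<le> r x 1" for x using M1[of 1 x] by (auto simp: e1_def)
  have "s x T \<le> A + e1 \<and> A - e1 \<le> r x T" if T: "1 \<le> T" and x: "x \<in> {x0..x1}" for T x
  proof -
    define P where "P e \<longleftrightarrow> (\<forall>t\<in>{1..T}. \<forall>x\<in>{x0..x1}. s x t \<le> A + e \<and> A - e \<le> r x t)" for e
    have step: "P (max e1 (\<eta> * e))" if "P e" for e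
      unfolding P_def
    proof (intro ballI conjI)
      fix t x assume t: "t \<in> {1..T}" and x: "x \<in> {x0..x1}"
      show "s x t \<le> A + max e1 (\<eta> * e)"
        by (rule s_bound_step[OF _ x t]) (use that start x01 in \<open>auto simp: P_def\<close>)
      have "- r (x0 + x1 - (x0 + x1 - x)) t \<le> - B + max e1 (\<eta> * e)"
      proof (rule M.s_bound_step[OF _ _ t])
        show "- B - e \<le> - s (x0 + x1 - x0) t" if "t \<in> {1..T}" for t
        proof -
          have "s x1 t \<le> A + e" using \<open>P e\<close> that x01 by (auto simp: P_def)
          then show ?thesis using assms by simp
        qed
        show "- r (x0 + x1 - y) 1 \<le> - B + e1" for y using start(2)[of "x0 + x1 - y"] assms by simp
      qed (use x in auto)
      then show "A - max e1 (\<eta> * e) \<le> r x t" using assms by simp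
    qed
    obtain M where M: "\<bar>s x t\<bar> \<le> M \<and> \<bar>r x t\<bar> \<le> M" if "t \<in> {0<..T}" for x t using bdd[of T] by blast
    define e0 where "e0 = \<bar>M\<bar> + \<bar>A\<bar> + 1"
    have P0: "P e0"
      unfolding P_def
    proof (intro ballI)
      fix t x assume "t \<in> {1..T}"
      then show "s x t \<le> A + e0 \<and> A - e0 \<le> r x t" using M[of t x] by (auto simp: e0_def)
    qed
    \<comment> \<open>The entry \<open>e1\<close> is stable under the step because
      \<open>\<eta> * e1 \<le> e1\<close>, so only the other argument of \<open>max\<close>
      shrinks.\<close>
    have iter: "P (max e1 (\<eta> ^ n * e0))" if "P (max e1 e0)" for n
    proof (induction n)
      case (Suc n)
      have "max e1 (\<eta> * max e1 (\<eta> ^ n * e0)) = max e1 (\<eta> ^ Suc n * e0)"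
      proof -
        have le: "\<eta> * e1 \<le> e1" using \<eta> e1 by (simp add: mult_left_le_one_le)
        show ?thesis
        proof (cases "\<eta> ^ n * e0 \<le> e1")
          case True
          then have "\<eta> * (\<eta> ^ n * e0) \<le> \<eta> * e1" using \<eta> by (intro mult_left_mono) auto
          with le True show ?thesis by (simp add: mult.assoc max_absorb1)
        next
          case False
          then show ?thesis by (simp add: mult.assoc max_absorb2)
        qed
      qed
      with step[OF Suc] show ?case by simp
    qed (use that in simp)
    have "P (max e1 e0)" using P0 unfolding P_def by fastforce
    moreover obtain n where "\<eta> ^ n < e1 / e0" 
      using real_arch_pow_inv[of "e1 / e0" \<eta>] e1 \<eta> by (auto simp: e0_def)
    then have "\<eta> ^ n * e0 \<le> e1" by (auto simp: e0_def pos_less_divide_eq less_imp_le)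
    ultimately have "P e1" using iter[of n] by (simp add: max_def split: if_splits)
    then show ?thesis using T x by (simp add: P_def)
  qed
  then show thesis using e1 by (intro that) auto
qed

text \<open>Both families must shrink together, because each step for \<open>s\<close> uses the
  bound on \<open>r\<close> and conversely; the later of the two waiting times serves for both. The
  waiting time may lengthen from step to step, so no rate results.\<close>

lemma decay:
  assumes "A = B" "0 < \<epsilon>"
  obtains T where "0 < T" "\<And>t x. T \<le> t \<Longrightarrow> x \<in> {x0..x1} \<Longrightarrow> s x t - r x t \<le> \<epsilon>"
proof -
  interpret M: strip x0 x1 \<eta> "- B" "- A" F "\<lambda>x t. - r (x0 + x1 - x) t" "\<lambda>x t. - s (x0 + x1 - x) t"
    by (rule mirror)
  define P where "P e T \<longleftrightarrow> (\<forall>t\<ge>T. \<forall>x\<in>{x0..x1}. s x t \<le> A + e \<and> A - e \<le> r x t)" for e T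
  obtain e where e: "0 < e" "P e 1" using deviation_bdd[OF assms(1)] unfolding P_def by metis
  have step: "\<exists>T'\<ge>T. P (\<eta> * e) T'" if "0 < T" "P e T" for e T
  proof -
    have "A - e \<le> r x0 t" if "T \<le> t" for t using \<open>P e T\<close> that x01 by (auto simp: P_def)
    then obtain T1 where T1: "T \<le> T1" "\<And>t x. T1 \<le> t \<Longrightarrow> x \<in> {x0..x1} \<Longrightarrow> s x t \<le> A + \<eta> * e"
      using s_decay_step[OF _ \<open>0 < T\<close>, of e] assms(1) by auto
    have "- B - e \<le> - s (x0 + x1 - x0) t" if "T \<le> t" for t
    proof -
      have "s x1 t \<le> A + e" using \<open>P e T\<close> that x01 by (auto simp: P_def)
      then show ?thesis using assms by simp
    qed
    then obtain T2 where T2: "T \<le> T2" "\<And>t x. T2 \<le> t \<Longrightarrow> x \<in> {x0..x1} \<Longrightarrow> - r (x0 + x1 - x) t \<le> - B + \<eta> * e"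
      using M.s_decay_step[OF _ \<open>0 < T\<close>, of e] assms(1) by auto
    have "P (\<eta> * e) (max T1 T2)"
      unfolding P_def
    proof (intro allI impI ballI)
      fix t x assume "max T1 T2 \<le> t" "x \<in> {x0..x1}"
      then show "s x t \<le> A + \<eta> * e \<and> A - \<eta> * e \<le> r x t"
        using T1(2)[of t x] T2(2)[of t "x0 + x1 - x"] assms(1) by auto
    qed
    then show ?thesis using T1(1) by (intro exI[of _ "max T1 T2"]) auto
  qed
  have iter: "\<exists>T>0. P (\<eta> ^ n * e) T" for n
  proof (induction n)
    case 0
    then show ?case using e by (intro exI[of _ 1]) simp
  next
    case (Suc n)
    then obtain T where "0 < T" "P (\<eta> ^ n * e) T" by blast
    from step[OF this] this(1) show ?case by (auto simp: mult.assoc intro: less_le_trans)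
  qed
  obtain n where "\<eta> ^ n < \<epsilon> / (2 * e)" using real_arch_pow_inv[of "\<epsilon> / (2 * e)" \<eta>] e \<eta> assms by auto
  then have n: "2 * (\<eta> ^ n * e) < \<epsilon>" using e by (simp add: pos_less_divide_eq mult_ac)
  obtain T where T: "0 < T" "P (\<eta> ^ n * e) T" using iter by blast
  show thesis
  proof (rule that[OF T(1)])
    fix t x assume "T \<le> t" "x \<in> {x0..x1}"
    with T(2) have "s x t \<le> A + \<eta> ^ n * e" "A - \<eta> ^ n * e \<le> r x t" by (auto simp: P_def)
    with n show "s x t - r x t \<le> \<epsilon>" by linarith
  qed
qed

section \<open>Round trips and trapped characteristics\<close>

lemma arc_crossing:
  assumes "arc X t1 t2" "0 < t1" "t1 < t2" "X t1 = x0" "X t2 = x1"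
  shows "s x1 t2 = s x0 t1" "r x1 t2 = - \<eta> * s x0 t1 + (1 + \<eta>) * B"
proof -
  show "s x1 t2 = s x0 t1" using arc_const[OF assms(1,2), of t2] assms by simp
  then show "r x1 t2 = - \<eta> * s x0 t1 + (1 + \<eta>) * B" using bc1[of t2] assms by simp
qed

text \<open>At \<open>x0\<close> the law reads \<open>s - r = (1 + \<eta>) * (A - r)\<close>, so
  this is the condition \<open>z > 0\<close>.\<close>

lemma r_x0_lt_A:
  assumes "0 < t"
  shows "r x0 t < A"
proof -
  have "0 < (1 + \<eta>) * (A - r x0 t)"
    using gap_pos[OF assms, of x0] bc0[OF assms] by (simp add: algebra_simps)
  then show ?thesis using \<eta> by (simp add: zero_less_mult_iff)
qed

text \<open>One round trip maps the value \<open>r\<close> at \<open>x1\<close> by an affine contraction whose fixed point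
  exceeds \<open>A\<close> when \<open>A < B\<close>.\<close>

lemma no_infinite_round_trips:
  assumes "A < B" and v: "\<And>n. v (Suc n) = - \<eta> * (- \<eta> * v n + (1 + \<eta>) * A) + (1 + \<eta>) * B"
    and less: "\<And>n. v n < A"
  shows False
proof -
  define R where "R = (B - \<eta> * A) / (1 - \<eta>)"
  have R: "(1 - \<eta>) * R = B - \<eta> * A" using \<eta> by (simp add: R_def)
  have "A * (1 - \<eta>) < B - \<eta> * A" using assms(1) by (simp add: algebra_simps)
  then have AR: "A < R" using \<eta> unfolding R_def by (simp add: pos_less_divide_eq)
  have "(1 + \<eta>) * (B - \<eta> * A) = (1 + \<eta>) * ((1 - \<eta>) * R)" by (simp only: R)
  then have "v (Suc n) - R = \<eta>\<^sup>2 * (v n - R)" for n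
    unfolding v by (simp add: algebra_simps power2_eq_square)
  then have "v n - R = (\<eta>\<^sup>2) ^ n * (v 0 - R)" for n
    by (induction n) (simp_all add: mult_ac)
  then have eq: "v n = (\<eta>\<^sup>2) ^ n * (v 0 - R) + R" for n by (simp add: algebra_simps)
  have "\<eta>\<^sup>2 < 1" using \<eta> by (simp add: power_less_one_iff)
  then have "(\<lambda>n. (\<eta>\<^sup>2) ^ n) \<longlonglongrightarrow> 0" by (intro LIMSEQ_realpow_zero) auto
  then have "(\<lambda>n. (\<eta>\<^sup>2) ^ n * (v 0 - R) + R) \<longlonglongrightarrow> 0 * (v 0 - R) + R"
    by (intro tendsto_add tendsto_mult tendsto_const)
  then have "v \<longlonglongrightarrow> R" by (simp flip: eq)
  then have "R \<le> A" using less by (intro LIMSEQ_le_const2[of v R A]) (auto simp: less_imp_le)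
  with AR show False by simp
qed

text \<open>If every characteristic left the strip, dependent choice would yield an endless sequence
  of round trips, each with \<open>r < A\<close> at \<open>x0\<close>, against
  \<open>no_infinite_round_trips\<close>. Neither the family nor the time of the trapped
  characteristic is determined by this.\<close>

lemma trapped_characteristic:
  assumes "A < B"
  shows "\<exists>\<sigma>\<in>{-1, 1}. \<exists>X t0. 0 < t0 \<and>
    (\<forall>t>t0. x0 < X t \<and> X t < x1 \<and> (X has_real_derivative \<sigma> * c (X t) t) (at t))"
proof (rule ccontr)
  interpret M: strip x0 x1 \<eta> "- B" "- A" F "\<lambda>x t. - r (x0 + x1 - x) t" "\<lambda>x t. - s (x0 + x1 - x) t"
    by (rule mirror)
  have Mc: "M.c x t = c (x0 + x1 - x) t" for x t by (simp add: M.c_def c_def)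
  assume "\<not> ?thesis"
  then have no: "\<exists>t>t0. \<not> (x0 < X t \<and> X t < x1 \<and> (X has_real_derivative \<sigma> * c (X t) t) (at t))"
    if "\<sigma> \<in> {-1, 1}" "0 < t0" for \<sigma> X t0 using that by blast
  have to_right: "\<exists>t'>t. s x1 t' = s x0 t" if t: "0 < t" for t
  proof -
    obtain X where X: "fwd X" "X t = x0" using fwd_exists[OF t] by blast
    have "\<not> (\<forall>\<tau>>t. x0 < X \<tau> \<and> X \<tau> < x1)"
      using no[of 1 t X] fwd_DERIV[OF X(1)] t by auto
    then obtain t' where t': "t < t'" "X t' = x1"
      using fwd_hits_or_trapped[OF X(1) t] X(2) x01 by auto
    have "arc X t t'" by (rule fwd_arc[OF X(1) t]) (use X t' in auto)
    from arc_crossing(1)[OF this t t'(1) X(2) t'(2)] t' show ?thesis by blast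
  qed
  have to_left: "\<exists>t'>t. r x0 t' = r x1 t" if t: "0 < t" for t
  proof -
    obtain X where X: "M.fwd X" "X t = x0" using M.fwd_exists[OF t] by blast
    have "\<not> (\<forall>\<tau>>t. x0 < X \<tau> \<and> X \<tau> < x1)"
    proof
      assume *: "\<forall>\<tau>>t. x0 < X \<tau> \<and> X \<tau> < x1"
      have "x0 < x0 + x1 - X \<tau> \<and> x0 + x1 - X \<tau> < x1 \<and>
        ((\<lambda>t. x0 + x1 - X t) has_real_derivative -1 * c (x0 + x1 - X \<tau>) \<tau>) (at \<tau>)" if "t < \<tau>" for \<tau>
        using * that M.fwd_DERIV[OF X(1), of \<tau>] t by (auto intro!: derivative_eq_intros simp: Mc)
      then show False using no[of "-1" t "\<lambda>t. x0 + x1 - X t"] t by blast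
    qed
    then obtain t' where t': "t < t'" "X t' = x1"
      using M.fwd_hits_or_trapped[OF X(1) t] X(2) x01 by auto
    have "M.arc X t t'" by (rule M.fwd_arc[OF X(1) t]) (use X t' in auto)
    from M.arc_crossing(1)[OF this t t'(1) X(2) t'(2)] t' show ?thesis by auto
  qed
  have round: "\<exists>t'>0. r x1 t' = - \<eta> * (- \<eta> * r x1 t + (1 + \<eta>) * A) + (1 + \<eta>) * B \<and> r x1 t < A"
    if t: "0 < t" for t
  proof -
    obtain t1 where t1: "t < t1" "r x0 t1 = r x1 t" using to_left[OF t] by blast
    then have "0 < t1" using t by simp
    then obtain t2 where t2: "t1 < t2" "s x1 t2 = s x0 t1" using to_right by blast
    then have "0 < t2" using \<open>0 < t1\<close> by simp
    then show ?thesis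
      using bc0[OF \<open>0 < t1\<close>] bc1[OF \<open>0 < t2\<close>] t1 t2 r_x0_lt_A[OF \<open>0 < t1\<close>] by (intro exI[of _ t2]) simp
  qed
  obtain T where T: "\<And>n. 0 < T n" "\<And>n. r x1 (T (Suc n)) = - \<eta> * (- \<eta> * r x1 (T n) + (1 + \<eta>) * A) + (1 + \<eta>) * B \<and> r x1 (T n) < A"
    using dependent_nat_choice[of "\<lambda>_ t. 0 < t"
        "\<lambda>_ t t'. r x1 t' = - \<eta> * (- \<eta> * r x1 t + (1 + \<eta>) * A) + (1 + \<eta>) * B \<and> r x1 t < A"] round
    by (metis zero_less_one)
  show False by (rule no_infinite_round_trips[OF assms, of "\<lambda>n. r x1 (T n)"]) (use T in auto)
qed

text \<open>The characteristic out of the corner \<open>(x0, 0)\<close> that carries the trace of \<open>s\<close> is the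
  limit of the ones from \<open>(x0, 1 / (n + 1))\<close>, which increase with \<open>n\<close>.\<close>

lemma corner_characteristic:
  obtains Z s0 r0 where "fwd Z" "\<forall>t>0. x0 < Z t" "(Z \<longlongrightarrow> x0) (at_right 0)"
    "((\<lambda>t. s x0 t) \<longlongrightarrow> s0) (at_right 0)" "((\<lambda>t. r x0 t) \<longlongrightarrow> r0) (at_right 0)"
    "((\<lambda>t. s (Z t) t) \<longlongrightarrow> s0) (at_right 0)" "((\<lambda>t. r (Z t) t) \<longlongrightarrow> r0) (at_right 0)"
proof -
  obtain r0 where r0: "\<And>\<epsilon>. \<epsilon> > 0 \<Longrightarrow> \<exists>\<delta>>0. \<forall>t\<in>{0<..<\<delta>}. \<forall>x\<in>{x0..<x0 + \<delta>}. \<bar>r x t - r0\<bar> < \<epsilon>"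
    using r_corner by blast
  \<comment> \<open>The reflection law in the limit at the corner: \<open>r\<close> has a limit
    there, since backward characteristics reach this corner from the data, and the law turns it into
    the limit of \<open>s x0\<close>.\<close>
  define s0 where "s0 = - \<eta> * r0 + (1 + \<eta>) * A"
  have r_lim: "((\<lambda>t. r (X t) t) \<longlongrightarrow> r0) (at_right 0)"
    if X: "(X \<longlongrightarrow> x0) (at_right 0)" "\<And>t. 0 < t \<Longrightarrow> x0 \<le> X t" for X
  proof (rule tendstoI)
    fix \<epsilon> :: real assume "0 < \<epsilon>"
    then obtain \<delta> where \<delta>: "0 < \<delta>" "\<forall>t\<in>{0<..<\<delta>}. \<forall>x\<in>{x0..<x0 + \<delta>}. \<bar>r x t - r0\<bar> < \<epsilon>"
      using r0 by blast
    have "\<forall>\<^sub>F t in at_right 0. X t < x0 + \<delta>" using order_tendstoD(2)[OF X(1), of "x0 + \<delta>"] \<delta>(1) by simp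
    moreover have "\<forall>\<^sub>F t in at_right 0. t \<in> {0<..<\<delta>}" using \<delta>(1) by (intro eventually_at_right_real) auto
    ultimately show "\<forall>\<^sub>F t in at_right 0. dist (r (X t) t) r0 < \<epsilon>"
    proof eventually_elim
      case (elim t)
      then show ?case using \<delta>(2) X(2)[of t] by (simp add: dist_real_def)
    qed
  qed
  have r_x0: "((\<lambda>t. r x0 t) \<longlongrightarrow> r0) (at_right 0)"
    by (rule r_lim[of "\<lambda>_. x0"]) auto
  have "((\<lambda>t. - \<eta> * r x0 t + (1 + \<eta>) * A) \<longlongrightarrow> s0) (at_right 0)"
    unfolding s0_def by (intro tendsto_add tendsto_mult tendsto_const r_x0)
  then have s_x0: "((\<lambda>t. s x0 t) \<longlongrightarrow> s0) (at_right 0)"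
    by (rule Lim_transform_eventually) (auto simp: eventually_at_filter bc0 intro!: always_eventually)
  define e where "e n = 1 / real (Suc n)" for n
  have e: "0 < e n" "e n \<le> 1" "e (Suc n) < e n" for n by (auto simp: e_def frac_less2)
  have e_lim: "e \<longlonglongrightarrow> 0" unfolding e_def by (rule lim_1_over_n[THEN LIMSEQ_Suc])
  have "\<exists>X. fwd X \<and> X (e n) = x0" for n using fwd_exists[OF e(1)] by blast
  then obtain X where X: "fwd (X n)" "X n (e n) = x0" for n by metis
  obtain C where C: "C > 0" "\<And>x t. t \<in> {0<..1} \<Longrightarrow> c x t \<le> C" using c_bdd[of 1] by blast
  \<comment> \<open>\<open>X (Suc n)\<close> starts earlier, so it is already to the right of
    \<open>x0\<close> when \<open>X n\<close> starts there.\<close>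
  have inc: "X n t < X (Suc n) t" if "0 < t" for n t
  proof (rule fwd_noncrossing[OF X(1) X(1) that e(1)])
    show "X n (e n) < X (Suc n) (e n)"
      using fwd_less[OF X(1) e(1) e(3), of "Suc n" n] X(2) by simp
  qed
  have upper: "X n t \<le> x0 + C * t" if "e n \<le> t" "t \<le> 1" for n t
  proof -
    have "X n t - X n (e n) \<le> C * (t - e n)"
      by (rule fwd_speed[OF X(1) C(2) e(1) that])
    moreover have "C * (t - e n) \<le> C * t" using e(1)[of n] C(1) by (intro mult_left_mono) auto
    ultimately show ?thesis using X(2) by simp
  qed
  have "incseq (\<lambda>n. X n 1)" using inc[of 1] by (intro incseq_SucI less_imp_le) auto
  then obtain \<xi> where \<xi>: "(\<lambda>n. X n 1) \<longlonglongrightarrow> \<xi>" "\<And>n. X n 1 \<le> \<xi>"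
    using incseq_convergent[of "\<lambda>n. X n 1" "x0 + C"] upper[of _ 1] e(2) by auto
  \<comment> \<open>The limit is taken at the single time \<open>1\<close> and continued backwards
    as a characteristic; continuous dependence then gives convergence at all earlier times.\<close>
  obtain Z where Z: "fwd Z" "Z 1 = \<xi>" using fwd_exists[of 1] by auto
  have XZ: "X n t < Z t" if "0 < t" for n t
  proof (rule fwd_noncrossing[OF X(1) Z(1) that zero_less_one])
    show "X n 1 < Z 1" using inc[of 1 n] \<xi>(2)[of "Suc n"] Z(2) by simp
  qed
  have conv: "(\<lambda>n. X n t) \<longlonglongrightarrow> Z t" if t: "0 < t" "t \<le> 1" for t
  proof -
    obtain L where L: "\<And>X Y. fwd X \<Longrightarrow> fwd Y \<Longrightarrow> \<forall>t'\<in>{t..1}. \<forall>t''\<in>{t..1}.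
        \<bar>X t' - Y t'\<bar> \<le> exp (L * \<bar>t' - t''\<bar>) * \<bar>X t'' - Y t''\<bar>"
      using fwd_gronwall[OF t] by blast
    have "((\<lambda>n. exp (L * \<bar>t - 1\<bar>) * \<bar>X n 1 - \<xi>\<bar>) \<longlongrightarrow> exp (L * \<bar>t - 1\<bar>) * \<bar>\<xi> - \<xi>\<bar>) sequentially"
      by (intro tendsto_mult tendsto_const tendsto_rabs tendsto_diff \<xi>(1))
    then have "(\<lambda>n. exp (L * \<bar>t - 1\<bar>) * \<bar>X n 1 - \<xi>\<bar>) \<longlonglongrightarrow> 0" by simp
    then have "(\<lambda>n. X n t - Z t) \<longlonglongrightarrow> 0"
    proof (rule Lim_null_comparison[rotated], intro always_eventually allI)
      fix n
      have "\<bar>X n t - Z t\<bar> \<le> exp (L * \<bar>t - 1\<bar>) * \<bar>X n 1 - Z 1\<bar>"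
        by (rule L[OF X(1) Z(1), rule_format]) (use t in auto)
      then show "norm (X n t - Z t) \<le> exp (L * \<bar>t - 1\<bar>) * \<bar>X n 1 - \<xi>\<bar>" by (simp add: Z(2))
    qed
    then show ?thesis by (simp add: LIM_zero_iff)
  qed
  have ev: "\<forall>\<^sub>F n in sequentially. e n < t" if "0 < t" for t
    using order_tendstoD(2)[OF e_lim that] .
  have Z_x0: "x0 < Z t" if t: "0 < t" for t
  proof -
    obtain n where "e n < t" using eventually_happens[OF ev[OF t]] by auto
    then have "X n (e n) < X n t" by (rule fwd_less[OF X(1) e(1)])
    then have "x0 < X n t" by (simp only: X(2))
    also have "\<dots> < Z t" by (rule XZ[OF t])
    finally show ?thesis .
  qed
  have Z_upper: "Z t \<le> x0 + C * t" if t: "0 < t" "t \<le> 1" for t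
  proof (rule tendsto_upperbound[OF conv[OF t]])
    show "\<forall>\<^sub>F n in sequentially. X n t \<le> x0 + C * t"
      using ev[OF t(1)] by eventually_elim (use t upper in auto)
  qed simp
  have Z_lim: "(Z \<longlongrightarrow> x0) (at_right 0)"
  proof (rule tendsto_sandwich[where f = "\<lambda>_. x0" and h = "\<lambda>t. x0 + C * t"])
    have ev1: "\<forall>\<^sub>F t in at_right 0. t \<in> {0<..<1::real}" by (intro eventually_at_right_real) auto
    show "\<forall>\<^sub>F t in at_right 0. x0 \<le> Z t"
      using ev1 by eventually_elim (use Z_x0 in \<open>auto intro: less_imp_le\<close>)
    show "\<forall>\<^sub>F t in at_right 0. Z t \<le> x0 + C * t"
      using ev1 by eventually_elim (use Z_upper in auto)
    have "((\<lambda>t. x0 + C * t) \<longlongrightarrow> x0 + C * 0) (at_right 0)" by (intro tendsto_intros)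
    then show "((\<lambda>t. x0 + C * t) \<longlongrightarrow> x0) (at_right 0)" by simp
  qed simp
  \<comment> \<open>\<open>X n\<close> carries the boundary value \<open>s x0 (e n)\<close>, so the
    limit curve carries the limit \<open>s0\<close>; in a fan this is the edge next to the
    contact.\<close>
  have s_Z: "s (Z t) t = s0" if t: "0 < t" "t \<le> 1" "Z t \<le> x1" for t
  proof -
    obtain L where L: "lipschitz_rect L UNIV {t..t} s" using lip[OF t(1), of t] by auto
    have "(\<lambda>n. L * (\<bar>X n t - Z t\<bar> + \<bar>t - t\<bar>)) \<longlonglongrightarrow> L * (\<bar>Z t - Z t\<bar> + \<bar>t - t\<bar>)"
      by (intro tendsto_mult tendsto_add tendsto_const tendsto_rabs tendsto_diff conv t)
    then have "(\<lambda>n. L * (\<bar>X n t - Z t\<bar> + \<bar>t - t\<bar>)) \<longlonglongrightarrow> 0" by simp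
    then have "(\<lambda>n. s (X n t) t - s (Z t) t) \<longlonglongrightarrow> 0"
      by (rule Lim_null_comparison[rotated])
        (use lipschitz_rectD[OF L] in \<open>auto intro!: always_eventually\<close>)
    then have 1: "(\<lambda>n. s (X n t) t) \<longlonglongrightarrow> s (Z t) t" by (simp add: LIM_zero_iff)
    have "filterlim e (at_right 0) sequentially"
      by (rule filterlim_at_withinI[OF e_lim]) (use e(1) in \<open>auto intro!: always_eventually simp: less_imp_neq[symmetric]\<close>)
    from filterlim_compose[OF s_x0 this] have 2: "(\<lambda>n. s x0 (e n)) \<longlonglongrightarrow> s0" .
    have "\<forall>\<^sub>F n in sequentially. s x0 (e n) = s (X n t) t"
      using ev[OF t(1)]
    proof eventually_elim
      case (elim n)
      have "s (X n t) t = s (X n (e n)) (e n)"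
        by (rule fwd_const[OF X(1) e(1)]) (use elim X(2) XZ[OF t(1), of n] t(3) in auto)
      then show ?case using X(2) by simp
    qed
    from Lim_transform_eventually[OF 2 this] 1 show ?thesis by (rule LIMSEQ_unique[symmetric])
  qed
  have "\<forall>\<^sub>F t in at_right 0. Z t < x1" using order_tendstoD(2)[OF Z_lim x01] .
  moreover have "\<forall>\<^sub>F t in at_right 0. t \<in> {0<..<1::real}" by (intro eventually_at_right_real) auto
  ultimately have "\<forall>\<^sub>F t in at_right 0. s (Z t) t = s0"
    by eventually_elim (use s_Z in auto)
  then have "((\<lambda>t. s (Z t) t) \<longlongrightarrow> s0) (at_right 0)" by (rule tendsto_eventually)
  moreover have "((\<lambda>t. r (Z t) t) \<longlongrightarrow> r0) (at_right 0)"
    by (rule r_lim[OF Z_lim]) (use Z_x0 in \<open>auto intro: less_imp_le\<close>)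
  ultimately show thesis using that Z(1) Z_x0 Z_lim s_x0 r_x0 by blast
qed

section \<open>Reflected characteristics, one leg at a time\<close>

definition leg :: "nat \<Rightarrow> (real \<Rightarrow> real) \<Rightarrow> real \<Rightarrow> real \<Rightarrow> bool" where
  "leg k X a b \<longleftrightarrow> a < b \<and> continuous_on {a..b} X \<and>
    X a = (if even k then x1 else x0) \<and> X b = (if even k then x0 else x1) \<and>
    (\<forall>t\<in>{a<..<b}. x0 < X t \<and> X t < x1 \<and>
      (X has_real_derivative (if even k then - 1 else 1) * c (X t) t) (at t))"

lemma leg_from_contact:
  assumes "B \<le> A" "0 < a"
  shows "\<exists>X b. leg k X a b"
proof -
  interpret M: strip x0 x1 \<eta> "- B" "- A" F "\<lambda>x t. - r (x0 + x1 - x) t" "\<lambda>x t. - s (x0 + x1 - x) t"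
    by (rule mirror)
  have Mc: "M.c x t = c (x0 + x1 - x) t" for x t by (simp add: M.c_def c_def)
  show ?thesis
  proof (cases "even k")
    case False
    obtain X where X: "fwd X" "X a = x0" using fwd_exists[OF assms(2)] by blast
    obtain b where b: "a < b" "X b = x1"
      by (rule fwd_hits[OF assms(1) X(1) assms(2)]) (use X(2) x01 in auto)
    have "arc X a b" by (rule fwd_arc[OF X(1) assms(2)]) (use X b in auto)
    then have "leg k X a b" using False X b by (auto simp: leg_def arc_def)
    then show ?thesis by blast
  next
    case True
    obtain X where X: "M.fwd X" "X a = x0" using M.fwd_exists[OF assms(2)] by blast
    obtain b where b: "a < b" "X b = x1"
      by (rule M.fwd_hits[OF _ X(1) assms(2)]) (use assms X(2) x01 in auto)
    have arc: "M.arc X a b" by (rule M.fwd_arc[OF X(1) assms(2)]) (use X b in auto)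
    have "leg k (\<lambda>t. x0 + x1 - X t) a b"
      unfolding leg_def
    proof (intro conjI ballI)
      show "continuous_on {a..b} (\<lambda>t. x0 + x1 - X t)"
        by (intro continuous_on_diff continuous_on_const) (use arc in \<open>simp add: M.arc_def\<close>)
      fix t assume "t \<in> {a<..<b}"
      then have *: "x0 < X t" "X t < x1" "(X has_real_derivative c (x0 + x1 - X t) t) (at t)"
        using arc by (auto simp: M.arc_def Mc)
      from *(1,2) show "x0 < x0 + x1 - X t" "x0 + x1 - X t < x1" by auto
      show "((\<lambda>t. x0 + x1 - X t) has_real_derivative
          (if even k then - 1 else 1) * c (x0 + x1 - X t) t) (at t)"
        using DERIV_diff[OF DERIV_const *(3), of "x0 + x1"] True by simp
    qed (use True X b in auto)
    then show ?thesis by blast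
  qed
qed

lemma leg_from_corner:
  assumes "B \<le> A"
  obtains X b ls lr where "leg 0 X 0 b"
    "((\<lambda>t. s x1 t) \<longlongrightarrow> ls) (at_right 0)" "((\<lambda>t. r x1 t) \<longlongrightarrow> lr) (at_right 0)"
    "((\<lambda>t. s (X t) t) \<longlongrightarrow> ls) (at_right 0)" "((\<lambda>t. r (X t) t) \<longlongrightarrow> lr) (at_right 0)"
proof -
  interpret M: strip x0 x1 \<eta> "- B" "- A" F "\<lambda>x t. - r (x0 + x1 - x) t" "\<lambda>x t. - s (x0 + x1 - x) t"
    by (rule mirror)
  have Mc: "M.c x t = c (x0 + x1 - x) t" for x t by (simp add: M.c_def c_def)
  obtain Z l1 l2 where Z: "M.fwd Z" "\<forall>t>0. x0 < Z t" "(Z \<longlongrightarrow> x0) (at_right 0)"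
    and l: "((\<lambda>t. - r (x0 + x1 - x0) t) \<longlongrightarrow> l1) (at_right 0)" "((\<lambda>t. - s (x0 + x1 - x0) t) \<longlongrightarrow> l2) (at_right 0)"
      "((\<lambda>t. - r (x0 + x1 - Z t) t) \<longlongrightarrow> l1) (at_right 0)" "((\<lambda>t. - s (x0 + x1 - Z t) t) \<longlongrightarrow> l2) (at_right 0)"
    by (rule M.corner_characteristic)
  have "\<forall>\<^sub>F t in at_right 0. Z t < x1" using order_tendstoD(2)[OF Z(3) x01] .
  then have "\<exists>t>0. Z t < x1" unfolding eventually_at_right_field using dense by metis
  then obtain t where t: "0 < t" "Z t < x1" by blast
  obtain b where b: "t < b" "Z b = x1"
    by (rule M.fwd_hits[OF _ Z(1) t(1)]) (use assms Z(2) t in auto)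
  \<comment> \<open>Set to \<open>x1\<close> up to time \<open>0\<close>, where \<open>Z\<close> has
    no prescribed value, to make the leg continuous at its start.\<close>
  define X where "X \<tau> = (if \<tau> \<le> 0 then x1 else x0 + x1 - Z \<tau>)" for \<tau>
  have X_pos: "X \<tau> = x0 + x1 - Z \<tau>" if "0 < \<tau>" for \<tau> using that by (simp add: X_def)
  have X_ev: "\<forall>\<^sub>F \<tau> in at_right 0. x0 + x1 - Z \<tau> = X \<tau>"
    using X_pos by (auto simp: eventually_at_filter intro!: always_eventually)
  have dX: "(X has_real_derivative - 1 * c (X \<tau>) \<tau>) (at \<tau>)" if "0 < \<tau>" for \<tau>
  proof (rule has_field_derivative_transform_within_open[of _ _ _ "{0<..}"])
    show "((\<lambda>\<tau>. x0 + x1 - Z \<tau>) has_real_derivative - 1 * c (X \<tau>) \<tau>) (at \<tau>)"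
      using DERIV_diff[OF DERIV_const M.fwd_DERIV[OF Z(1) that], of "x0 + x1"] X_pos[OF that] by (simp add: Mc)
  qed (use that X_pos in auto)
  show thesis
  proof (rule that)
    show "leg 0 X 0 b"
      unfolding leg_def
    proof (intro conjI ballI)
      show "continuous_on {0..b} X"
        unfolding continuous_on_eq_continuous_within
      proof
        fix \<tau> assume \<tau>: "\<tau> \<in> {0..b}"
        show "continuous (at \<tau> within {0..b}) X"
        proof (cases "\<tau> = 0")
          case False
          then have "isCont X \<tau>" using \<tau> dX[of \<tau>] by (auto intro: DERIV_isCont)
          then show ?thesis by (rule continuous_at_imp_continuous_at_within)
        next
          case True
          have "((\<lambda>\<tau>. x0 + x1 - Z \<tau>) \<longlongrightarrow> x0 + x1 - x0) (at_right 0)"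
            by (intro tendsto_diff tendsto_const Z(3))
          from Lim_transform_eventually[OF this X_ev] have "(X \<longlongrightarrow> x1) (at_right 0)" by simp
          then have "(X \<longlongrightarrow> X 0) (at_right 0)" by (simp only: X_def order_refl if_True)
          moreover have "at 0 within {0..b} = at_right 0" using b t by (intro at_within_Icc_at_right) auto
          ultimately show ?thesis unfolding continuous_within True by simp
        qed
      qed
      show "0 < b" using b t by simp
      show "X 0 = (if even 0 then x1 else x0)" by (simp add: X_def)
      show "X b = (if even 0 then x0 else x1)" using b t by (simp add: X_def)
      fix \<tau> assume \<tau>: "\<tau> \<in> {0<..<b}"
      then have "Z \<tau> < x1" using M.fwd_less[OF Z(1), of \<tau> b] b by simp
      then show "x0 < X \<tau>" using \<tau> by (simp add: X_def)
      show "X \<tau> < x1" using Z(2) \<tau> by (simp add: X_def)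
      show "(X has_real_derivative (if even 0 then - 1 else 1) * c (X \<tau>) \<tau>) (at \<tau>)"
        using dX[of \<tau>] \<tau> by simp
    qed
    show "((\<lambda>t. s x1 t) \<longlongrightarrow> - l2) (at_right 0)" "((\<lambda>t. r x1 t) \<longlongrightarrow> - l1) (at_right 0)"
      using tendsto_minus[OF l(2)] tendsto_minus[OF l(1)] by simp_all
    show "((\<lambda>t. s (X t) t) \<longlongrightarrow> - l2) (at_right 0)" "((\<lambda>t. r (X t) t) \<longlongrightarrow> - l1) (at_right 0)"
    proof -
      have ev: "\<forall>\<^sub>F \<tau> in at_right 0. s (x0 + x1 - Z \<tau>) \<tau> = s (X \<tau>) \<tau>"
        "\<forall>\<^sub>F \<tau> in at_right 0. r (x0 + x1 - Z \<tau>) \<tau> = r (X \<tau>) \<tau>"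
        using X_ev by (auto elim!: eventually_mono)
      show "((\<lambda>t. s (X t) t) \<longlongrightarrow> - l2) (at_right 0)"
        by (rule Lim_transform_eventually[OF tendsto_minus[OF l(4), simplified] ev(1)])
      show "((\<lambda>t. r (X t) t) \<longlongrightarrow> - l1) (at_right 0)"
        by (rule Lim_transform_eventually[OF tendsto_minus[OF l(3), simplified] ev(2)])
    qed
  qed
qed

text \<open>On a bounded time interval the speed is bounded, so each leg takes a minimal time; this
  prevents the reflection times from accumulating.\<close>

lemma leg_duration:
  assumes leg: "leg k X a b" and a: "0 \<le> a" and b: "b \<le> T" and C: "\<And>x t. t \<in> {0<..T} \<Longrightarrow> c x t \<le> C"
  shows "x1 - x0 \<le> C * (b - a)"
proof -
  have ab: "a < b" "continuous_on {a..b} X" using leg by (auto simp: leg_def)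
  have D: "(X has_real_derivative (if even k then - 1 else 1) * c (X t) t) (at t)" if "a < t" "t < b" for t
    using leg that by (auto simp: leg_def)
  obtain l t where t: "a < t" "t < b" "(X has_real_derivative l) (at t)" "X b - X a = (b - a) * l"
    using MVT[OF ab] D by (auto simp: real_differentiable_def)
  then have "l = (if even k then - 1 else 1) * c (X t) t" using D[of t] DERIV_unique by blast
  moreover have "c (X t) t \<le> C" "0 < c (X t) t" using C[of t] c_pos t a b by auto
  ultimately have "\<bar>l\<bar> \<le> C" by auto
  then have "(b - a) * \<bar>l\<bar> \<le> (b - a) * C" using ab by (intro mult_left_mono) auto
  moreover have "\<bar>X b - X a\<bar> = (b - a) * \<bar>l\<bar>" using t(4) ab by (simp add: abs_mult)
  moreover have "\<bar>X b - X a\<bar> = x1 - x0" using leg x01 by (auto simp: leg_def)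
  ultimately show ?thesis by (simp add: mult.commute)
qed

lemma infinite_reflection:
  assumes "B \<le> A"
  obtains X t ls lr where "t 0 = 0" "\<forall>k. leg k X (t k) (t (Suc k))" "filterlim t at_top sequentially"
    "((\<lambda>t. s x1 t) \<longlongrightarrow> ls) (at_right 0)" "((\<lambda>t. r x1 t) \<longlongrightarrow> lr) (at_right 0)"
    "((\<lambda>t. s (X t) t) \<longlongrightarrow> ls) (at_right 0)" "((\<lambda>t. r (X t) t) \<longlongrightarrow> lr) (at_right 0)"
proof -
  obtain X0 b0 ls lr where leg0: "leg 0 X0 0 b0"
    and lim: "((\<lambda>t. s x1 t) \<longlongrightarrow> ls) (at_right 0)" "((\<lambda>t. r x1 t) \<longlongrightarrow> lr) (at_right 0)"
      "((\<lambda>t. s (X0 t) t) \<longlongrightarrow> ls) (at_right 0)" "((\<lambda>t. r (X0 t) t) \<longlongrightarrow> lr) (at_right 0)"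
    by (rule leg_from_corner[OF assms])
  \<comment> \<open>A state is a curve with its start and end time. The clause for
    \<open>k = 0\<close> pins the first leg to the one from the corner, whose limits at
    \<open>t = 0\<close> are known.\<close>
  define P where "P k p \<longleftrightarrow> leg k (fst p) (fst (snd p)) (snd (snd p)) \<and> 0 \<le> fst (snd p) \<and>
    (k = 0 \<longrightarrow> p = (X0, 0, b0))" for k and p :: "(real \<Rightarrow> real) \<times> real \<times> real"
  obtain f where f: "\<And>k. P k (f k)" "\<And>k. fst (snd (f (Suc k))) = snd (snd (f k))"
  proof (rule exE[OF dependent_nat_choice[of P "\<lambda>_ p q. fst (snd q) = snd (snd p)"]])
    show "\<exists>p. P 0 p" using leg0 by (intro exI[of _ "(X0, 0, b0)"]) (simp add: P_def)
    fix p k assume p: "P k p"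
    then have pos: "0 < snd (snd p)" by (auto simp: P_def leg_def)
    obtain X b where "leg (Suc k) X (snd (snd p)) b" using leg_from_contact[OF assms pos] by blast
    then show "\<exists>q. P (Suc k) q \<and> fst (snd q) = snd (snd p)"
      using pos by (intro exI[of _ "(X, snd (snd p), b)"]) (auto simp: P_def)
  qed blast
  define Z t where "Z k = fst (f k)" and "t k = fst (snd (f k))" for k
  have t_Suc: "t (Suc k) = snd (snd (f k))" for k using f(2) by (simp add: t_def)
  have legs: "leg k (Z k) (t k) (t (Suc k))" "0 \<le> t k" for k
    using f(1)[of k] unfolding t_Suc by (auto simp: P_def Z_def t_def)
  have f0: "Z 0 = X0" "t 0 = 0" using f(1)[of 0] by (auto simp: P_def Z_def t_def)
  have t_less: "t k < t (Suc k)" for k using legs(1)[of k] by (simp add: leg_def)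
  then have mono: "strict_mono t" by (rule strict_mono_Suc_iff[THEN iffD2, rule_format])
  have unbdd: "\<exists>k. T < t k" for T
  proof (rule ccontr)
    assume "\<not> ?thesis"
    then have le: "t k \<le> T" for k by (simp add: not_less)
    obtain C where C: "C > 0" "\<And>x \<tau>. \<tau> \<in> {0<..T} \<Longrightarrow> c x \<tau> \<le> C" using c_bdd[of T] by blast
    have "real k * (x1 - x0) \<le> C * t k" for k
    proof (induction k)
      case (Suc k)
      have "x1 - x0 \<le> C * (t (Suc k) - t k)" by (rule leg_duration[OF legs le C(2)])
      with Suc show ?case by (simp add: algebra_simps)
    qed (simp add: f0)
    moreover have "C * t k \<le> C * T" for k using le C(1) by (intro mult_left_mono) auto
    ultimately have "real k * (x1 - x0) \<le> C * T" for k using order.trans by blast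
    moreover obtain k where "C * T < real k * (x1 - x0)"
      using reals_Archimedean3[of "x1 - x0"] x01 by auto
    ultimately show False by (meson not_less)
  qed
  \<comment> \<open>At a reflection time this picks the earlier leg, while time \<open>0\<close>
    belongs to leg \<open>0\<close>; neighbouring legs agree where they meet.\<close>
  define K where "K \<tau> = (LEAST k. \<tau> \<le> t (Suc k))" for \<tau>
  define X where "X \<tau> = Z (K \<tau>) \<tau>" for \<tau>
  have K: "K \<tau> = k" if "t k < \<tau>" "\<tau> \<le> t (Suc k)" for \<tau> k
    unfolding K_def
  proof (rule Least_equality[of "\<lambda>k. \<tau> \<le> t (Suc k)", OF that(2)])
    fix y assume "\<tau> \<le> t (Suc y)"
    then have "t k < t (Suc y)" using that by simp
    then show "k \<le> y" using strict_mono_less[OF mono] by simp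
  qed
  have XZ: "X \<tau> = Z k \<tau>" if \<tau>: "t k \<le> \<tau>" "\<tau> \<le> t (Suc k)" for \<tau> k
  proof (cases "t k < \<tau>")
    case True
    then show ?thesis using K[OF True \<tau>(2)] by (simp add: X_def)
  next
    case False
    then have eq: "\<tau> = t k" using \<tau> by simp
    show ?thesis
    proof (cases k)
      case 0
      have "K \<tau> = 0" unfolding K_def using t_less[of 0] eq 0 by (intro Least_eq_0) simp
      then show ?thesis using 0 by (simp add: X_def)
    next
      case (Suc j)
      have "K \<tau> = j" by (rule K) (use eq Suc t_less in auto)
      then have "X \<tau> = Z j (t (Suc j))" using eq Suc by (simp add: X_def)
      also have "\<dots> = Z k \<tau>" using legs(1)[of j] legs(1)[of k] eq Suc by (auto simp: leg_def)
      finally show ?thesis .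
    qed
  qed
  show thesis
  proof (rule that[of t X])
    show "t 0 = 0" by (rule f0)
    show "filterlim t at_top sequentially"
      unfolding filterlim_at_top
    proof
      fix T
      obtain k where "T < t k" using unbdd by blast
      then have "\<forall>n\<ge>k. T \<le> t n" using strict_mono_less_eq[OF mono] by (meson less_imp_le order.trans)
      then show "\<forall>\<^sub>F n in sequentially. T \<le> t n" by (auto simp: eventually_sequentially)
    qed
    show "\<forall>k. leg k X (t k) (t (Suc k))"
      unfolding leg_def
    proof (intro allI conjI ballI)
      fix k
      show "t k < t (Suc k)" by (rule t_less)
      have "continuous_on {t k..t (Suc k)} (Z k)" using legs(1)[of k] by (simp add: leg_def)
      then show "continuous_on {t k..t (Suc k)} X"
        by (rule continuous_on_eq) (use XZ in auto)
      show "X (t k) = (if even k then x1 else x0)" "X (t (Suc k)) = (if even k then x0 else x1)"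
        using XZ[of k "t k"] XZ[of k "t (Suc k)"] t_less[of k] legs(1)[of k] by (auto simp: leg_def)
      fix \<tau> assume \<tau>: "\<tau> \<in> {t k<..<t (Suc k)}"
      have Z: "x0 < Z k \<tau>" "Z k \<tau> < x1"
        "(Z k has_real_derivative (if even k then - 1 else 1) * c (Z k \<tau>) \<tau>) (at \<tau>)"
        using legs(1)[of k] \<tau> by (auto simp: leg_def)
      have eq: "X \<tau> = Z k \<tau>" by (rule XZ) (use \<tau> in auto)
      show "x0 < X \<tau>" "X \<tau> < x1" using Z eq by auto
      show "(X has_real_derivative (if even k then - 1 else 1) * c (X \<tau>) \<tau>) (at \<tau>)"
        unfolding eq by (rule has_field_derivative_transform_within_open[OF Z(3), of "{t k<..<t (Suc k)}"])
          (use \<tau> in \<open>auto intro!: XZ[symmetric]\<close>)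
    qed
    have "\<forall>\<^sub>F \<tau> in at_right 0. \<tau> \<in> {0<..<t 1}"
      using t_less[of 0] f0 by (intro eventually_at_right_real) auto
    then have ev: "\<forall>\<^sub>F \<tau> in at_right 0. X0 \<tau> = X \<tau>"
    proof eventually_elim
      case (elim \<tau>)
      then show ?case using XZ[of 0 \<tau>] f0 by auto
    qed
    then have ev': "\<forall>\<^sub>F \<tau> in at_right 0. s (X0 \<tau>) \<tau> = s (X \<tau>) \<tau>" "\<forall>\<^sub>F \<tau> in at_right 0. r (X0 \<tau>) \<tau> = r (X \<tau>) \<tau>"
      by (auto elim!: eventually_mono)
    show "((\<lambda>t. s (X t) t) \<longlongrightarrow> ls) (at_right 0)" "((\<lambda>t. r (X t) t) \<longlongrightarrow> lr) (at_right 0)"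
      using Lim_transform_eventually[OF lim(3) ev'(1)] Lim_transform_eventually[OF lim(4) ev'(2)] .
  qed (rule lim)+
qed

end


section \<open>Gas dynamics and one-sided traces\<close>

lemma lipschitz_rect_mono: "lipschitz_rect L A T f \<Longrightarrow> A' \<subseteq> A \<Longrightarrow> T' \<subseteq> T \<Longrightarrow> lipschitz_rect L A' T' f"
  unfolding lipschitz_rect_def by blast

lemma lipschitz_rect_compose:
  assumes f: "lipschitz_rect L A T f" and rng: "\<And>x t. x \<in> A \<Longrightarrow> t \<in> T \<Longrightarrow> f x t \<in> J"
    and g: "\<And>v w. v \<in> J \<Longrightarrow> w \<in> J \<Longrightarrow> \<bar>g v - g w\<bar> \<le> B * \<bar>v - w\<bar>"
  shows "lipschitz_rect (\<bar>B\<bar> * L) A T (\<lambda>x t. g (f x t))"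
  unfolding lipschitz_rect_def
proof (intro ballI)
  fix x y s t assume *: "x \<in> A" "y \<in> A" "s \<in> T" "t \<in> T"
  have "\<bar>g (f x s) - g (f y t)\<bar> \<le> B * \<bar>f x s - f y t\<bar>" using * rng by (intro g) auto
  also have "\<dots> \<le> \<bar>B\<bar> * \<bar>f x s - f y t\<bar>" by (intro mult_right_mono) auto
  also have "\<dots> \<le> \<bar>B\<bar> * (L * (\<bar>x - y\<bar> + \<bar>s - t\<bar>))"
    by (intro mult_left_mono lipschitz_rectD[OF f] *) auto
  finally show "\<bar>g (f x s) - g (f y t)\<bar> \<le> \<bar>B\<bar> * L * (\<bar>x - y\<bar> + \<bar>s - t\<bar>)" by (simp add: mult.assoc)
qed

lemma lipschitz_rect_add:
  assumes "lipschitz_rect L A T f" "lipschitz_rect L' A T g"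
  shows "lipschitz_rect (L + \<bar>k\<bar> * L') A T (\<lambda>x t. f x t + k * g x t)"
  unfolding lipschitz_rect_def
proof (intro ballI)
  fix x y s t assume *: "x \<in> A" "y \<in> A" "s \<in> T" "t \<in> T"
  have "\<bar>k * g x s - k * g y t\<bar> \<le> \<bar>k\<bar> * (L' * (\<bar>x - y\<bar> + \<bar>s - t\<bar>))"
    using lipschitz_rectD[OF assms(2) *] by (simp add: mult_left_mono abs_mult flip: right_diff_distrib)
  moreover have "\<bar>f x s - f y t\<bar> \<le> L * (\<bar>x - y\<bar> + \<bar>s - t\<bar>)" by (rule lipschitz_rectD[OF assms(1) *])
  ultimately have "\<bar>f x s + k * g x s - (f y t + k * g y t)\<bar>
      \<le> L * (\<bar>x - y\<bar> + \<bar>s - t\<bar>) + \<bar>k\<bar> * (L' * (\<bar>x - y\<bar> + \<bar>s - t\<bar>))" by linarith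
  then show "\<bar>f x s + k * g x s - (f y t + k * g y t)\<bar> \<le> (L + \<bar>k\<bar> * L') * (\<bar>x - y\<bar> + \<bar>s - t\<bar>)"
    by (simp only: distrib_right mult.assoc)
qed

lemma lipschitz_of_derivative_bound:
  fixes f :: "real \<Rightarrow> real"
  assumes f: "\<And>v. v \<in> {a..b} \<Longrightarrow> (f has_real_derivative f' v) (at v)" and f': "\<And>v. v \<in> {a..b} \<Longrightarrow> \<bar>f' v\<bar> \<le> B"
    and "v \<in> {a..b}" "w \<in> {a..b}"
  shows "\<bar>f v - f w\<bar> \<le> B * \<bar>v - w\<bar>"
  using field_differentiable_bound[of "{a..b}" f f' B w v] assms
  by (auto intro: has_field_derivative_at_within simp: abs_minus_commute)

lemma powr_lipschitz:
  fixes a b e :: real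
  assumes "0 < a"
  shows "\<exists>L. \<forall>v\<in>{a..b}. \<forall>w\<in>{a..b}. \<bar>v powr e - w powr e\<bar> \<le> L * \<bar>v - w\<bar>"
proof -
  have "continuous_on {a..b} (\<lambda>v. e * v powr (e - 1))"
    by (intro continuous_intros) (use assms in auto)
  then have "bounded ((\<lambda>v. e * v powr (e - 1)) ` {a..b})"
    by (intro compact_imp_bounded compact_continuous_image) auto
  then obtain C where C: "\<And>v. v \<in> {a..b} \<Longrightarrow> \<bar>e * v powr (e - 1)\<bar> \<le> C"
    unfolding bounded_iff by (metis image_eqI real_norm_def)
  have "\<bar>v powr e - w powr e\<bar> \<le> C * \<bar>v - w\<bar>" if "v \<in> {a..b}" "w \<in> {a..b}" for v w
    by (rule lipschitz_of_derivative_bound[OF _ C that])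
      (use assms in \<open>auto intro!: has_real_derivative_powr\<close>)
  then show ?thesis by blast
qed

definition riemann_w :: "real \<Rightarrow> real \<Rightarrow> real \<Rightarrow> real \<Rightarrow> real \<Rightarrow> real" where
  "riemann_w K \<gamma> cv S \<tau> = entropy_var K \<gamma> cv S * z_var \<gamma> \<tau>"

lemma entropy_var_pos: "\<gamma> > 1 \<Longrightarrow> K > 0 \<Longrightarrow> entropy_var K \<gamma> cv S > 0"
  using C_z_pos[of \<gamma>] by (simp add: entropy_var_def C_m_def)

lemma riemann_w_pos: "\<gamma> > 1 \<Longrightarrow> K > 0 \<Longrightarrow> \<tau> > 0 \<Longrightarrow> riemann_w K \<gamma> cv S \<tau> > 0"
  by (simp add: riemann_w_def entropy_var_pos z_var_pos)

text \<open>With \<open>d = d_exp \<gamma>\<close>, the normalisation of \<open>C_z\<close> amounts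
  to \<open>C_z powr (d - 1) = 1 / (d - 1)\<close>, and this makes \<open>m z\<close> a primitive of
  \<open>- c\<close> in \<tau>. So it is the function \<open>W\<close> of
  \<open>invariant_along_characteristic\<close>.\<close>

lemma riemann_w_deriv:
  assumes "\<gamma> > 1" "K > 0" "\<tau> > 0"
  shows "(riemann_w K \<gamma> cv S has_real_derivative - sound_speed K \<gamma> cv S \<tau>) (at \<tau>)"
proof -
  let ?d = "d_exp \<gamma>" and ?m = "entropy_var K \<gamma> cv S"
  have d: "?d > 1" using assms d_exp_gt_1 by simp
  have d1: "inverse (?d - 1) = (\<gamma> - 1) / 2" using assms by (simp add: d_exp_def field_simps)
  have Cz: "C_z \<gamma> powr ?d = C_z \<gamma> * ((\<gamma> - 1) / 2)"
  proof -
    have "C_z \<gamma> powr ?d = C_z \<gamma> powr (1 + (?d - 1))" by simp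
    also have "\<dots> = C_z \<gamma> * C_z \<gamma> powr (?d - 1)"
      using C_z_pos[OF assms(1)] by (simp only: powr_add powr_one less_imp_le)
    also have "C_z \<gamma> powr (?d - 1) = inverse (?d - 1)"
    proof -
      have "1 / (1 - ?d) * (?d - 1) = - 1" using d by (simp add: field_simps)
      then show ?thesis using d by (simp add: C_z_def powr_powr powr_minus)
    qed
    finally show ?thesis by (simp only: d1)
  qed
  have e: "- (\<gamma> - 1) / 2 * ?d = - (\<gamma> - 1) / 2 - 1" using assms by (simp add: d_exp_def field_simps)
  have "sound_speed K \<gamma> cv S \<tau> = ?m * (C_z \<gamma> powr ?d * \<tau> powr (- (\<gamma> - 1) / 2 * ?d))"
    using C_z_pos[OF assms(1)] assms by (simp add: sound_speed_eq z_var_def powr_mult powr_powr)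
  also have "\<dots> = ?m * (C_z \<gamma> * ((\<gamma> - 1) / 2) * \<tau> powr (- (\<gamma> - 1) / 2 - 1))"
    unfolding Cz e ..
  finally have c: "- sound_speed K \<gamma> cv S \<tau> = ?m * (C_z \<gamma> * (- (\<gamma> - 1) / 2 * \<tau> powr (- (\<gamma> - 1) / 2 - 1)))"
    by (simp add: algebra_simps)
  have "((\<lambda>\<tau>. ?m * (C_z \<gamma> * \<tau> powr (- (\<gamma> - 1) / 2))) has_real_derivative - sound_speed K \<gamma> cv S \<tau>) (at \<tau>)"
    unfolding c by (intro DERIV_cmult has_real_derivative_powr assms)
  then show ?thesis by (simp add: riemann_w_def[abs_def] z_var_def)
qed

lemma pressure_deriv:
  assumes "\<gamma> > 1" "K > 0" "\<tau> > 0"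
  shows "(pressure K \<gamma> cv S has_real_derivative - (sound_speed K \<gamma> cv S \<tau>)\<^sup>2) (at \<tau>)"
proof -
  have "(pressure K \<gamma> cv S has_real_derivative K * exp (S / cv) * (- \<gamma> * \<tau> powr (- \<gamma> - 1))) (at \<tau>)"
    unfolding pressure_def[abs_def] using assms by (auto intro!: derivative_eq_intros)
  moreover have "(sound_speed K \<gamma> cv S \<tau>)\<^sup>2 = K * \<gamma> * exp (S / cv) * \<tau> powr (- \<gamma> - 1)"
    unfolding sound_speed_def sound_speed_sqr[OF assms(3)] using assms by simp
  ultimately show ?thesis by (simp add: mult_ac)
qed

lemma sound_speed_powr:
  assumes "\<gamma> > 1" "K > 0"
  obtains k where "k > 0" "\<And>\<tau>. \<tau> > 0 \<Longrightarrow> sound_speed K \<gamma> cv S \<tau> = k * \<tau> powr (- (\<gamma> - 1) / 2 * d_exp \<gamma>)"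
proof (rule that)
  show "entropy_var K \<gamma> cv S * C_z \<gamma> powr d_exp \<gamma> > 0"
    using entropy_var_pos[OF assms] C_z_pos[OF assms(1)] by simp
  show "sound_speed K \<gamma> cv S \<tau> = entropy_var K \<gamma> cv S * C_z \<gamma> powr d_exp \<gamma> * \<tau> powr (- (\<gamma> - 1) / 2 * d_exp \<gamma>)"
    if "\<tau> > 0" for \<tau>
    using C_z_pos[OF assms(1)] assms that by (simp add: sound_speed_eq z_var_def powr_mult powr_powr)
qed

lemma sound_speed_pos: "\<gamma> > 1 \<Longrightarrow> K > 0 \<Longrightarrow> \<tau> > 0 \<Longrightarrow> sound_speed K \<gamma> cv S \<tau> > 0"
  by (simp add: sound_speed_eq entropy_var_pos z_var_pos less_imp_neq[symmetric])

lemma gas_lipschitz: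
  assumes "\<gamma> > 1" "K > 0" "0 < a"
  obtains L C where
    "\<And>v w. v \<in> {a..b} \<Longrightarrow> w \<in> {a..b} \<Longrightarrow> \<bar>sound_speed K \<gamma> cv S v - sound_speed K \<gamma> cv S w\<bar> \<le> L * \<bar>v - w\<bar>"
    "\<And>v w. v \<in> {a..b} \<Longrightarrow> w \<in> {a..b} \<Longrightarrow> \<bar>riemann_w K \<gamma> cv S v - riemann_w K \<gamma> cv S w\<bar> \<le> L * \<bar>v - w\<bar>"
    "\<And>v w. v \<in> {a..b} \<Longrightarrow> w \<in> {a..b} \<Longrightarrow> \<bar>pressure K \<gamma> cv S v - pressure K \<gamma> cv S w\<bar> \<le> L * \<bar>v - w\<bar>"
    "\<And>v. v \<in> {a..b} \<Longrightarrow> \<bar>sound_speed K \<gamma> cv S v\<bar> \<le> C"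
proof -
  obtain k where k: "k > 0" "\<And>\<tau>. \<tau> > 0 \<Longrightarrow> sound_speed K \<gamma> cv S \<tau> = k * \<tau> powr (- (\<gamma> - 1) / 2 * d_exp \<gamma>)"
    using sound_speed_powr[OF assms(1,2)] by metis
  obtain L1 where L1: "\<And>v w. v \<in> {a..b} \<Longrightarrow> w \<in> {a..b} \<Longrightarrow>
      \<bar>v powr (- (\<gamma> - 1) / 2 * d_exp \<gamma>) - w powr (- (\<gamma> - 1) / 2 * d_exp \<gamma>)\<bar> \<le> L1 * \<bar>v - w\<bar>"
    using powr_lipschitz[OF assms(3)] by blast
  have c_lip: "\<bar>sound_speed K \<gamma> cv S v - sound_speed K \<gamma> cv S w\<bar> \<le> k * L1 * \<bar>v - w\<bar>"
    if "v \<in> {a..b}" "w \<in> {a..b}" for v w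
    using mult_left_mono[OF L1[OF that], of k] that assms k by (simp add: abs_mult mult.assoc flip: right_diff_distrib)
  define C where "C = \<bar>sound_speed K \<gamma> cv S a\<bar> + \<bar>k * L1\<bar> * \<bar>b - a\<bar>"
  have C: "\<bar>sound_speed K \<gamma> cv S v\<bar> \<le> C" if v: "v \<in> {a..b}" for v
  proof -
    have "k * L1 * \<bar>v - a\<bar> \<le> \<bar>k * L1\<bar> * \<bar>b - a\<bar>" using v by (intro mult_mono) auto
    then show ?thesis using c_lip[OF v, of a] v by (auto simp: C_def)
  qed
  have w_lip: "\<bar>riemann_w K \<gamma> cv S v - riemann_w K \<gamma> cv S w\<bar> \<le> C * \<bar>v - w\<bar>" if "v \<in> {a..b}" "w \<in> {a..b}" for v w
    by (rule lipschitz_of_derivative_bound[OF _ _ that, where f' = "\<lambda>v. - sound_speed K \<gamma> cv S v"])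
      (use C assms in \<open>auto intro!: riemann_w_deriv\<close>)
  have p_lip: "\<bar>pressure K \<gamma> cv S v - pressure K \<gamma> cv S w\<bar> \<le> C\<^sup>2 * \<bar>v - w\<bar>" if "v \<in> {a..b}" "w \<in> {a..b}" for v w
  proof (rule lipschitz_of_derivative_bound[OF _ _ that, where f' = "\<lambda>v. - (sound_speed K \<gamma> cv S v)\<^sup>2"])
    show "\<bar>- (sound_speed K \<gamma> cv S v)\<^sup>2\<bar> \<le> C\<^sup>2" if "v \<in> {a..b}" for v
      using power_mono[OF C[OF that], of 2] by simp
  qed (use assms in \<open>auto intro!: pressure_deriv\<close>)
  define L where "L = max (k * L1) (max C (C\<^sup>2))"
  have L: "k * L1 \<le> L" "C \<le> L" "C\<^sup>2 \<le> L" by (auto simp: L_def)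
  show thesis
  proof (rule that[of L C])
    fix v w assume vw: "v \<in> {a..b}" "w \<in> {a..b}"
    show "\<bar>sound_speed K \<gamma> cv S v - sound_speed K \<gamma> cv S w\<bar> \<le> L * \<bar>v - w\<bar>"
      using c_lip[OF vw] mult_right_mono[OF L(1), of "\<bar>v - w\<bar>"] by simp
    show "\<bar>riemann_w K \<gamma> cv S v - riemann_w K \<gamma> cv S w\<bar> \<le> L * \<bar>v - w\<bar>"
      using w_lip[OF vw] mult_right_mono[OF L(2), of "\<bar>v - w\<bar>"] by simp
    show "\<bar>pressure K \<gamma> cv S v - pressure K \<gamma> cv S w\<bar> \<le> L * \<bar>v - w\<bar>"
      using p_lip[OF vw] mult_right_mono[OF L(3), of "\<bar>v - w\<bar>"] by simp
  qed (use C in auto)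
qed

text \<open>Since \<open>p\<close> is proportional to \<open>m\<^sup>2 * z powr (1 + d)\<close>,
  multiplying it by \<open>m powr (d - 1)\<close> gives a multiple of
  \<open>(m * z) powr (1 + d)\<close>. At equal pressures the ratio of \<open>m z\<close> is thus
  the ratio of \<open>m\<close> to the power \<open>(d - 1) / (d + 1)\<close>, which explains the
  measure of strength.\<close>

lemma pressure_jump:
  assumes "\<gamma> > 1" "K > 0" "\<tau>l > 0" "\<tau>r > 0" and p: "pressure K \<gamma> cv Sl \<tau>l = pressure K \<gamma> cv Sr \<tau>r"
  shows "riemann_w K \<gamma> cv Sr \<tau>r
    = contact_strength \<gamma> (entropy_var K \<gamma> cv Sl) (entropy_var K \<gamma> cv Sr) * riemann_w K \<gamma> cv Sl \<tau>l"
proof -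
  define d ml mr zl zr where defs: "d = d_exp \<gamma>" "ml = entropy_var K \<gamma> cv Sl" "mr = entropy_var K \<gamma> cv Sr"
    "zl = z_var \<gamma> \<tau>l" "zr = z_var \<gamma> \<tau>r"
  have d: "d > 1" using assms d_exp_gt_1 by (simp add: defs)
  have pos: "ml > 0" "mr > 0" "zl > 0" "zr > 0" using assms by (simp_all add: defs entropy_var_pos z_var_pos)
  have eq: "ml\<^sup>2 * zl powr (1 + d) = mr\<^sup>2 * zr powr (1 + d)"
    using p d unfolding pressure_eq[OF assms(1,2,3)] pressure_eq[OF assms(1,2,4)] by (simp add: defs)
  have split: "m powr (1 + d) = m powr (d - 1) * m\<^sup>2" if "m > 0" for m :: real
  proof -
    have "m powr (1 + d) = m powr ((d - 1) + 2)" by (simp add: add.commute)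
    also have "\<dots> = m powr (d - 1) * m\<^sup>2" using that by (simp only: powr_add powr_numeral)
    finally show ?thesis .
  qed
  have "(mr * zr) powr (1 + d) = mr powr (d - 1) * (mr\<^sup>2 * zr powr (1 + d))"
    using pos by (simp add: powr_mult split)
  also have "\<dots> = mr powr (d - 1) * (ml\<^sup>2 * zl powr (1 + d))" by (simp only: eq)
  also have "\<dots> = (mr / ml) powr (d - 1) * (ml * zl) powr (1 + d)"
    using pos by (simp add: powr_mult split powr_divide)
  finally have "((mr * zr) powr (1 + d)) powr (1 / (1 + d))
      = ((mr / ml) powr (d - 1) * (ml * zl) powr (1 + d)) powr (1 / (1 + d))" by simp
  then have "mr * zr = (mr / ml) powr ((d - 1) / (1 + d)) * (ml * zl)"
    using pos d by (simp add: powr_mult powr_powr)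
  then show ?thesis by (simp add: riemann_w_def contact_strength_def defs add.commute)
qed

text \<open>The limits also replace the values at \<open>p\<close> and \<open>q\<close> themselves,
  which are arbitrary for a solution.\<close>

definition extend :: "real \<Rightarrow> real \<Rightarrow> (real \<Rightarrow> real \<Rightarrow> real) \<Rightarrow> real \<Rightarrow> real \<Rightarrow> real" where
  "extend p q f x t = (if x \<le> p then Lim (at_right p) (\<lambda>y. f y t)
    else if q \<le> x then Lim (at_left q) (\<lambda>y. f y t) else f x t)"

lemma extend_inside [simp]: "p < x \<Longrightarrow> x < q \<Longrightarrow> extend p q f x t = f x t"
  by (simp add: extend_def)

lemma at_within_Ioo_ends:
  fixes p q :: real
  assumes "p < q"
  shows "at p within {p<..<q} = at_right p" "at q within {p<..<q} = at_left q"
  by (rule at_within_nhd[of _ "{..<q}"]; use assms in auto)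
    (rule at_within_nhd[of _ "{p<..}"]; use assms in auto)

text \<open>A Lipschitz function extends to the closure with the same constant, and clamping
  \<open>x\<close> to \<open>{p..q}\<close> does not increase distances; \<open>T\<close> is closed
  so that taking the closure adds no times.\<close>

lemma extend_lipschitz:
  assumes "p < q" and f: "lipschitz_rect L {p<..<q} T f" and T: "closed T"
  obtains L' where "lipschitz_rect L' UNIV T (extend p q f)"
    "\<And>t. t \<in> T \<Longrightarrow> ((\<lambda>x. f x t) \<longlongrightarrow> extend p q f p t) (at_right p)"
    "\<And>t. t \<in> T \<Longrightarrow> ((\<lambda>x. f x t) \<longlongrightarrow> extend p q f q t) (at_left q)"
proof -
  have "(2 * \<bar>L\<bar>)-lipschitz_on ({p<..<q} \<times> T) (\<lambda>(x, t). f x t)"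
    by (rule lipschitz_on_of_rect[OF f])
  then obtain g where g: "(2 * \<bar>L\<bar>)-lipschitz_on (closure ({p<..<q} \<times> T)) g"
    "\<And>x t. x \<in> {p<..<q} \<Longrightarrow> t \<in> T \<Longrightarrow> g (x, t) = f x t"
    using lipschitz_extend_closure by fastforce
  have cl: "closure ({p<..<q} \<times> T) = {p..q} \<times> T" using assms by (simp add: closure_Times)
  have lim: "((\<lambda>x. f x t) \<longlongrightarrow> g (y, t)) (at y within {p<..<q})" if "t \<in> T" "y \<in> {p..q}" for y t
  proof -
    have "continuous_on ({p..q} \<times> T) g" using lipschitz_on_continuous_on[OF g(1)] cl by simp
    moreover have "continuous_on {p..q} (\<lambda>x. (x, t))" by (intro continuous_intros)
    ultimately have "continuous_on {p..q} (\<lambda>x. g (x, t))"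
      by (rule continuous_on_compose2) (use that in auto)
    then have "((\<lambda>x. g (x, t)) \<longlongrightarrow> g (y, t)) (at y within {p..q})"
      using that by (simp add: continuous_on_def)
    then have "((\<lambda>x. g (x, t)) \<longlongrightarrow> g (y, t)) (at y within {p<..<q})"
      by (rule tendsto_within_subset) auto
    moreover have "\<forall>\<^sub>F x in at y within {p<..<q}. g (x, t) = f x t"
      using g(2) that by (auto simp: eventually_at_filter intro!: always_eventually)
    ultimately show ?thesis by (rule Lim_transform_eventually)
  qed
  have lp: "((\<lambda>x. f x t) \<longlongrightarrow> g (p, t)) (at_right p)" and lq: "((\<lambda>x. f x t) \<longlongrightarrow> g (q, t)) (at_left q)"
    if "t \<in> T" for t
    using lim[OF that, of p] lim[OF that, of q] \<open>p < q\<close> by (simp_all add: at_within_Ioo_ends)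
  have ext: "extend p q f x t = g (max p (min q x), t)" if "t \<in> T" for x t
    using tendsto_Lim[OF _ lp[OF that]] tendsto_Lim[OF _ lq[OF that]] g(2)[of x t] that \<open>p < q\<close>
    by (auto simp: extend_def max_def min_def)
  show thesis
  proof (rule that)
    show "lipschitz_rect (2 * \<bar>L\<bar>) UNIV T (extend p q f)"
      unfolding lipschitz_rect_def
    proof (intro ballI)
      fix x y s t assume st: "s \<in> T" "t \<in> T"
      let ?x = "max p (min q x)" and ?y = "max p (min q y)"
      have "\<bar>extend p q f x s - extend p q f y t\<bar> \<le> 2 * \<bar>L\<bar> * dist (?x, s) (?y, t)"
        using lipschitz_onD[OF g(1), of "(?x, s)" "(?y, t)"] st ext \<open>p < q\<close> by (simp add: cl dist_real_def)
      also have "\<dots> \<le> 2 * \<bar>L\<bar> * (\<bar>x - y\<bar> + \<bar>s - t\<bar>)"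
      proof (rule mult_left_mono)
        have "dist (?x, s) (?y, t) \<le> \<bar>?x - ?y\<bar> + \<bar>s - t\<bar>"
          unfolding dist_Pair_Pair dist_real_def using sqrt_sum_squares_le_sum_abs[of "?x - ?y" "s - t"] by simp
        also have "\<bar>?x - ?y\<bar> \<le> \<bar>x - y\<bar>" by (auto simp: max_def min_def)
        finally show "dist (?x, s) (?y, t) \<le> \<bar>x - y\<bar> + \<bar>s - t\<bar>" by simp
      qed simp
      finally show "\<bar>extend p q f x s - extend p q f y t\<bar> \<le> 2 * \<bar>L\<bar> * (\<bar>x - y\<bar> + \<bar>s - t\<bar>)" .
    qed
    fix t assume t: "t \<in> T"
    show "((\<lambda>x. f x t) \<longlongrightarrow> extend p q f p t) (at_right p)" "((\<lambda>x. f x t) \<longlongrightarrow> extend p q f q t) (at_left q)"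
      using lp[OF t] lq[OF t] ext[OF t, of p] ext[OF t, of q] \<open>p < q\<close> by simp_all
  qed
qed


section \<open>Solutions with two contacts\<close>

lemma lipschitz_rect_of_lipschitz_on:
  assumes "L-lipschitz_on (A \<times> T) (\<lambda>(x, t). f x t)"
  shows "lipschitz_rect L A T f"
  unfolding lipschitz_rect_def
proof (intro ballI)
  fix x y s t assume *: "x \<in> A" "y \<in> A" "s \<in> T" "t \<in> T"
  have "\<bar>f x s - f y t\<bar> \<le> L * dist (x, s) (y, t)"
    using lipschitz_onD[OF assms, of "(x, s)" "(y, t)"] * by (simp add: dist_real_def)
  also have "\<dots> \<le> L * (\<bar>x - y\<bar> + \<bar>s - t\<bar>)"
  proof (rule mult_left_mono)
    show "dist (x, s) (y, t) \<le> \<bar>x - y\<bar> + \<bar>s - t\<bar>"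
      unfolding dist_Pair_Pair dist_real_def using sqrt_sum_squares_le_sum_abs[of "x - y" "s - t"] by simp
  qed (rule lipschitz_on_nonneg[OF assms])
  finally show "\<bar>f x s - f y t\<bar> \<le> L * (\<bar>x - y\<bar> + \<bar>s - t\<bar>)" .
qed

lemma integral_abs_le_except_point:
  fixes w :: "real \<Rightarrow> real"
  assumes "a \<le> b" and w: "\<And>x. x \<in> {a..b} \<Longrightarrow> x \<noteq> y \<Longrightarrow> \<bar>w x\<bar> \<le> M" and "0 \<le> M"
  shows "\<bar>integral {a..b} w\<bar> \<le> M * (b - a)"
proof -
  define w' where "w' x = (if x = y then 0 else w x)" for x
  have eq: "integral {a..b} w = integral {a..b} w'"
    by (rule integral_spike[of "{y}"]) (auto simp: w'_def)
  have "\<bar>integral {a..b} w'\<bar> \<le> M * (b - a)"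
  proof (cases "w' integrable_on {a..b}")
    case True
    have "norm (integral {a..b} w') \<le> integral {a..b} (\<lambda>_. M)"
      by (rule integral_norm_bound_integral[OF True]) (use w assms in \<open>auto simp: w'_def\<close>)
    then show ?thesis using assms by (simp add: mult.commute)
  next
    \<comment> \<open>Nothing is assumed about integrability: by convention the integral is
      \<open>0\<close> in this case.\<close>
    case False
    then show ?thesis using assms by (simp add: not_integrable_integral)
  qed
  then show ?thesis by (simp only: eq)
qed

text \<open>Rectangles shrinking to the line \<open>x = y\<close>.\<close>

lemma conservation_law_continuous_flux:
  assumes cl: "conservation_law D w f" and pq: "p < y" "y < q" and D: "{p<..<q} \<inter> D = {y}"
    and w: "\<And>T. \<exists>M. \<forall>x t. x \<notin> D \<longrightarrow> 0 \<le> t \<longrightarrow> t \<le> T \<longrightarrow> \<bar>w x t\<bar> \<le> M"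
    and fl: "\<And>a b. 0 < a \<Longrightarrow> a \<le> b \<Longrightarrow> \<exists>L. lipschitz_rect L {p<..<y} {a..b} f"
    and fr: "\<And>a b. 0 < a \<Longrightarrow> a \<le> b \<Longrightarrow> \<exists>L. lipschitz_rect L {y<..<q} {a..b} f"
    and t: "0 < t"
  shows "Lim (at_left y) (\<lambda>x. f x t) = Lim (at_right y) (\<lambda>x. f x t)"
proof -
  \<comment> \<open>A time window around \<open>t\<close> that stays away from \<open>0\<close>,
    where the Lipschitz bounds may fail at a corner.\<close>
  define a0 b0 where "a0 = t / 2" and "b0 = t + 1"
  have ab: "0 < a0" "a0 < t" "t < b0" using t by (auto simp: a0_def b0_def)
  have cl_T: "closed {a0..b0}" by simp
  obtain L0 where "lipschitz_rect L0 {p<..<y} {a0..b0} f" using fl[of a0 b0] ab by auto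
  from extend_lipschitz[OF pq(1) this cl_T]
  obtain L1 where L1: "lipschitz_rect L1 UNIV {a0..b0} (extend p y f)" by metis
  obtain L0 where "lipschitz_rect L0 {y<..<q} {a0..b0} f" using fr[of a0 b0] ab by auto
  from extend_lipschitz[OF pq(2) this cl_T]
  obtain L2 where L2: "lipschitz_rect L2 UNIV {a0..b0} (extend y q f)" by metis
  obtain M0 where M0: "\<And>x t. x \<notin> D \<Longrightarrow> 0 \<le> t \<Longrightarrow> t \<le> b0 \<Longrightarrow> \<bar>w x t\<bar> \<le> M0" using w[of b0] by blast
  define M where "M = \<bar>M0\<bar>"
  have M: "0 \<le> M" "\<And>x t. x \<notin> D \<Longrightarrow> 0 \<le> t \<Longrightarrow> t \<le> b0 \<Longrightarrow> \<bar>w x t\<bar> \<le> M"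
    using M0 abs_ge_self[of M0] by (auto simp: M_def intro: order.trans)
  define gl gr where "gl = extend p y f y" and "gr = extend y q f y"
  have cont: "continuous_on {a0..\<theta>} (h x)" if "lipschitz_rect L UNIV {a0..b0} h" "\<theta> \<le> b0" for L h x \<theta>
  proof -
    have "continuous_on {a0..\<theta>} (\<lambda>t. (x, t))" by (intro continuous_intros)
    then have "continuous_on {a0..\<theta>} (\<lambda>t. (\<lambda>(x, t). h x t) (x, t))"
      by (rule continuous_on_compose2[OF continuous_on_lipschitz_rect[OF that(1)]]) (use that in auto)
    then show ?thesis by simp
  qed
  have near: "\<bar>integral {a0..\<theta>} (h x) - integral {a0..\<theta>} (h y)\<bar> \<le> L * \<bar>x - y\<bar> * (\<theta> - a0)"
    if "lipschitz_rect L UNIV {a0..b0} h" "a0 \<le> \<theta>" "\<theta> \<le> b0" for L h x \<theta>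
  proof -
    note c = cont[OF that(1,3)]
    have "norm (integral {a0..\<theta>} (\<lambda>r. h x r - h y r)) \<le> L * \<bar>x - y\<bar> * (\<theta> - a0)"
    proof (rule integral_bound[OF that(2)])
      show "continuous_on {a0..\<theta>} (\<lambda>r. h x r - h y r)" by (intro continuous_on_diff c)
      show "norm (h x r - h y r) \<le> L * \<bar>x - y\<bar>" if "r \<in> {a0..\<theta>}" for r
        using lipschitz_rectD[OF \<open>lipschitz_rect L _ _ _\<close>, of x y r r] that \<open>\<theta> \<le> b0\<close> by simp
    qed
    moreover have "integral {a0..\<theta>} (\<lambda>r. h x r - h y r) = integral {a0..\<theta>} (h x) - integral {a0..\<theta>} (h y)"
      by (intro integral_diff integrable_continuous_real c)
    ultimately show ?thesis by simp
  qed
  have eq: "integral {a0..\<theta>} gl = integral {a0..\<theta>} gr" if \<theta>: "\<theta> \<in> {a0..b0}" for \<theta>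
  proof (cases "\<theta> = a0")
    case False
    then have less: "a0 < \<theta>" using \<theta> by simp
    \<comment> \<open>Two integrals of \<open>w\<close> over a width \<open>2 * h\<close> give
      \<open>4 * M\<close>; replacing the fluxes at distance \<open>h\<close> by their limits on the
      line gives the rest.\<close>
    define C where "C = 4 * M + (L1 + L2) * (\<theta> - a0)"
    have "((\<lambda>h. C * h) \<longlongrightarrow> C * 0) (at_right 0)" by (intro tendsto_intros)
    then have "\<bar>integral {a0..\<theta>} gl - integral {a0..\<theta>} gr\<bar> \<le> C * 0"
    proof (rule tendsto_lowerbound)
      have "\<forall>\<^sub>F h in at_right 0. h \<in> {0<..<min (y - p) (q - y)}"
        using pq by (intro eventually_at_right_real) auto
      then show "\<forall>\<^sub>F h in at_right 0. \<bar>integral {a0..\<theta>} gl - integral {a0..\<theta>} gr\<bar> \<le> C * h"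
      proof eventually_elim
        case (elim h)
        let ?a = "y - h" and ?b = "y + h"
        have in_pq: "x \<notin> D" if "x \<in> {?a..?b}" "x \<noteq> y" for x using D elim that by fastforce
        have aD: "?a \<notin> D" "?b \<notin> D" using in_pq[of ?a] in_pq[of ?b] elim by auto
        have W: "\<bar>integral {?a..?b} (\<lambda>x. w x r)\<bar> \<le> M * (2 * h)" if "0 \<le> r" "r \<le> b0" for r
          using integral_abs_le_except_point[of ?a ?b y "\<lambda>x. w x r" M] M in_pq that elim by auto
        have law: "integral {?a..?b} (\<lambda>x. w x \<theta>) - integral {?a..?b} (\<lambda>x. w x a0)
            = integral {a0..\<theta>} (f ?a) - integral {a0..\<theta>} (f ?b)"
          using cl aD less ab elim by (auto simp: conservation_law_def)
        have fa: "f ?a = extend p y f ?a" "f ?b = extend y q f ?b" using elim by auto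
        have 1: "\<bar>integral {a0..\<theta>} (f ?a) - integral {a0..\<theta>} gl\<bar> \<le> L1 * h * (\<theta> - a0)"
          using near[OF L1, of \<theta> ?a] \<theta> elim by (simp add: fa(1) gl_def)
        have 2: "\<bar>integral {a0..\<theta>} (f ?b) - integral {a0..\<theta>} gr\<bar> \<le> L2 * h * (\<theta> - a0)"
          using near[OF L2, of \<theta> ?b] \<theta> elim by (simp add: fa(2) gr_def)
        have 3: "\<bar>integral {?a..?b} (\<lambda>x. w x \<theta>)\<bar> \<le> M * (2 * h)" by (rule W) (use \<theta> ab in auto)
        have 4: "\<bar>integral {?a..?b} (\<lambda>x. w x a0)\<bar> \<le> M * (2 * h)" by (rule W) (use ab in auto)
        have "\<bar>integral {a0..\<theta>} gl - integral {a0..\<theta>} gr\<bar> \<le> M * (2 * h) + M * (2 * h) + L1 * h * (\<theta> - a0) + L2 * h * (\<theta> - a0)"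
          using 1 2 3 4 law by linarith
        then show ?case by (simp add: C_def algebra_simps)
      qed
    qed simp
    then show ?thesis by simp
  qed simp
  \<comment> \<open>The two time integrals agree for every upper limit, so their difference has
    derivative \<open>0\<close>; on the other hand this derivative is the jump of the flux at
    \<open>t\<close>.\<close>
  have D: "((\<lambda>\<theta>. integral {a0..\<theta>} gl - integral {a0..\<theta>} gr) has_real_derivative gl t - gr t) (at t within {a0..b0})"
    unfolding gl_def gr_def
    by (intro DERIV_diff integral_has_real_derivative cont[OF L1] cont[OF L2]) (use ab in auto)
  have "((\<lambda>\<theta>. integral {a0..\<theta>} gl - integral {a0..\<theta>} gr) has_real_derivative 0) (at t within {a0..b0})"
    by (rule has_field_derivative_transform_within[OF DERIV_const[of 0] zero_less_one]) (use eq ab in auto)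
  with D have "gl t - gr t = 0"
    using ab by (simp only: at_within_Icc_at) (rule DERIV_unique)
  then show ?thesis using pq by (simp add: gl_def gr_def extend_def)
qed

locale two_contacts =
  fixes K \<gamma> cv x0 x1 Sl Sm Sr Q :: real and S :: "real \<Rightarrow> real" and \<tau> u :: "real \<Rightarrow> real \<Rightarrow> real"
  assumes \<gamma>: "\<gamma> > 1" and K: "K > 0" and x01: "x0 < x1"
    and S: "S = entropy_profile x0 x1 Sl Sm Sr"
    and Q: "Q > 1"
    and jump0: "contact_strength \<gamma> (entropy_var K \<gamma> cv Sl) (entropy_var K \<gamma> cv Sm) = Q"
    and jump1: "contact_strength \<gamma> (entropy_var K \<gamma> cv Sm) (entropy_var K \<gamma> cv Sr) = 1 / Q"
    and sol: "euler_solution K \<gamma> cv x0 x1 S \<tau> u"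
    and smooth: "smooth_data_between x0 x1 (\<lambda>x. \<tau> x 0) (\<lambda>x. u x 0)"
    and rarefactive: "rarefactive_data K \<gamma> cv x0 x1 S (\<lambda>x. \<tau> x 0) (\<lambda>x. u x 0)"
begin

text \<open>Pairing each region with its entropy lets the strip and both outer parts share the
  proofs that rest on constant entropy.\<close>

definition "regions = {({..<x0}, Sl), ({x0<..<x1}, Sm), ({x1<..}, Sr)}"

lemma region_open: "(I, Si) \<in> regions \<Longrightarrow> open I"
  and region_avoids: "(I, Si) \<in> regions \<Longrightarrow> x \<in> I \<Longrightarrow> x \<notin> {x0, x1}"
  and region_entropy: "(I, Si) \<in> regions \<Longrightarrow> x \<in> I \<Longrightarrow> S x = Si"
  using x01 by (auto simp: regions_def S entropy_profile_def)

lemma sol_bounds: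
  "\<exists>M>0. \<forall>x t. x \<notin> {x0, x1} \<longrightarrow> 0 \<le> t \<longrightarrow> t \<le> T \<longrightarrow> 1 / M \<le> \<tau> x t \<and> \<tau> x t \<le> M \<and> \<bar>u x t\<bar> \<le> M"
  using sol unfolding euler_solution_def by meson

lemma tau_pos:
  assumes "x \<notin> {x0, x1}" "0 \<le> t"
  shows "0 < \<tau> x t"
proof -
  obtain M where "0 < M" "1 / M \<le> \<tau> x t" using sol_bounds[of t] assms by blast
  then show ?thesis using less_le_trans[of 0 "1 / M" "\<tau> x t"] by simp
qed

text \<open>The hypothesis \<open>corners\<close> keeps the compact set \<open>A \<times> T\<close>
  away from both corners: either time \<open>0\<close> or the contacts are avoided.\<close>

lemma region_lipschitz:
  assumes I: "(I, Si) \<in> regions" and A: "compact A" "A \<subseteq> closure I" and T: "compact T" "T \<subseteq> {0..}"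
    and corners: "0 \<notin> T \<or> A \<inter> {x0, x1} = {}"
  shows "\<exists>L. lipschitz_rect L (A \<inter> I) T \<tau> \<and> lipschitz_rect L (A \<inter> I) T u"
proof -
  have *: "\<exists>L. lipschitz_rect L (A \<inter> I) T f" if pl: "piecewise_lipschitz x0 x1 f" for f
  proof -
    have "I \<in> {{..<x0}, {x0<..<x1}, {x1<..}}" using I by (auto simp: regions_def)
    moreover have "compact (A \<times> T)" "A \<times> T \<subseteq> closure I \<times> {0..} - {(x0, 0), (x1, 0)}"
      using A T corners by (auto intro: compact_Times)
    ultimately obtain L where "L-lipschitz_on (A \<times> T \<inter> I \<times> {0..}) (\<lambda>(x, t). f x t)"
      using pl unfolding piecewise_lipschitz_def by blast
    moreover have "A \<times> T \<inter> I \<times> {0..} = (A \<inter> I) \<times> T" using T by auto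
    ultimately show ?thesis using lipschitz_rect_of_lipschitz_on by metis
  qed
  obtain L1 L2 where "lipschitz_rect L1 (A \<inter> I) T \<tau>" "lipschitz_rect L2 (A \<inter> I) T u"
    using sol * unfolding euler_solution_def by meson
  then have "lipschitz_rect (max L1 L2) (A \<inter> I) T \<tau>" "lipschitz_rect (max L1 L2) (A \<inter> I) T u"
    unfolding lipschitz_rect_def by (meson max.cobounded1 max.cobounded2 mult_right_mono order.trans abs_ge_zero add_nonneg_nonneg)+
  then show ?thesis by blast
qed

lemma region_balance:
  assumes I: "(I, Si) \<in> regions" and "A \<subseteq> I" "T \<subseteq> {0..}"
  shows "balance_rect A T \<tau> (\<lambda>x t. - u x t)" "balance_rect A T u (\<lambda>x t. pressure K \<gamma> cv Si (\<tau> x t))"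
proof -
  have av: "x \<notin> {x0, x1}" "S x = Si" if "x \<in> A" for x
    using region_avoids[OF I] region_entropy[OF I] that assms(2) by blast+
  show "balance_rect A T \<tau> (\<lambda>x t. - u x t)"
    using sol av(1) assms(3) unfolding euler_solution_def conservation_law_def balance_rect_def by (meson atLeast_iff subsetD)
  have "balance_rect A T u (\<lambda>x t. pressure K \<gamma> cv (S x) (\<tau> x t))"
    using sol av(1) assms(3) unfolding euler_solution_def conservation_law_def balance_rect_def by (meson atLeast_iff subsetD)
  then show "balance_rect A T u (\<lambda>x t. pressure K \<gamma> cv Si (\<tau> x t))"
    by (simp add: balance_rect_def av(2))
qed

text \<open>Differentiability is local, so it is enough to fit a rectangle in the region around
  \<open>(X t, t)\<close> that contains the curve for a short time, and to apply
  \<open>invariant_along_characteristic\<close> there.\<close>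

lemma region_invariant:
  assumes I: "(I, Si) \<in> regions" and \<sigma>: "\<sigma> \<in> {-1, 1}" and "0 \<le> a"
    and X: "\<And>\<theta>. \<theta> \<in> {a<..<b} \<Longrightarrow> X \<theta> \<in> I \<and>
      (X has_real_derivative \<sigma> * sound_speed K \<gamma> cv Si (\<tau> (X \<theta>) \<theta>)) (at \<theta>)"
    and t: "t \<in> {a<..<b}"
  shows "((\<lambda>\<theta>. u (X \<theta>) \<theta> + \<sigma> * riemann_w K \<gamma> cv Si (\<tau> (X \<theta>) \<theta>)) has_real_derivative 0) (at t)"
proof -
  obtain e where e: "0 < e" "cball (X t) e \<subseteq> I"
    using region_open[OF I] X[OF t] by (auto simp: open_contains_cball)
  define \<epsilon> where "\<epsilon> = e / 2"
  have \<epsilon>: "0 < \<epsilon>" "{X t - 2 * \<epsilon>..X t + 2 * \<epsilon>} \<subseteq> I" using e by (auto simp: \<epsilon>_def cball_eq_atLeastAtMost)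
  have "isCont X t" using X[OF t] DERIV_isCont by blast
  then obtain \<delta> where \<delta>: "0 < \<delta>" "\<And>\<theta>. \<bar>\<theta> - t\<bar> < \<delta> \<Longrightarrow> \<bar>X \<theta> - X t\<bar> < \<epsilon>"
    using \<epsilon>(1) unfolding continuous_at_eps_delta dist_real_def by metis
  \<comment> \<open>At most halfway towards \<open>a\<close> and \<open>b\<close>, so that
    \<open>t1 > 0\<close> even if \<open>a = 0\<close>; the terms with \<open>\<delta>\<close> keep
    the curve within \<open>\<epsilon>\<close> of \<open>X t\<close>.\<close>
  define t1 t2 where "t1 = max ((a + t) / 2) (t - \<delta> / 2)" and "t2 = min ((t + b) / 2) (t + \<delta> / 2)"
  have t12: "a < t1" "t1 < t" "t < t2" "t2 < b" "t - \<delta> < t1" "t2 < t + \<delta>"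
    using t \<delta>(1) by (auto simp: t1_def t2_def field_simps less_max_iff_disj min_less_iff_disj)
  let ?R = "{X t - 2 * \<epsilon>..X t + 2 * \<epsilon>}" and ?T = "{t1..t2}"
  have T0: "?T \<subseteq> {0..}" "0 \<notin> ?T" using t12 assms by auto
  obtain L where L: "lipschitz_rect L (?R \<inter> I) ?T \<tau>" "lipschitz_rect L (?R \<inter> I) ?T u"
    using region_lipschitz[OF I, of ?R ?T] \<epsilon>(2) closure_subset[of I] T0 by auto
  have RI: "?R \<inter> I = ?R" using \<epsilon>(2) by blast
  obtain M where M: "0 < M" "\<And>x t. x \<notin> {x0, x1} \<Longrightarrow> 0 \<le> t \<Longrightarrow> t \<le> t2 \<Longrightarrow>
      1 / M \<le> \<tau> x t \<and> \<tau> x t \<le> M \<and> \<bar>u x t\<bar> \<le> M" using sol_bounds[of t2] by blast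
  have M1: "0 < 1 / M" using M by simp
  obtain B C where g: "\<And>v w. v \<in> {1 / M..M} \<Longrightarrow> w \<in> {1 / M..M} \<Longrightarrow>
      \<bar>sound_speed K \<gamma> cv Si v - sound_speed K \<gamma> cv Si w\<bar> \<le> B * \<bar>v - w\<bar>"
    "\<And>v. v \<in> {1 / M..M} \<Longrightarrow> \<bar>sound_speed K \<gamma> cv Si v\<bar> \<le> C"
    using gas_lipschitz[OF \<gamma> K M1] by metis
  have pos: "0 < v" if "v \<in> {1 / M..M}" for v by (rule less_le_trans[OF M1]) (use that in simp)
  show ?thesis
  proof (rule invariant_along_characteristic[of "X t - 2 * \<epsilon>" "X t + 2 * \<epsilon>" t t1 t2 \<epsilon> \<sigma> L \<tau> u "1 / M" M
        "pressure K \<gamma> cv Si" "sound_speed K \<gamma> cv Si" "riemann_w K \<gamma> cv Si" B C X])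
    show "\<tau> x \<theta> \<in> {1 / M..M}" if "x \<in> ?R" "\<theta> \<in> ?T" for x \<theta>
      using M(2)[of x \<theta>] region_avoids[OF I, of x] that T0 \<epsilon>(2) by auto
    show "(X has_real_derivative \<sigma> * sound_speed K \<gamma> cv Si (\<tau> (X \<theta>) \<theta>)) (at \<theta>)" if "\<theta> \<in> {t1<..<t2}" for \<theta>
      using X[of \<theta>] that t12 by auto
    show "X t - 2 * \<epsilon> + \<epsilon> \<le> X \<theta> \<and> X \<theta> \<le> X t + 2 * \<epsilon> - \<epsilon>" if "\<theta> \<in> {t1<..<t2}" for \<theta>
      using \<delta>(2)[of \<theta>] that t12 by (auto simp: abs_less_iff)
  qed (use \<epsilon> t12 \<sigma> L[unfolded RI] region_balance[OF I \<epsilon>(2) T0(1)] g pos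
      pressure_deriv[OF \<gamma> K] riemann_w_deriv[OF \<gamma> K] in auto)
qed

text \<open>No waves come in from outside: the characteristics that move towards the strip start in
  the constant part of the data.\<close>

lemma outer_invariant:
  assumes I: "(I, Si) \<in> regions" and side: "(I = {..<x0} \<and> \<sigma> = 1) \<or> (I = {x1<..} \<and> \<sigma> = -1)"
    and y: "y \<in> I" "y' \<in> I" and t: "0 < t"
  shows "u y t + \<sigma> * riemann_w K \<gamma> cv Si (\<tau> y t) = u y' 0 + \<sigma> * riemann_w K \<gamma> cv Si (\<tau> y' 0)"
proof -
  have \<sigma>: "\<sigma> \<in> {-1, 1}" "\<sigma> * \<sigma> = 1" using side by auto
  obtain M where M: "0 < M" "\<And>x \<theta>. x \<notin> {x0, x1} \<Longrightarrow> 0 \<le> \<theta> \<Longrightarrow> \<theta> \<le> t \<Longrightarrow>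
      1 / M \<le> \<tau> x \<theta> \<and> \<tau> x \<theta> \<le> M \<and> \<bar>u x \<theta>\<bar> \<le> M" using sol_bounds[of t] by blast
  have M1: "0 < 1 / M" using M by simp
  obtain B C where g: "\<And>v w. v \<in> {1 / M..M} \<Longrightarrow> w \<in> {1 / M..M} \<Longrightarrow>
      \<bar>sound_speed K \<gamma> cv Si v - sound_speed K \<gamma> cv Si w\<bar> \<le> B * \<bar>v - w\<bar>"
    "\<And>v w. v \<in> {1 / M..M} \<Longrightarrow> w \<in> {1 / M..M} \<Longrightarrow>
      \<bar>riemann_w K \<gamma> cv Si v - riemann_w K \<gamma> cv Si w\<bar> \<le> B * \<bar>v - w\<bar>"
    "\<And>v. v \<in> {1 / M..M} \<Longrightarrow> \<bar>sound_speed K \<gamma> cv Si v\<bar> \<le> C"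
    using gas_lipschitz[OF \<gamma> K M1] by metis
  \<comment> \<open>The interval that a characteristic ending at \<open>y\<close> can have visited
    since time \<open>0\<close> at speed at most \<open>C\<close>; it extends away from the strip,
    hence stays in \<open>I\<close>.\<close>
  define p q where "p = (if \<sigma> = 1 then y - C * t else y)" and "q = (if \<sigma> = 1 then y else y + C * t)"
  have \<tau>_in: "\<tau> x \<theta> \<in> {1 / M..M}" if "x \<in> I" "\<theta> \<in> {0..t}" for x \<theta>
    using M(2)[of x \<theta>] region_avoids[OF I that(1)] that(2) by auto
  have C0: "0 \<le> C" using g(3)[OF \<tau>_in[OF y(1), of t]] t by fastforce
  then have Ct: "0 \<le> C * t" using t by simp
  have pq: "p \<le> q" "{p..q} \<subseteq> I" using Ct side y(1) by (auto simp: p_def q_def)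
  obtain L where L: "lipschitz_rect L ({p..q} \<inter> I) {0..t} \<tau>" "lipschitz_rect L ({p..q} \<inter> I) {0..t} u"
  proof -
    have "{p..q} \<subseteq> closure I" using pq(2) closure_subset by blast
    moreover have "{p..q} \<inter> {x0, x1} = {}" using pq(2) region_avoids[OF I] by blast
    ultimately show thesis using region_lipschitz[OF I, of "{p..q}" "{0..t}"] that by auto
  qed
  have pqI: "{p..q} \<inter> I = {p..q}" using pq(2) by blast
  note L = L[unfolded pqI]
  \<comment> \<open>Clipping to this compact rectangle makes the speed globally Lipschitz and
    bounded; \<open>X_in\<close> shows afterwards that the clipping has no effect on the
    curve.\<close>
  define clx where "clx x = max p (min q x)" for x
  define clt where "clt \<theta> = max 0 (min t \<theta>)" for \<theta>
  have cl_in: "clx x \<in> {p..q}" "clt \<theta> \<in> {0..t}" for x \<theta> using pq(1) t by (auto simp: clx_def clt_def)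
  define h where "h x \<theta> = \<sigma> * sound_speed K \<gamma> cv Si (\<tau> (clx x) (clt \<theta>))" for x \<theta>
  have "lipschitz_rect (\<bar>B\<bar> * L) {p..q} {0..t} (\<lambda>x \<theta>. sound_speed K \<gamma> cv Si (\<tau> x \<theta>))"
    by (rule lipschitz_rect_compose[OF L(1), of "{1 / M..M}"]) (use \<tau>_in pq(2) g(1) in auto)
  note cs_lip = lipschitz_rectD[OF this]
  define N where "N = \<bar>B\<bar> * L"
  have N0: "0 \<le> N"
  proof -
    have "0 \<le> N * (\<bar>p - p\<bar> + \<bar>0 - t\<bar>)"
      unfolding N_def by (rule order.trans[OF abs_ge_zero cs_lip]) (use pq t in auto)
    then show ?thesis using t by (simp add: zero_le_mult_iff)
  qed
  have h_lip: "\<bar>h x \<theta> - h y \<theta>'\<bar> \<le> N * (\<bar>x - y\<bar> + \<bar>\<theta> - \<theta>'\<bar>)" for x y \<theta> \<theta>'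
  proof -
    have "\<bar>h x \<theta> - h y \<theta>'\<bar>
        = \<bar>sound_speed K \<gamma> cv Si (\<tau> (clx x) (clt \<theta>)) - sound_speed K \<gamma> cv Si (\<tau> (clx y) (clt \<theta>'))\<bar>"
      using \<sigma>(1) by (auto simp: h_def)
    also have "\<dots> \<le> N * (\<bar>clx x - clx y\<bar> + \<bar>clt \<theta> - clt \<theta>'\<bar>)"
      unfolding N_def by (rule cs_lip[OF cl_in(1) cl_in(1) cl_in(2) cl_in(2)])
    also have "\<dots> \<le> N * (\<bar>x - y\<bar> + \<bar>\<theta> - \<theta>'\<bar>)"
      using N0 by (intro mult_left_mono add_mono) (auto simp: clx_def clt_def)
    finally show ?thesis .
  qed
  have h_lip1: "\<bar>h x \<theta> - h y \<theta>\<bar> \<le> N * \<bar>x - y\<bar>" for x y \<theta> using h_lip[of x \<theta> y \<theta>] by simp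
  have "lipschitz_rect N UNIV UNIV h" unfolding lipschitz_rect_def using h_lip by blast
  from continuous_on_lipschitz_rect[OF this] have h_cont: "continuous_on UNIV (\<lambda>(x, t). h x t)" by simp
  have h_bdd: "\<bar>h x \<theta>\<bar> \<le> C" and h_pos: "0 \<le> \<sigma> * h x \<theta>" for x \<theta>
  proof -
    have in1: "\<tau> (clx x) (clt \<theta>) \<in> {1 / M..M}" using \<tau>_in cl_in pq(2) by blast
    then show "\<bar>h x \<theta>\<bar> \<le> C" using g(3)[OF in1] \<sigma>(1) by (auto simp: h_def)
    have "0 < sound_speed K \<gamma> cv Si (\<tau> (clx x) (clt \<theta>))"
      by (rule sound_speed_pos[OF \<gamma> K], rule less_le_trans[OF M1]) (use in1 in simp)
    then show "0 \<le> \<sigma> * h x \<theta>" using \<sigma>(2) by (simp add: h_def flip: mult.assoc)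
  qed
  obtain X where X: "X t = y" "\<And>\<theta>. (X has_real_derivative h (X \<theta>) \<theta>) (at \<theta>)"
    using ode_global_exists[OF h_lip1 h_cont h_bdd] by metis
  have X_in: "X \<theta> \<in> {p..q}" if "\<theta> \<in> {0..t}" for \<theta>
  proof -
    have le: "\<theta> \<le> t" using that by simp
    have "\<bar>X t - X \<theta>\<bar> \<le> C * t - C * \<theta>"
      by (rule abs_diff_le_of_derivative_bound[OF le, where D' = "\<lambda>\<theta>. h (X \<theta>) \<theta>" and \<phi>' = "\<lambda>_. C"])
        (auto intro!: has_field_derivative_at_within[OF X(2)] derivative_eq_intros h_bdd)
    then have "\<bar>y - X \<theta>\<bar> \<le> C * t" using X(1) C0 that by (smt (verit) atLeastAtMost_iff mult_nonneg_nonneg)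
    moreover have "\<sigma> * X \<theta> \<le> \<sigma> * X t"
    proof (rule DERIV_nonneg_imp_nondecreasing[OF le])
      fix x
      show "\<exists>y. ((\<lambda>\<theta>. \<sigma> * X \<theta>) has_real_derivative y) (at x) \<and> 0 \<le> y"
        using DERIV_cmult[OF X(2)] h_pos by blast
    qed
    ultimately show ?thesis using \<sigma>(1) X(1) by (auto simp: p_def q_def abs_le_iff)
  qed
  have X_speed: "h (X \<theta>) \<theta> = \<sigma> * sound_speed K \<gamma> cv Si (\<tau> (X \<theta>) \<theta>)" if "\<theta> \<in> {0..t}" for \<theta>
    using X_in[OF that] that by (auto simp: h_def clx_def clt_def)
  define G where "G \<theta> = u (X \<theta>) \<theta> + \<sigma> * riemann_w K \<gamma> cv Si (\<tau> (X \<theta>) \<theta>)" for \<theta>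
  have "lipschitz_rect (\<bar>B\<bar> * L) {p..q} {0..t} (\<lambda>x \<theta>. riemann_w K \<gamma> cv Si (\<tau> x \<theta>))"
    by (rule lipschitz_rect_compose[OF L(1), of "{1 / M..M}"]) (use \<tau>_in pq(2) g(2) in auto)
  from continuous_on_lipschitz_rect[OF lipschitz_rect_add[OF L(2) this, of \<sigma>]]
  have cont2: "continuous_on ({p..q} \<times> {0..t}) (\<lambda>(x, \<theta>). u x \<theta> + \<sigma> * riemann_w K \<gamma> cv Si (\<tau> x \<theta>))" .
  have "continuous_on {0..t} (\<lambda>\<theta>. (X \<theta>, \<theta>))"
    by (intro continuous_on_Pair continuous_on_id continuous_at_imp_continuous_on ballI DERIV_isCont[OF X(2)])
  then have "continuous_on {0..t} (\<lambda>\<theta>. (\<lambda>(x, \<theta>). u x \<theta> + \<sigma> * riemann_w K \<gamma> cv Si (\<tau> x \<theta>)) (X \<theta>, \<theta>))"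
    by (rule continuous_on_compose2[OF cont2]) (use X_in in auto)
  then have "continuous_on {0..t} G" by (simp add: G_def)
  moreover have "(G has_real_derivative 0) (at \<theta>)" if "0 < \<theta>" "\<theta> < t" for \<theta>
    unfolding G_def
  proof (rule region_invariant[OF I \<sigma>(1), of 0 t])
    fix \<theta> assume "\<theta> \<in> {0<..<t}"
    then have \<theta>: "\<theta> \<in> {0..t}" by auto
    show "X \<theta> \<in> I \<and> (X has_real_derivative \<sigma> * sound_speed K \<gamma> cv Si (\<tau> (X \<theta>) \<theta>)) (at \<theta>)"
      using X_in[OF \<theta>] pq(2) X(2)[of \<theta>] X_speed[OF \<theta>] by auto
  qed (use that in auto)
  \<comment> \<open>Away from the contacts the Lipschitz bounds hold down to \<open>t = 0\<close>,
    so the constant reaches the data, where every \<open>y'\<close> in the region gives the same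
    value.\<close>
  ultimately have "G t = G 0" using t by (intro DERIV_isconst_end) auto
  moreover have "\<tau> (X 0) 0 = \<tau> y' 0" "u (X 0) 0 = u y' 0"
  proof -
    have "X 0 \<in> I" using X_in[of 0] pq(2) t by auto
    then show "\<tau> (X 0) 0 = \<tau> y' 0" "u (X 0) 0 = u y' 0"
      using smooth side y(2) unfolding smooth_data_between_def constant_on_def by metis+
  qed
  ultimately show ?thesis using X(1) by (simp add: G_def)
qed

end


section \<open>The reflection laws\<close>

context two_contacts
begin

lemma subregion_lipschitz:
  assumes I: "(I, Si) \<in> regions" and J: "{p<..<q} \<subseteq> I" "p < q" and a: "0 < a" "a \<le> b"
  shows "\<exists>L. lipschitz_rect L {p<..<q} {a..b} \<tau> \<and> lipschitz_rect L {p<..<q} {a..b} u"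
proof -
  have "{p..q} \<subseteq> closure I" using closure_mono[OF J(1)] J(2) by simp
  then obtain L where "lipschitz_rect L ({p..q} \<inter> I) {a..b} \<tau>" "lipschitz_rect L ({p..q} \<inter> I) {a..b} u"
    using region_lipschitz[OF I, of "{p..q}" "{a..b}"] a by auto
  moreover have "{p<..<q} \<subseteq> {p..q} \<inter> I" using J(1) by auto
  ultimately show ?thesis by (meson lipschitz_rect_mono order_refl)
qed

lemma traces:
  assumes I: "(I, Si) \<in> regions" and J: "{p<..<q} \<subseteq> I" "p < q" and t: "0 < t"
  shows "((\<lambda>x. \<tau> x t) \<longlongrightarrow> extend p q \<tau> p t) (at_right p)" "((\<lambda>x. u x t) \<longlongrightarrow> extend p q u p t) (at_right p)"
    "((\<lambda>x. \<tau> x t) \<longlongrightarrow> extend p q \<tau> q t) (at_left q)" "((\<lambda>x. u x t) \<longlongrightarrow> extend p q u q t) (at_left q)"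
proof -
  obtain L where L: "lipschitz_rect L {p<..<q} {t..t} \<tau>" "lipschitz_rect L {p<..<q} {t..t} u"
    using subregion_lipschitz[OF I J t, of t] by auto
  have T: "closed {t..t}" "t \<in> {t..t}" by auto
  show "((\<lambda>x. \<tau> x t) \<longlongrightarrow> extend p q \<tau> p t) (at_right p)" "((\<lambda>x. \<tau> x t) \<longlongrightarrow> extend p q \<tau> q t) (at_left q)"
    using extend_lipschitz[OF J(2) L(1) T(1)] T(2) by metis+
  show "((\<lambda>x. u x t) \<longlongrightarrow> extend p q u p t) (at_right p)" "((\<lambda>x. u x t) \<longlongrightarrow> extend p q u q t) (at_left q)"
    using extend_lipschitz[OF J(2) L(2) T(1)] T(2) by metis+
qed

lemma extend_bounds:
  assumes I: "(I, Si) \<in> regions" and J: "{p<..<q} \<subseteq> I" "p < q"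
  shows "\<exists>M>0. \<forall>x. \<forall>t\<in>{0<..T}. 1 / M \<le> extend p q \<tau> x t \<and> extend p q \<tau> x t \<le> M \<and> \<bar>extend p q u x t\<bar> \<le> M"
proof -
  obtain M where M: "0 < M" "\<And>x t. x \<notin> {x0, x1} \<Longrightarrow> 0 \<le> t \<Longrightarrow> t \<le> T \<Longrightarrow>
      1 / M \<le> \<tau> x t \<and> \<tau> x t \<le> M \<and> \<bar>u x t\<bar> \<le> M" using sol_bounds[of T] by blast
  have "1 / M \<le> extend p q \<tau> x t \<and> extend p q \<tau> x t \<le> M \<and> \<bar>extend p q u x t\<bar> \<le> M"
    if t: "t \<in> {0<..T}" for x t
  proof -
    have t0: "0 < t" using t by simp
    note tr = traces[OF I J t0]
    have bd: "1 / M \<le> \<tau> y t \<and> \<tau> y t \<le> M \<and> \<bar>u y t\<bar> \<le> M" if "y \<in> {p<..<q}" for y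
      using M(2)[of y t] region_avoids[OF I, of y] J that t by auto
    have lim: "1 / M \<le> l \<and> l \<le> M \<and> \<bar>k\<bar> \<le> M"
      if "((\<lambda>x. \<tau> x t) \<longlongrightarrow> l) F" "((\<lambda>x. u x t) \<longlongrightarrow> k) F" "F \<noteq> bot" "\<forall>\<^sub>F y in F. y \<in> {p<..<q}" for l k F
    proof (intro conjI)
      show "1 / M \<le> l" by (rule tendsto_lowerbound[OF that(1) _ that(3)]) (use that(4) bd in \<open>auto elim: eventually_mono\<close>)
      show "l \<le> M" by (rule tendsto_upperbound[OF that(1) _ that(3)]) (use that(4) bd in \<open>auto elim: eventually_mono\<close>)
      show "\<bar>k\<bar> \<le> M" by (rule tendsto_upperbound[OF tendsto_rabs[OF that(2)] _ that(3)]) (use that(4) bd in \<open>auto elim: eventually_mono\<close>)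
    qed
    consider "x \<le> p" | "q \<le> x" | "x \<in> {p<..<q}" by force
    then show ?thesis
    proof cases
      case 1
      then have "extend p q f x t = extend p q f p t" for f by (simp add: extend_def)
      then show ?thesis using lim[OF tr(1,2)] eventually_at_right_real[OF J(2)] by simp
    next
      case 2
      then have "extend p q f x t = extend p q f q t" for f using J(2) by (simp add: extend_def)
      then show ?thesis using lim[OF tr(3,4)] eventually_at_left_real[OF J(2)] by simp
    next
      case 3
      then show ?thesis using bd[OF 3] by simp
    qed
  qed
  with M(1) show ?thesis by blast
qed

lemma extend_pos:
  assumes "(I, Si) \<in> regions" "{p<..<q} \<subseteq> I" "p < q" "0 < t"
  shows "0 < extend p q \<tau> x t"
proof -
  obtain M where M: "0 < M" "\<forall>x. \<forall>t\<in>{0<..t}. 1 / M \<le> extend p q \<tau> x t"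
    using extend_bounds[OF assms(1-3), of t] by blast
  then show ?thesis using assms(4) less_le_trans[of 0 "1 / M" "extend p q \<tau> x t"] by simp
qed

lemma pressure_traces:
  assumes I: "(I, Si) \<in> regions" and J: "{p<..<q} \<subseteq> I" "p < q" and t: "0 < t"
  shows "Lim (at_right p) (\<lambda>x. pressure K \<gamma> cv (S x) (\<tau> x t)) = pressure K \<gamma> cv Si (extend p q \<tau> p t)"
    "Lim (at_left q) (\<lambda>x. pressure K \<gamma> cv (S x) (\<tau> x t)) = pressure K \<gamma> cv Si (extend p q \<tau> q t)"
proof -
  have cont: "isCont (pressure K \<gamma> cv Si) (extend p q \<tau> x t)" for x
    using pressure_deriv[OF \<gamma> K extend_pos[OF I J t]] DERIV_isCont by blast
  have *: "Lim F (\<lambda>x. pressure K \<gamma> cv (S x) (\<tau> x t)) = pressure K \<gamma> cv Si (extend p q \<tau> x t)"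
    if "((\<lambda>x. \<tau> x t) \<longlongrightarrow> extend p q \<tau> x t) F" "F \<noteq> bot" "\<forall>\<^sub>F y in F. y \<in> {p<..<q}" for x F
  proof (rule tendsto_Lim[OF that(2)])
    have "\<forall>\<^sub>F y in F. pressure K \<gamma> cv Si (\<tau> y t) = pressure K \<gamma> cv (S y) (\<tau> y t)"
      using that(3) by eventually_elim (use region_entropy[OF I] J(1) in auto)
    with isCont_tendsto_compose[OF cont that(1)]
    show "((\<lambda>x. pressure K \<gamma> cv (S x) (\<tau> x t)) \<longlongrightarrow> pressure K \<gamma> cv Si (extend p q \<tau> x t)) F"
      by (rule Lim_transform_eventually)
  qed
  show "Lim (at_right p) (\<lambda>x. pressure K \<gamma> cv (S x) (\<tau> x t)) = pressure K \<gamma> cv Si (extend p q \<tau> p t)"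
    using *[OF traces(1)[OF I J t]] eventually_at_right_real[OF J(2)] by simp
  show "Lim (at_left q) (\<lambda>x. pressure K \<gamma> cv (S x) (\<tau> x t)) = pressure K \<gamma> cv Si (extend p q \<tau> q t)"
    using *[OF traces(3)[OF I J t]] eventually_at_left_real[OF J(2)] by simp
qed

lemma pressure_lipschitz:
  assumes I: "(I, Si) \<in> regions" and J: "{p<..<q} \<subseteq> I" "p < q" and a: "0 < a" "a \<le> b"
  shows "\<exists>L. lipschitz_rect L {p<..<q} {a..b} (\<lambda>x t. pressure K \<gamma> cv (S x) (\<tau> x t))"
proof -
  obtain L where L: "lipschitz_rect L {p<..<q} {a..b} \<tau>" using subregion_lipschitz[OF I J a] by blast
  obtain M where M: "0 < M" "\<And>x t. x \<notin> {x0, x1} \<Longrightarrow> 0 \<le> t \<Longrightarrow> t \<le> b \<Longrightarrow>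
      1 / M \<le> \<tau> x t \<and> \<tau> x t \<le> M \<and> \<bar>u x t\<bar> \<le> M" using sol_bounds[of b] by blast
  have M1: "0 < 1 / M" using M by simp
  obtain B where B: "\<And>v w. v \<in> {1 / M..M} \<Longrightarrow> w \<in> {1 / M..M} \<Longrightarrow>
      \<bar>pressure K \<gamma> cv Si v - pressure K \<gamma> cv Si w\<bar> \<le> B * \<bar>v - w\<bar>"
    using gas_lipschitz[OF \<gamma> K M1] by metis
  have "\<tau> x t \<in> {1 / M..M}" if "x \<in> {p<..<q}" "t \<in> {a..b}" for x t
    using M(2)[of x t] region_avoids[OF I, of x] J that a by auto
  from lipschitz_rect_compose[OF L this B]
  have "lipschitz_rect (\<bar>B\<bar> * L) {p<..<q} {a..b} (\<lambda>x t. pressure K \<gamma> cv Si (\<tau> x t))" by blast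
  moreover have "S x = Si" if "x \<in> {p<..<q}" for x using region_entropy[OF I] J that by blast
  ultimately have "lipschitz_rect (\<bar>B\<bar> * L) {p<..<q} {a..b} (\<lambda>x t. pressure K \<gamma> cv (S x) (\<tau> x t))"
    by (simp add: lipschitz_rect_def)
  then show ?thesis by blast
qed

text \<open>Obtained from \<open>conservation_law_continuous_flux\<close> with the flux
  \<open>- u\<close> of the first law and the flux \<open>p\<close> of the second.\<close>

lemma contact:
  assumes I: "(I, Si) \<in> regions" "{p<..<y} \<subseteq> I" "p < y"
    and I': "(I', Si') \<in> regions" "{y<..<q} \<subseteq> I'" "y < q"
    and D: "{p<..<q} \<inter> {x0, x1} = {y}" and t: "0 < t"
  shows "extend p y u y t = extend y q u y t"
    "pressure K \<gamma> cv Si (extend p y \<tau> y t) = pressure K \<gamma> cv Si' (extend y q \<tau> y t)"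
proof -
  have bds: "\<exists>M. \<forall>x t. x \<notin> {x0, x1} \<longrightarrow> 0 \<le> t \<longrightarrow> t \<le> T \<longrightarrow> \<bar>\<tau> x t\<bar> \<le> M"
    "\<exists>M. \<forall>x t. x \<notin> {x0, x1} \<longrightarrow> 0 \<le> t \<longrightarrow> t \<le> T \<longrightarrow> \<bar>u x t\<bar> \<le> M" for T
  proof -
    obtain M where "\<And>x t. x \<notin> {x0, x1} \<Longrightarrow> 0 \<le> t \<Longrightarrow> t \<le> T \<Longrightarrow> \<tau> x t \<le> M \<and> \<bar>u x t\<bar> \<le> M"
      using sol_bounds[of T] by blast
    moreover from this have "\<bar>\<tau> x t\<bar> \<le> M" if "x \<notin> {x0, x1}" "0 \<le> t" "t \<le> T" for x t
      using tau_pos[OF that(1,2)] that by simp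
    ultimately show "\<exists>M. \<forall>x t. x \<notin> {x0, x1} \<longrightarrow> 0 \<le> t \<longrightarrow> t \<le> T \<longrightarrow> \<bar>\<tau> x t\<bar> \<le> M"
      "\<exists>M. \<forall>x t. x \<notin> {x0, x1} \<longrightarrow> 0 \<le> t \<longrightarrow> t \<le> T \<longrightarrow> \<bar>u x t\<bar> \<le> M" by blast+
  qed
  have cl: "conservation_law {x0, x1} \<tau> (\<lambda>x t. - u x t)"
    "conservation_law {x0, x1} u (\<lambda>x t. pressure K \<gamma> cv (S x) (\<tau> x t))"
    using sol by (auto simp: euler_solution_def)
  have minus: "lipschitz_rect L A T (\<lambda>x t. - u x t)" if "lipschitz_rect L A T u" for L A T
    using that by (simp add: lipschitz_rect_def abs_minus_commute)
  have "Lim (at_left y) (\<lambda>x. - u x t) = Lim (at_right y) (\<lambda>x. - u x t)"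
    by (rule conservation_law_continuous_flux[OF cl(1) I(3) I'(3) D bds(1) _ _ t])
      (use subregion_lipschitz[OF I] subregion_lipschitz[OF I'] minus in blast)+
  moreover have "Lim (at_left y) (\<lambda>x. - u x t) = - extend p y u y t"
    by (intro tendsto_Lim tendsto_minus traces(4)[OF I t]) simp
  moreover have "Lim (at_right y) (\<lambda>x. - u x t) = - extend y q u y t"
    by (intro tendsto_Lim tendsto_minus traces(2)[OF I' t]) simp
  ultimately show "extend p y u y t = extend y q u y t" by simp
  have "Lim (at_left y) (\<lambda>x. pressure K \<gamma> cv (S x) (\<tau> x t)) = Lim (at_right y) (\<lambda>x. pressure K \<gamma> cv (S x) (\<tau> x t))"
    by (rule conservation_law_continuous_flux[OF cl(2) I(3) I'(3) D bds(2) _ _ t])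
      (use pressure_lipschitz[OF I] pressure_lipschitz[OF I'] in blast)+
  then show "pressure K \<gamma> cv Si (extend p y \<tau> y t) = pressure K \<gamma> cv Si' (extend y q \<tau> y t)"
    by (simp only: pressure_traces(2)[OF I t] pressure_traces(1)[OF I' t])
qed

text \<open>These are the constants \<open>A\<close> and \<open>B\<close> of the overview. The
  sample points at distance \<open>1\<close> are arbitrary: by \<open>outer_invariant\<close> every
  point on the same side gives the same value.\<close>

definition "invA = u (x0 - 1) 0 + riemann_w K \<gamma> cv Sl (\<tau> (x0 - 1) 0)"
definition "invB = u (x1 + 1) 0 - riemann_w K \<gamma> cv Sr (\<tau> (x1 + 1) 0)"

abbreviation "us \<equiv> extend x0 x1 u"
abbreviation "ts \<equiv> extend x0 x1 \<tau>"
definition "ws x t = riemann_w K \<gamma> cv Sm (ts x t)"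
definition "ss x t = us x t + ws x t"
definition "rs x t = us x t - ws x t"
text \<open>The law \<open>c = m z^d\<close> as a function of
  \<open>s - r = 2 * m * z\<close>.\<close>

definition "speed y = entropy_var K \<gamma> cv Sm * (y / (2 * entropy_var K \<gamma> cv Sm)) powr d_exp \<gamma>"

lemma regions_in:
  "({..<x0}, Sl) \<in> regions" "({x0<..<x1}, Sm) \<in> regions" "({x1<..}, Sr) \<in> regions"
  by (auto simp: regions_def)

lemma tendsto_riemann_w:
  assumes "(f \<longlongrightarrow> l) F" "0 < l"
  shows "((\<lambda>x. riemann_w K \<gamma> cv Si (f x)) \<longlongrightarrow> riemann_w K \<gamma> cv Si l) F"
  using isCont_tendsto_compose[OF DERIV_isCont[OF riemann_w_deriv[OF \<gamma> K assms(2)]] assms(1)] .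

text \<open>Outside, \<open>u + m z\<close> is \<open>invA\<close>; crossing the contact keeps
  \<open>u\<close> and multiplies \<open>m z\<close> by \<open>Q\<close>. At \<open>x1\<close> the
  strength is \<open>1 / Q\<close> from left to right, so there too the outer value of
  \<open>m z\<close> is the inner one divided by \<open>Q\<close>.\<close>

lemma contact_left:
  assumes t: "0 < t"
  shows "us x0 t + ws x0 t / Q = invA"
proof -
  note I' = regions_in(2) order_refl x01
  have J: "{x0 - 1<..<x0} \<subseteq> {..<x0}" "x0 - 1 < x0" by auto
  note L = regions_in(1) J
  have D: "{x0 - 1<..<x1} \<inter> {x0, x1} = {x0}" using x01 by auto
  note ct = contact[OF L I' D t]
  have pos: "0 < extend (x0 - 1) x0 \<tau> x0 t" "0 < ts x0 t"
    using extend_pos[OF L t] extend_pos[OF I' t] by auto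
  have "((\<lambda>x. u x t + riemann_w K \<gamma> cv Sl (\<tau> x t)) \<longlongrightarrow>
      extend (x0 - 1) x0 u x0 t + riemann_w K \<gamma> cv Sl (extend (x0 - 1) x0 \<tau> x0 t)) (at_left x0)"
    by (intro tendsto_add tendsto_riemann_w traces[OF L t] pos)
  moreover have "\<forall>\<^sub>F x in at_left x0. u x t + riemann_w K \<gamma> cv Sl (\<tau> x t) = invA"
    using eventually_at_left_real[OF J(2)]
  proof eventually_elim
    case (elim x)
    then show ?case using outer_invariant[OF regions_in(1), of 1 x "x0 - 1" t] t by (simp add: invA_def)
  qed
  then have "((\<lambda>x. u x t + riemann_w K \<gamma> cv Sl (\<tau> x t)) \<longlongrightarrow> invA) (at_left x0)"
    by (rule tendsto_eventually)
  ultimately have "extend (x0 - 1) x0 u x0 t + riemann_w K \<gamma> cv Sl (extend (x0 - 1) x0 \<tau> x0 t) = invA"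
    by (rule tendsto_unique[OF trivial_limit_at_left_real])
  moreover have "ws x0 t = Q * riemann_w K \<gamma> cv Sl (extend (x0 - 1) x0 \<tau> x0 t)"
    unfolding ws_def using pressure_jump[OF \<gamma> K pos ct(2)] jump0 by simp
  ultimately show ?thesis using ct(1) Q by simp
qed

lemma contact_right:
  assumes t: "0 < t"
  shows "us x1 t - ws x1 t / Q = invB"
proof -
  note I = regions_in(2) order_refl x01
  have J: "{x1<..<x1 + 1} \<subseteq> {x1<..}" "x1 < x1 + 1" by auto
  note R = regions_in(3) J
  have D: "{x0<..<x1 + 1} \<inter> {x0, x1} = {x1}" using x01 by auto
  note ct = contact[OF I R D t]
  have pos: "0 < ts x1 t" "0 < extend x1 (x1 + 1) \<tau> x1 t"
    using extend_pos[OF R t] extend_pos[OF I t] by auto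
  have "((\<lambda>x. u x t - riemann_w K \<gamma> cv Sr (\<tau> x t)) \<longlongrightarrow>
      extend x1 (x1 + 1) u x1 t - riemann_w K \<gamma> cv Sr (extend x1 (x1 + 1) \<tau> x1 t)) (at_right x1)"
    by (intro tendsto_diff tendsto_riemann_w traces[OF R t] pos)
  moreover have "\<forall>\<^sub>F x in at_right x1. u x t - riemann_w K \<gamma> cv Sr (\<tau> x t) = invB"
    using eventually_at_right_real[OF J(2)]
  proof eventually_elim
    case (elim x)
    then show ?case using outer_invariant[OF regions_in(3), of "-1" x "x1 + 1" t] t by (simp add: invB_def)
  qed
  then have "((\<lambda>x. u x t - riemann_w K \<gamma> cv Sr (\<tau> x t)) \<longlongrightarrow> invB) (at_right x1)"
    by (rule tendsto_eventually)
  ultimately have "extend x1 (x1 + 1) u x1 t - riemann_w K \<gamma> cv Sr (extend x1 (x1 + 1) \<tau> x1 t) = invB"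
    by (rule tendsto_unique[OF trivial_limit_at_right_real])
  moreover have "riemann_w K \<gamma> cv Sr (extend x1 (x1 + 1) \<tau> x1 t) = 1 / Q * ws x1 t"
    unfolding ws_def using pressure_jump[OF \<gamma> K pos ct(2)] jump1 by simp
  ultimately show ?thesis using ct(1) by simp
qed

lemma speed_eq:
  assumes "0 < t"
  shows "speed (ss x t - rs x t) = sound_speed K \<gamma> cv Sm (ts x t)"
proof -
  have "(ss x t - rs x t) / (2 * entropy_var K \<gamma> cv Sm) = z_var \<gamma> (ts x t)"
    using entropy_var_pos[OF \<gamma> K, of cv Sm] by (simp add: ss_def rs_def ws_def riemann_w_def)
  then show ?thesis
    unfolding speed_def sound_speed_eq[OF \<gamma> K extend_pos[OF regions_in(2) order_refl x01 assms]] by simp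
qed

lemma inside:
  assumes "x0 < x" "x < x1"
  shows "ss x t = u x t + riemann_w K \<gamma> cv Sm (\<tau> x t)" "rs x t = u x t - riemann_w K \<gamma> cv Sm (\<tau> x t)"
  using assms by (simp_all add: ss_def rs_def ws_def)

text \<open>From \<open>p_x = - c^2 \<tau>_x\<close> the derivatives of \<open>u + m z\<close> and
  \<open>u - m z\<close> are \<open>u_x + p_x / c\<close> and \<open>u_x - p_x / c\<close>, the
  quantities \<alpha> and \<beta>.\<close>

lemma initial_monotone:
  assumes xy: "x0 < x" "x \<le> y" "y < x1"
  shows "ss x 0 \<le> ss y 0 \<and> rs x 0 \<le> rs y 0"
proof -
  obtain \<tau>' u' where D: "\<And>x. x \<in> {x0<..<x1} \<Longrightarrow> ((\<lambda>x. \<tau> x 0) has_real_derivative \<tau>' x) (at x)"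
    "\<And>x. x \<in> {x0<..<x1} \<Longrightarrow> ((\<lambda>x. u x 0) has_real_derivative u' x) (at x)"
    using smooth unfolding smooth_data_between_def C2_on_def by metis
  let ?c = "\<lambda>x. sound_speed K \<gamma> cv Sm (\<tau> x 0)"
  have deriv: "((\<lambda>x. u x 0 + \<sigma> * riemann_w K \<gamma> cv Sm (\<tau> x 0)) has_real_derivative u' x + \<sigma> * (- ?c x * \<tau>' x)) (at x)"
    if "x \<in> {x0<..<x1}" for x \<sigma>
  proof -
    have "0 < \<tau> x 0" using tau_pos[of x 0] that by auto
    from DERIV_chain2[OF riemann_w_deriv[OF \<gamma> K this] D(1)[OF that]]
    show ?thesis by (intro DERIV_add DERIV_cmult D(2)[OF that])
  qed
  have nonneg: "0 \<le> u' x + \<sigma> * (- ?c x * \<tau>' x)" if x: "x \<in> {x0<..<x1}" and \<sigma>: "\<sigma> \<in> {-1, 1}" for x \<sigma>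
  proof -
    have pos: "0 < \<tau> x 0" using tau_pos[of x 0] x by auto
    have "((\<lambda>y. pressure K \<gamma> cv Sm (\<tau> y 0)) has_real_derivative - (?c x)\<^sup>2 * \<tau>' x) (at x)"
      by (rule DERIV_chain2[OF pressure_deriv[OF \<gamma> K pos] D(1)[OF x]])
    then have "((\<lambda>y. pressure K \<gamma> cv (S y) (\<tau> y 0)) has_real_derivative - (?c x)\<^sup>2 * \<tau>' x) (at x)"
      by (rule has_field_derivative_transform_within_open[of _ _ _ "{x0<..<x1}"])
        (use x region_entropy[OF regions_in(2)] in auto)
    then have px: "deriv (\<lambda>y. pressure K \<gamma> cv (S y) (\<tau> y 0)) x = - (?c x)\<^sup>2 * \<tau>' x" by (rule DERIV_imp_deriv)
    have ux: "deriv (\<lambda>x. u x 0) x = u' x" by (rule DERIV_imp_deriv[OF D(2)[OF x]])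
    have c: "0 < ?c x" by (rule sound_speed_pos[OF \<gamma> K pos])
    have Sx: "S x = Sm" using region_entropy[OF regions_in(2) x] .
    have "- (?c x)\<^sup>2 * \<tau>' x / ?c x = - ?c x * \<tau>' x" using c by (simp add: power2_eq_square)
    moreover have "deriv (\<lambda>x. u x 0) x + deriv (\<lambda>y. pressure K \<gamma> cv (S y) (\<tau> y 0)) x / ?c x \<ge> 0"
      "deriv (\<lambda>x. u x 0) x - deriv (\<lambda>y. pressure K \<gamma> cv (S y) (\<tau> y 0)) x / ?c x \<ge> 0"
      using rarefactive x unfolding rarefactive_data_def by (auto simp: Let_def Sx)
    ultimately show ?thesis using \<sigma> unfolding px ux by auto
  qed
  have mono: "u x 0 + \<sigma> * riemann_w K \<gamma> cv Sm (\<tau> x 0) \<le> u y 0 + \<sigma> * riemann_w K \<gamma> cv Sm (\<tau> y 0)"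
    if "\<sigma> \<in> {-1, 1}" for \<sigma>
  proof (rule DERIV_nonneg_imp_nondecreasing[OF xy(2)])
    fix q assume "x \<le> q" "q \<le> y"
    then have q: "q \<in> {x0<..<x1}" using xy by auto
    show "\<exists>v. ((\<lambda>x. u x 0 + \<sigma> * riemann_w K \<gamma> cv Sm (\<tau> x 0)) has_real_derivative v) (at q) \<and> 0 \<le> v"
      using deriv[OF q] nonneg[OF q that] by blast
  qed
  show ?thesis using mono[of 1] mono[of "-1"] xy by (simp add: inside)
qed

text \<open>Around an interior point the solution is Lipschitz up to \<open>t = 0\<close>, as a
  small neighbourhood misses the corners; so the limit is joint in \<open>x\<close> and
  \<open>t\<close>, which allows it to be taken along curves.\<close>

lemma initial_limit:
  assumes x: "x \<in> {x0<..<x1}"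
  shows "((\<lambda>(y, t). u y t + \<sigma> * riemann_w K \<gamma> cv Sm (\<tau> y t)) \<longlongrightarrow> u x 0 + \<sigma> * riemann_w K \<gamma> cv Sm (\<tau> x 0))
    (at (x, 0) within {x0<..<x1} \<times> {0..})"
proof -
  obtain e where e: "0 < e" "cball x e \<subseteq> {x0<..<x1}"
    using x open_greaterThanLessThan[of x0 x1] unfolding open_contains_cball by blast
  have R: "{x - e..x + e} \<subseteq> {x0<..<x1}" using e(2) by (simp add: cball_eq_atLeastAtMost)
  have "{x - e..x + e} \<inter> {x0, x1} = {}" using R by fastforce
  moreover have "{x - e..x + e} \<subseteq> closure {x0<..<x1}" using R closure_subset by blast
  ultimately obtain L where "lipschitz_rect L ({x - e..x + e} \<inter> {x0<..<x1}) {0..1} \<tau>"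
    "lipschitz_rect L ({x - e..x + e} \<inter> {x0<..<x1}) {0..1} u"
    using region_lipschitz[OF regions_in(2), of "{x - e..x + e}" "{0..1}"] by auto
  moreover have "{x - e..x + e} \<inter> {x0<..<x1} = {x - e..x + e}" using R by blast
  ultimately have L: "lipschitz_rect L {x - e..x + e} {0..1} \<tau>" "lipschitz_rect L {x - e..x + e} {0..1} u" by simp_all
  have lim: "((\<lambda>(y, t). f y t) \<longlongrightarrow> f x 0) (at (x, 0) within {x0<..<x1} \<times> {0..})"
    if "lipschitz_rect L {x - e..x + e} {0..1} f" for f
  proof -
    have "((\<lambda>(y, t). f y t) \<longlongrightarrow> f x 0) (at (x, 0) within {x - e..x + e} \<times> {0..1})"
      using continuous_on_lipschitz_rect[OF that] e(1) unfolding continuous_on_def by fastforce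
    moreover have "at (x, 0) within {x - e..x + e} \<times> {0..1} = at (x, 0) within {x0<..<x1} \<times> {0::real..}"
      by (rule at_within_nhd[of _ "{x - e<..<x + e} \<times> {-1<..<1}"]) (use e(1) R in \<open>auto intro!: open_Times\<close>)
    ultimately show ?thesis by simp
  qed
  have pos: "0 < \<tau> x 0" using tau_pos[of x 0] x by auto
  have "((\<lambda>p. (\<lambda>(y, t). u y t) p + \<sigma> * riemann_w K \<gamma> cv Sm ((\<lambda>(y, t). \<tau> y t) p)) \<longlongrightarrow>
      u x 0 + \<sigma> * riemann_w K \<gamma> cv Sm (\<tau> x 0)) (at (x, 0) within {x0<..<x1} \<times> {0..})"
    by (intro tendsto_add tendsto_mult tendsto_const tendsto_riemann_w lim L pos)
  then show ?thesis by (simp add: case_prod_unfold)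
qed

lemma initial_limits:
  assumes x: "x \<in> {x0<..<x1}"
  shows "((\<lambda>(y, t). ss y t) \<longlongrightarrow> ss x 0) (at (x, 0) within UNIV \<times> {0<..})"
    "((\<lambda>(y, t). rs y t) \<longlongrightarrow> rs x 0) (at (x, 0) within UNIV \<times> {0<..})"
proof -
  have at: "at (x, 0) within {x0<..<x1} \<times> {0<..} = at (x, 0) within UNIV \<times> {0::real<..}"
    by (rule at_within_nhd[of _ "{x0<..<x1} \<times> UNIV"]) (use x in \<open>auto intro!: open_Times\<close>)
  have *: "((\<lambda>(y, t). f y t) \<longlongrightarrow> f x 0) (at (x, 0) within UNIV \<times> {0<..})"
    if f: "\<And>y t. x0 < y \<Longrightarrow> y < x1 \<Longrightarrow> f y t = u y t + \<sigma> * riemann_w K \<gamma> cv Sm (\<tau> y t)" for f \<sigma>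
  proof -
    have "((\<lambda>(y, t). u y t + \<sigma> * riemann_w K \<gamma> cv Sm (\<tau> y t)) \<longlongrightarrow> f x 0) (at (x, 0) within {x0<..<x1} \<times> {0<..})"
      using tendsto_within_subset[OF initial_limit[OF x], of "{x0<..<x1} \<times> {0<..}" \<sigma>] f x by fastforce
    moreover have "\<forall>\<^sub>F p in at (x, 0) within {x0<..<x1} \<times> {0<..}.
        (case p of (y, t) \<Rightarrow> u y t + \<sigma> * riemann_w K \<gamma> cv Sm (\<tau> y t)) = (case p of (y, t) \<Rightarrow> f y t)"
      using f by (auto simp: eventually_at_filter intro!: always_eventually)
    ultimately show ?thesis unfolding at by (rule Lim_transform_eventually)
  qed
  show "((\<lambda>(y, t). ss y t) \<longlongrightarrow> ss x 0) (at (x, 0) within UNIV \<times> {0<..})"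
    by (rule *[of _ 1]) (simp add: inside)
  show "((\<lambda>(y, t). rs y t) \<longlongrightarrow> rs x 0) (at (x, 0) within UNIV \<times> {0<..})"
    by (rule *[of _ "-1"]) (simp add: inside)
qed

lemma strip_invariant:
  assumes \<sigma>: "\<sigma> \<in> {-1, 1}" and a: "0 \<le> a"
    and X: "\<And>\<theta>. \<theta> \<in> {a<..<b} \<Longrightarrow> x0 < X \<theta> \<and> X \<theta> < x1 \<and>
        (X has_real_derivative \<sigma> * speed (ss (X \<theta>) \<theta> - rs (X \<theta>) \<theta>)) (at \<theta>)"
    and t: "t \<in> {a<..<b}"
    and f: "\<And>y t. x0 < y \<Longrightarrow> y < x1 \<Longrightarrow> f y t = u y t + \<sigma> * riemann_w K \<gamma> cv Sm (\<tau> y t)"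
  shows "((\<lambda>\<theta>. f (X \<theta>) \<theta>) has_real_derivative 0) (at t)"
proof (rule has_field_derivative_transform_within_open[of _ _ _ "{a<..<b}"])
  show "((\<lambda>\<theta>. u (X \<theta>) \<theta> + \<sigma> * riemann_w K \<gamma> cv Sm (\<tau> (X \<theta>) \<theta>)) has_real_derivative 0) (at t)"
  proof (rule region_invariant[OF regions_in(2) \<sigma> a _ t])
    fix \<theta> assume \<theta>: "\<theta> \<in> {a<..<b}"
    then have "speed (ss (X \<theta>) \<theta> - rs (X \<theta>) \<theta>) = sound_speed K \<gamma> cv Sm (\<tau> (X \<theta>) \<theta>)"
      using speed_eq[of \<theta> "X \<theta>"] X[OF \<theta>] a by simp
    then show "X \<theta> \<in> {x0<..<x1} \<and> (X has_real_derivative \<sigma> * sound_speed K \<gamma> cv Sm (\<tau> (X \<theta>) \<theta>)) (at \<theta>)"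
      using X[OF \<theta>] by auto
  qed
qed (use t X f in auto)

sublocale strip x0 x1 "(Q - 1) / (Q + 1)" invA invB speed ss rs
proof
  let ?m = "entropy_var K \<gamma> cv Sm" and ?\<eta> = "(Q - 1) / (Q + 1)"
  note m = entropy_var_pos[OF \<gamma> K, of cv Sm] and mid = regions_in(2) order_refl x01
  have d: "1 < d_exp \<gamma>" by (rule d_exp_gt_1[OF \<gamma>])
  show "x0 < x1" by (rule x01)
  show "0 < ?\<eta>" "?\<eta> < 1" using Q by auto
  show "0 < speed y" if "0 < y" for y using that m by (simp add: speed_def)
  show "speed y < speed y'" if "0 < y" "y < y'" for y y'
    unfolding speed_def using that m d by (intro mult_strict_left_mono powr_less_mono2 divide_strict_right_mono) auto
  show "\<exists>L. \<forall>y\<in>{a..b}. \<forall>y'\<in>{a..b}. \<bar>speed y - speed y'\<bar> \<le> L * \<bar>y - y'\<bar>" if "0 < a" for a b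
  proof -
    have "0 < a / (2 * ?m)" using that m by simp
    then obtain L where L: "\<And>v w. v \<in> {a / (2 * ?m)..b / (2 * ?m)} \<Longrightarrow> w \<in> {a / (2 * ?m)..b / (2 * ?m)} \<Longrightarrow>
        \<bar>v powr d_exp \<gamma> - w powr d_exp \<gamma>\<bar> \<le> L * \<bar>v - w\<bar>"
      using powr_lipschitz[of "a / (2 * ?m)" "b / (2 * ?m)" "d_exp \<gamma>"] by meson
    have "\<bar>speed y - speed y'\<bar> \<le> L / 2 * \<bar>y - y'\<bar>" if "y \<in> {a..b}" "y' \<in> {a..b}" for y y'
    proof -
      have "\<bar>speed y - speed y'\<bar> = ?m * \<bar>(y / (2 * ?m)) powr d_exp \<gamma> - (y' / (2 * ?m)) powr d_exp \<gamma>\<bar>"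
        using m by (simp add: speed_def abs_mult flip: right_diff_distrib)
      also have "\<dots> \<le> ?m * (L * \<bar>y / (2 * ?m) - y' / (2 * ?m)\<bar>)"
        using that m by (intro mult_left_mono L) (auto intro: divide_right_mono)
      also have "\<dots> = L / 2 * \<bar>y - y'\<bar>"
        using m by (simp add: abs_divide flip: diff_divide_distrib)
      finally show ?thesis .
    qed
    then show ?thesis by blast
  qed
  \<comment> \<open>A single function of \<open>T\<close> confines \<tau> to a compact set of
    positive numbers, from which the bounds on \<open>riemann_w\<close> over bounded times
    follow.\<close>
  obtain bound where bound: "\<And>T. 0 < bound T \<and> (\<forall>x. \<forall>t\<in>{0<..T}. 1 / bound T \<le> ts x t \<and> ts x t \<le> bound T \<and> \<bar>us x t\<bar> \<le> bound T)"
    using extend_bounds[OF mid] by metis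
  have bound1: "0 < 1 / bound T" for T using bound[of T] by simp
  have ts_in: "ts x t \<in> {1 / bound T..bound T}" if "t \<in> {0<..T}" for x t T using bound[of T] that by auto
  show "\<exists>L. lipschitz_rect L UNIV {a..b} ss \<and> lipschitz_rect L UNIV {a..b} rs" if a: "0 < a" "a \<le> b" for a b
  proof -
    obtain L where L: "lipschitz_rect L {x0<..<x1} {a..b} \<tau>" "lipschitz_rect L {x0<..<x1} {a..b} u"
      using subregion_lipschitz[OF mid a] by auto
    have cl: "closed {a..b}" by simp
    obtain L1 where L1: "lipschitz_rect L1 UNIV {a..b} ts" using extend_lipschitz[OF x01 L(1) cl] by metis
    obtain L2 where L2: "lipschitz_rect L2 UNIV {a..b} us" using extend_lipschitz[OF x01 L(2) cl] by metis
    obtain B where B: "\<And>v w. v \<in> {1 / bound b..bound b} \<Longrightarrow> w \<in> {1 / bound b..bound b} \<Longrightarrow>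
        \<bar>riemann_w K \<gamma> cv Sm v - riemann_w K \<gamma> cv Sm w\<bar> \<le> B * \<bar>v - w\<bar>"
      using gas_lipschitz[OF \<gamma> K bound1[of b]] by metis
    have "lipschitz_rect (\<bar>B\<bar> * L1) UNIV {a..b} ws"
      unfolding ws_def[abs_def] 
    proof (rule lipschitz_rect_compose[OF L1 _ B])
      show "ts x t \<in> {1 / bound b..bound b}" if "t \<in> {a..b}" for x t using ts_in[of t b] that a by auto
    qed
    from lipschitz_rect_add[OF L2 this, of 1] lipschitz_rect_add[OF L2 this, of "-1"] show ?thesis
      by (auto simp: ss_def[abs_def] rs_def[abs_def])
  qed
  have w_cont: "continuous_on {1 / bound T..bound T} (riemann_w K \<gamma> cv Sm)" for T
  proof (rule DERIV_continuous_on)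
    fix v assume "v \<in> {1 / bound T..bound T}"
    then have "0 < v" using less_le_trans[OF bound1[of T], of v] by simp
    then show "(riemann_w K \<gamma> cv Sm has_real_derivative - sound_speed K \<gamma> cv Sm v) (at v within {1 / bound T..bound T})"
      by (intro has_field_derivative_at_within[of _ _ _ "{1 / bound T..bound T}"] riemann_w_deriv[OF \<gamma> K])
  qed
  show "\<exists>k>0. \<forall>x. \<forall>t\<in>{0<..T}. k \<le> ss x t - rs x t" for T
  proof (cases "0 < T")
    case True
    then have ne: "{1 / bound T..bound T} \<noteq> {}" using ts_in[of T T x0] by auto
    \<comment> \<open>The gap is the minimum of a positive continuous function over this compact
      range.\<close>
    obtain v where v: "v \<in> {1 / bound T..bound T}" "\<And>y. y \<in> {1 / bound T..bound T} \<Longrightarrow> riemann_w K \<gamma> cv Sm v \<le> riemann_w K \<gamma> cv Sm y"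
      using continuous_attains_inf[OF compact_Icc ne w_cont] by blast
    have "0 < v" using less_le_trans[OF bound1[of T], of v] v(1) by simp
    then have "0 < riemann_w K \<gamma> cv Sm v" by (rule riemann_w_pos[OF \<gamma> K])
    moreover have "riemann_w K \<gamma> cv Sm v \<le> ss x t - rs x t" if "t \<in> {0<..T}" for x t
      using v(2)[OF ts_in[OF that, of x]] calculation by (simp add: ss_def rs_def ws_def)
    ultimately show ?thesis by blast
  next
    case False
    then show ?thesis by (intro exI[of _ 1]) auto
  qed
  show "\<exists>M. \<forall>x. \<forall>t\<in>{0<..T}. \<bar>ss x t\<bar> \<le> M \<and> \<bar>rs x t\<bar> \<le> M" for T
  proof -
    have "bounded (riemann_w K \<gamma> cv Sm ` {1 / bound T..bound T})"
      by (intro compact_imp_bounded compact_continuous_image w_cont) simp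
    then obtain W where W: "\<And>v. v \<in> {1 / bound T..bound T} \<Longrightarrow> \<bar>riemann_w K \<gamma> cv Sm v\<bar> \<le> W"
      unfolding bounded_iff by (metis image_eqI real_norm_def)
    have "\<bar>ss x t\<bar> \<le> bound T + W \<and> \<bar>rs x t\<bar> \<le> bound T + W" if "t \<in> {0<..T}" for x t
    proof -
      have "\<bar>us x t\<bar> \<le> bound T" using bound[of T] that by blast
      moreover have "\<bar>ws x t\<bar> \<le> W" unfolding ws_def by (rule W[OF ts_in[OF that]])
      ultimately show ?thesis by (auto simp: ss_def rs_def abs_le_iff)
    qed
    then show ?thesis by blast
  qed
  show "((\<lambda>(y, t). ss y t) \<longlongrightarrow> ss x 0) (at (x, 0) within UNIV \<times> {0<..})"
    "((\<lambda>(y, t). rs y t) \<longlongrightarrow> rs x 0) (at (x, 0) within UNIV \<times> {0<..})" if "x \<in> {x0<..<x1}" for x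
    using initial_limits[OF that] by auto
  show "ss x 0 \<le> ss y 0 \<and> rs x 0 \<le> rs y 0" if "x0 < x" "x \<le> y" "y < x1" for x y
    using initial_monotone[OF that] .
  show "((\<lambda>\<theta>. ss (X \<theta>) \<theta>) has_real_derivative 0) (at t)"
    if "0 \<le> a" "\<And>\<theta>. \<theta> \<in> {a<..<b} \<Longrightarrow> x0 < X \<theta> \<and> X \<theta> < x1 \<and>
        (X has_real_derivative speed (ss (X \<theta>) \<theta> - rs (X \<theta>) \<theta>)) (at \<theta>)" "t \<in> {a<..<b}" for a b X t
  proof (rule strip_invariant[where f = ss and \<sigma> = 1, OF _ that(1) _ that(3)])
    show "ss y t = u y t + 1 * riemann_w K \<gamma> cv Sm (\<tau> y t)" if "x0 < y" "y < x1" for y t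
      using that by (simp add: inside)
  qed (use that(2) in simp_all)
  show "((\<lambda>\<theta>. rs (X \<theta>) \<theta>) has_real_derivative 0) (at t)"
    if "0 \<le> a" "\<And>\<theta>. \<theta> \<in> {a<..<b} \<Longrightarrow> x0 < X \<theta> \<and> X \<theta> < x1 \<and>
        (X has_real_derivative - speed (ss (X \<theta>) \<theta> - rs (X \<theta>) \<theta>)) (at \<theta>)" "t \<in> {a<..<b}" for a b X t
  proof (rule strip_invariant[where f = rs and \<sigma> = "-1", OF _ that(1) _ that(3)])
    show "rs y t = u y t + -1 * riemann_w K \<gamma> cv Sm (\<tau> y t)" if "x0 < y" "y < x1" for y t
      using that by (simp add: inside)
  qed (use that(2) in simp_all)
  have \<eta>1: "1 + ?\<eta> = 2 * Q / (Q + 1)" using Q by (simp add: field_simps)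
  have "(1 + ?\<eta>) / Q = 2 / (Q + 1)" using Q unfolding \<eta>1 by simp
  \<comment> \<open>This identity is where \<eta> comes from: with it \<open>u + w / Q = A\<close>
    becomes the law that expresses \<open>s\<close> by \<open>r\<close>, and likewise at
    \<open>x1\<close>.\<close>
  then have key: "?\<eta> + (1 + ?\<eta>) / Q = 1" using Q by (simp flip: add_divide_distrib)
  show "ss x0 t = - ?\<eta> * rs x0 t + (1 + ?\<eta>) * invA" if "0 < t" for t
  proof -
    have "- ?\<eta> * rs x0 t + (1 + ?\<eta>) * invA = us x0 t + (?\<eta> + (1 + ?\<eta>) / Q) * ws x0 t"
      unfolding contact_left[OF that, symmetric] rs_def by (simp add: algebra_simps add_divide_distrib)
    then show ?thesis by (simp add: key ss_def)
  qed
  show "rs x1 t = - ?\<eta> * ss x1 t + (1 + ?\<eta>) * invB" if "0 < t" for t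
  proof -
    have "- ?\<eta> * ss x1 t + (1 + ?\<eta>) * invB = us x1 t - (?\<eta> + (1 + ?\<eta>) / Q) * ws x1 t"
      unfolding contact_right[OF that, symmetric] ss_def by (simp add: algebra_simps add_divide_distrib)
    then show ?thesis by (simp add: key rs_def)
  qed
qed

end


section \<open>Long-time behavior\<close>

lemma increasing_bounded_tendsto:
  fixes Y :: "real \<Rightarrow> real"
  assumes inc: "\<And>s t. T < s \<Longrightarrow> s \<le> t \<Longrightarrow> Y s \<le> Y t" and bd: "\<And>t. T < t \<Longrightarrow> Y t \<le> b"
  shows "\<exists>l. (Y \<longlongrightarrow> l) at_top"
proof -
  define l where "l = Sup (Y ` {T<..})"
  have ba: "bdd_above (Y ` {T<..})" using bd by (intro bdd_aboveI[of _ b]) auto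
  have "(Y \<longlongrightarrow> l) at_top"
  proof (rule tendstoI)
    fix e :: real assume "0 < e"
    then have "l - e < l" by simp
    then obtain s where s: "T < s" "l - e < Y s"
      unfolding l_def by (subst (asm) less_cSup_iff[OF _ ba]) auto
    have "\<forall>\<^sub>F t in at_top. s \<le> t" by (rule eventually_ge_at_top)
    then show "\<forall>\<^sub>F t in at_top. dist (Y t) l < e"
    proof eventually_elim
      case (elim t)
      have "Y t \<le> l" unfolding l_def by (rule cSup_upper[OF _ ba]) (use s elim in auto)
      then show ?case using inc[OF s(1) elim] s(2) by (simp add: dist_real_def)
    qed
  qed
  then show ?thesis by blast
qed

context strip
begin

lemma untrapped:
  assumes "B \<le> A" "0 \<le> T" and \<sigma>: "\<sigma> \<in> {-1, 1}"
    and X: "\<And>t. T < t \<Longrightarrow> x0 < X t \<and> X t < x1 \<and> (X has_real_derivative \<sigma> * c (X t) t) (at t)"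
  shows False
proof -
  interpret M: strip x0 x1 \<eta> "- B" "- A" F "\<lambda>x t. - r (x0 + x1 - x) t" "\<lambda>x t. - s (x0 + x1 - x) t"
    by (rule mirror)
  have Mc: "M.c x t = c (x0 + x1 - x) t" for x t by (simp add: M.c_def c_def)
  have cont: "continuous_on {T + 1..t} X" for t
  proof (intro continuous_at_imp_continuous_on ballI)
    fix \<theta> assume "\<theta> \<in> {T + 1..t}"
    then have "T < \<theta>" by simp
    from X[OF this] show "isCont X \<theta>" using DERIV_isCont by blast
  qed
  \<comment> \<open>\<open>T\<close> may be \<open>0\<close>, while \<open>arc_exit\<close> needs a
    positive starting time.\<close>
  have T: "0 < T + 1" using assms(2) by simp
  show False
  proof (cases "\<sigma> = 1")
    case True
    obtain \<tau> where \<tau>: "0 < \<tau>" "\<And>X t1. T + 1 < t1 \<Longrightarrow> arc X (T + 1) t1 \<Longrightarrow> t1 - (T + 1) \<le> \<tau>"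
      using arc_exit[OF assms(1) T] by metis
    have "arc X (T + 1) (T + 1 + \<tau> + 1)" using cont X True by (auto simp: arc_def)
    from \<tau>(2)[OF _ this] \<tau>(1) show False by simp
  next
    case False
    then have \<sigma>': "\<sigma> = -1" using \<sigma> by simp
    obtain \<tau> where \<tau>: "0 < \<tau>" "\<And>X t1. T + 1 < t1 \<Longrightarrow> M.arc X (T + 1) t1 \<Longrightarrow> t1 - (T + 1) \<le> \<tau>"
      using M.arc_exit[OF _ T] assms(1) by (metis neg_le_iff_le)
    have "M.arc (\<lambda>t. x0 + x1 - X t) (T + 1) (T + 1 + \<tau> + 1)"
      unfolding M.arc_def
    proof (intro conjI ballI)
      show "continuous_on {T + 1..T + 1 + \<tau> + 1} (\<lambda>t. x0 + x1 - X t)"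
        by (intro continuous_on_diff continuous_on_const cont)
      fix t assume "t \<in> {T + 1<..<T + 1 + \<tau> + 1}"
      then have "T < t" by simp
      from X[OF this] have *: "x0 < X t" "X t < x1" "(X has_real_derivative - 1 * c (X t) t) (at t)"
        using \<sigma>' by auto
      from *(1,2) show "x0 < x0 + x1 - X t" "x0 + x1 - X t < x1" by auto
      show "((\<lambda>t. x0 + x1 - X t) has_real_derivative M.c (x0 + x1 - X t) t) (at t)"
        using DERIV_diff[OF DERIV_const *(3), of "x0 + x1"] by (simp add: Mc)
    qed
    from \<tau>(2)[OF _ this] \<tau>(1) show False by simp
  qed
qed

lemma back_leg_const:
  assumes leg: "leg k X a b" and "even k" and t: "0 < t" "a \<le> t" "t < b"
  shows "r (X t) t = r x0 b"
proof -
  interpret M: strip x0 x1 \<eta> "- B" "- A" F "\<lambda>x t. - r (x0 + x1 - x) t" "\<lambda>x t. - s (x0 + x1 - x) t"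
    by (rule mirror)
  have Mc: "M.c x t = c (x0 + x1 - x) t" for x t by (simp add: M.c_def c_def)
  have "M.arc (\<lambda>t. x0 + x1 - X t) t b"
    unfolding M.arc_def
  proof (intro conjI ballI)
    have "continuous_on {t..b} X"
      by (rule continuous_on_subset[of "{a..b}"]) (use leg t in \<open>auto simp: leg_def\<close>)
    then show "continuous_on {t..b} (\<lambda>t. x0 + x1 - X t)"
      by (intro continuous_on_diff continuous_on_const)
    fix \<tau> assume "\<tau> \<in> {t<..<b}"
    then have *: "x0 < X \<tau>" "X \<tau> < x1" "(X has_real_derivative - 1 * c (X \<tau>) \<tau>) (at \<tau>)"
      using leg \<open>even k\<close> t by (auto simp: leg_def)
    from *(1,2) show "x0 < x0 + x1 - X \<tau>" "x0 + x1 - X \<tau> < x1" by auto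
    show "((\<lambda>t. x0 + x1 - X t) has_real_derivative M.c (x0 + x1 - X \<tau>) \<tau>) (at \<tau>)"
      using DERIV_diff[OF DERIV_const *(3), of "x0 + x1"] by (simp add: Mc)
  qed
  from M.arc_const[OF this t(1), of b] show ?thesis
    using leg \<open>even k\<close> t by (simp add: leg_def)
qed

text \<open>The values are read off at \<open>t (2 * n + 2)\<close>, from the second visit to
  \<open>x1\<close> on: the first is the corner at time \<open>0\<close>, where the boundary laws do
  not apply.\<close>

lemma no_infinite_reflection:
  assumes "A < B" "t 0 = 0" and legs: "\<And>k. leg k X (t k) (t (Suc k))"
  shows False
proof (rule no_infinite_round_trips[OF assms(1), of "\<lambda>n. r x1 (t (2 * n + 2))"])
  have less: "t k < t (Suc k)" for k using legs[of k] by (simp add: leg_def)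
  then have "strict_mono t" by (rule strict_mono_Suc_iff[THEN iffD2, rule_format])
  then have pos: "0 < t k" if "0 < k" for k :: nat using strict_mono_less[of t 0 k] assms(2) that by simp
  fix n :: nat
  let ?k = "2 * n + 2"
  have X: "X (t ?k) = x1" using legs[of ?k] by (simp add: leg_def)
  have 1: "r x1 (t ?k) = r x0 (t (Suc ?k))"
    using back_leg_const[OF legs[of ?k], of "t ?k"] pos less X by simp
  then show "r x1 (t ?k) < A" using r_x0_lt_A[of "t (Suc ?k)"] pos by simp
  have arc: "arc X (t (Suc ?k)) (t (Suc (Suc ?k)))" "X (t (Suc ?k)) = x0" "X (t (Suc (Suc ?k))) = x1"
    using legs[of "Suc ?k"] by (auto simp: leg_def arc_def)
  have "r x1 (t (Suc (Suc ?k))) = - \<eta> * s x0 (t (Suc ?k)) + (1 + \<eta>) * B"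
    by (rule arc_crossing(2)[OF arc(1)]) (use pos less arc in auto)
  also have "s x0 (t (Suc ?k)) = - \<eta> * r x1 (t ?k) + (1 + \<eta>) * A"
    using bc0[of "t (Suc ?k)"] pos 1 by simp
  finally show "r x1 (t (2 * Suc n + 2)) = - \<eta> * (- \<eta> * r x1 (t ?k) + (1 + \<eta>) * A) + (1 + \<eta>) * B"
    by simp
qed

text \<open>The strict inequality survives the limit because \<open>gap\<close> is uniform down to
  \<open>t = 0\<close>.\<close>

lemma x1_limits:
  obtains ls lr where "((\<lambda>t. s x1 t) \<longlongrightarrow> ls) (at_right 0)" "((\<lambda>t. r x1 t) \<longlongrightarrow> lr) (at_right 0)"
    "lr < ls" "lr = - \<eta> * ls + (1 + \<eta>) * B"
proof -
  interpret M: strip x0 x1 \<eta> "- B" "- A" F "\<lambda>x t. - r (x0 + x1 - x) t" "\<lambda>x t. - s (x0 + x1 - x) t"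
    by (rule mirror)
  obtain Z l1 l2 where "M.fwd Z" "\<forall>t>0. x0 < Z t" "(Z \<longlongrightarrow> x0) (at_right 0)"
    and l: "((\<lambda>t. - r (x0 + x1 - x0) t) \<longlongrightarrow> l1) (at_right 0)" "((\<lambda>t. - s (x0 + x1 - x0) t) \<longlongrightarrow> l2) (at_right 0)"
      "((\<lambda>t. - r (x0 + x1 - Z t) t) \<longlongrightarrow> l1) (at_right 0)" "((\<lambda>t. - s (x0 + x1 - Z t) t) \<longlongrightarrow> l2) (at_right 0)"
    by (rule M.corner_characteristic)
  have lim: "((\<lambda>t. s x1 t) \<longlongrightarrow> - l2) (at_right 0)" "((\<lambda>t. r x1 t) \<longlongrightarrow> - l1) (at_right 0)"
    using tendsto_minus[OF l(2)] tendsto_minus[OF l(1)] by simp_all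
  obtain k where k: "0 < k" "\<And>x t. t \<in> {0<..1} \<Longrightarrow> k \<le> s x t - r x t" using gap[of 1] by blast
  have ev: "\<forall>\<^sub>F t in at_right 0. t \<in> {0<..<1::real}" by (intro eventually_at_right_real) auto
  have "k \<le> - l2 - - l1"
  proof (rule tendsto_lowerbound[OF tendsto_diff[OF lim]])
    show "\<forall>\<^sub>F t in at_right 0. k \<le> s x1 t - r x1 t" using ev by eventually_elim (use k(2) in auto)
  qed simp
  moreover have "((\<lambda>t. - \<eta> * s x1 t + (1 + \<eta>) * B) \<longlongrightarrow> - \<eta> * (- l2) + (1 + \<eta>) * B) (at_right 0)"
    by (intro tendsto_add tendsto_mult tendsto_const lim)
  moreover have "\<forall>\<^sub>F t in at_right 0. - \<eta> * s x1 t + (1 + \<eta>) * B = r x1 t"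
    using ev by eventually_elim (use bc1 in auto)
  ultimately have "((\<lambda>t. r x1 t) \<longlongrightarrow> - \<eta> * (- l2) + (1 + \<eta>) * B) (at_right 0)"
    using Lim_transform_eventually by blast
  from tendsto_unique[OF trivial_limit_at_right_real lim(2) this]
  show thesis using that[OF lim] \<open>k \<le> _\<close> k(1) by simp
qed

end

context two_contacts
begin

section \<open>From Riemann invariants back to gas variables\<close>

abbreviation "m \<equiv> entropy_var K \<gamma> cv Sm"
abbreviation "cf \<equiv> \<lambda>x t. sound_speed K \<gamma> cv (S x) (\<tau> x t)"
abbreviation "zf \<equiv> \<lambda>x t. z_var \<gamma> (\<tau> x t)"

lemma m_pos: "0 < m" by (rule entropy_var_pos[OF \<gamma> K])

lemma ws_eq: "ws x t = (ss x t - rs x t) / 2" and us_eq: "us x t = (ss x t + rs x t) / 2"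
  by (simp_all add: ss_def rs_def)

lemma cf_eq:
  assumes "x0 < x" "x < x1" "0 < t"
  shows "cf x t = c x t"
  using speed_eq[OF assms(3), of x] region_entropy[OF regions_in(2), of x] assms by (simp add: c_def)

lemma zf_eq:
  assumes "x0 < x" "x < x1"
  shows "zf x t = (ss x t - rs x t) / (2 * m)"
  using assms m_pos by (simp add: inside riemann_w_def)

lemma characteristic_iff:
  assumes "J \<subseteq> {0<..}"
  shows "characteristic x0 x1 cf \<sigma> J X \<longleftrightarrow>
    (\<forall>t\<in>J. x0 < X t \<and> X t < x1 \<and> (X has_real_derivative \<sigma> * c (X t) t) (at t))"
  using assms cf_eq unfolding characteristic_def by (smt (verit) greaterThan_iff subsetD)

text \<open>The inverse of \<open>riemann_w\<close> at the middle entropy, read off from the formula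
  for \<tau> in terms of \<open>z = w / m\<close>.\<close>

definition "tau_of_w w = (w / m) powr (1 - d_exp \<gamma>) / (d_exp \<gamma> - 1)"

lemma ts_eq:
  assumes "0 < t"
  shows "ts x t = tau_of_w (ws x t)"
proof -
  have "tau_of_w (ws x t) = z_var \<gamma> (ts x t) powr (1 - d_exp \<gamma>) / (d_exp \<gamma> - 1)"
    using m_pos by (simp add: tau_of_w_def ws_def riemann_w_def)
  also have "\<dots> = ts x t"
    by (rule specific_volume_eq[OF \<gamma> extend_pos[OF regions_in(2) order_refl x01 assms], symmetric])
  finally show ?thesis by (rule sym)
qed

lemma riemann_w_tau_of_w:
  assumes "0 < w"
  shows "0 < tau_of_w w" "riemann_w K \<gamma> cv Sm (tau_of_w w) = w"
proof -
  let ?d = "d_exp \<gamma>"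
  have d: "1 < ?d" by (rule d_exp_gt_1[OF \<gamma>])
  have wm: "0 < w / m" using assms m_pos by simp
  show "0 < tau_of_w w" using assms m_pos d by (simp add: tau_of_w_def)
  have d1: "?d - 1 = 2 / (\<gamma> - 1)" using \<gamma> by (simp add: d_exp_def field_simps)
  have e1: "(1 - ?d) * (- (\<gamma> - 1) / 2) = 1" and e2: "1 / (1 - ?d) = - (\<gamma> - 1) / 2"
    using \<gamma> d by (simp_all add: d_exp_def field_simps)
  have "tau_of_w w powr (- (\<gamma> - 1) / 2)
      = ((w / m) powr (1 - ?d)) powr (- (\<gamma> - 1) / 2) / (?d - 1) powr (- (\<gamma> - 1) / 2)"
    unfolding tau_of_w_def by (rule powr_divide)
  also have "((w / m) powr (1 - ?d)) powr (- (\<gamma> - 1) / 2) = w / m"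
    unfolding powr_powr e1 using assms m_pos by simp
  finally show "riemann_w K \<gamma> cv Sm (tau_of_w w) = w"
    using m_pos d by (simp add: riemann_w_def z_var_def C_z_def e2)
qed

text \<open>\<open>corner_trace\<close> and \<open>reflected_characteristic\<close> speak of \<tau>
  and \<open>u\<close>, whereas limits are known for \<open>s\<close> and \<open>r\<close>;
  \<open>lr < ls\<close> keeps the limit away from vacuum, where \<open>tau_of_w\<close> is
  continuous.\<close>

lemma state_limits:
  assumes "((\<lambda>t. ss (X t) t) \<longlongrightarrow> ls) F" "((\<lambda>t. rs (X t) t) \<longlongrightarrow> lr) F" "lr < ls" "\<forall>\<^sub>F t in F. 0 < t"
  shows "((\<lambda>t. ts (X t) t) \<longlongrightarrow> tau_of_w ((ls - lr) / 2)) F" "((\<lambda>t. us (X t) t) \<longlongrightarrow> (ls + lr) / 2) F"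
proof -
  have w: "((\<lambda>t. ws (X t) t) \<longlongrightarrow> (ls - lr) / 2) F"
    unfolding ws_eq by (intro tendsto_divide tendsto_diff assms tendsto_const) simp
  have "((\<lambda>t. tau_of_w (ws (X t) t)) \<longlongrightarrow> tau_of_w ((ls - lr) / 2)) F"
    unfolding tau_of_w_def using m_pos assms(3) d_exp_gt_1[OF \<gamma>]
    by (intro tendsto_divide tendsto_powr w tendsto_const) auto
  moreover have "\<forall>\<^sub>F t in F. tau_of_w (ws (X t) t) = ts (X t) t"
    using assms(4) by eventually_elim (simp add: ts_eq)
  ultimately show "((\<lambda>t. ts (X t) t) \<longlongrightarrow> tau_of_w ((ls - lr) / 2)) F" by (rule Lim_transform_eventually)
  show "((\<lambda>t. us (X t) t) \<longlongrightarrow> (ls + lr) / 2) F"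
    unfolding us_eq by (intro tendsto_divide tendsto_add assms tendsto_const) simp
qed

lemma corner_traces:
  assumes l: "((\<lambda>t. ss x1 t) \<longlongrightarrow> ls) (at_right 0)" "((\<lambda>t. rs x1 t) \<longlongrightarrow> lr) (at_right 0)" "lr < ls"
  shows "corner_trace x1 \<tau> = tau_of_w ((ls - lr) / 2)" "corner_trace x1 u = (ls + lr) / 2"
    "corner_trace x1 zf = (ls - lr) / (2 * m)"
proof -
  have ev: "\<forall>\<^sub>F t in at_right (0::real). 0 < t" by (rule eventually_at_right_less)
  note mid = regions_in(2) order_refl x01
  have tr: "Lim (at_left x1) (\<lambda>x. \<tau> x t) = ts x1 t" "Lim (at_left x1) (\<lambda>x. u x t) = us x1 t"
    if "0 < t" for t
    by (intro tendsto_Lim traces[OF mid that]; simp)+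
  have zt: "Lim (at_left x1) (\<lambda>x. zf x t) = (ss x1 t - rs x1 t) / (2 * m)" if t: "0 < t" for t
  proof (rule tendsto_Lim)
    have "((\<lambda>x. riemann_w K \<gamma> cv Sm (\<tau> x t) / m) \<longlongrightarrow> ws x1 t / m) (at_left x1)"
      unfolding ws_def using m_pos
      by (intro tendsto_divide tendsto_const tendsto_riemann_w traces[OF mid t] extend_pos[OF mid t]) simp
    then show "((\<lambda>x. zf x t) \<longlongrightarrow> (ss x1 t - rs x1 t) / (2 * m)) (at_left x1)"
      using m_pos by (simp add: riemann_w_def ws_eq)
  qed simp
  have *: "corner_trace x1 f = lim" if "\<And>t. 0 < t \<Longrightarrow> Lim (at_left x1) (\<lambda>x. f x t) = g t" "(g \<longlongrightarrow> lim) (at_right 0)" for f g lim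
    unfolding corner_trace_def
  proof (rule tendsto_Lim[OF trivial_limit_at_right_real Lim_transform_eventually[OF that(2)]])
    show "\<forall>\<^sub>F t in at_right 0. g t = Lim (at_left x1) (\<lambda>x. f x t)"
      using ev by eventually_elim (simp add: that(1))
  qed
  show "corner_trace x1 \<tau> = tau_of_w ((ls - lr) / 2)"
    by (rule *[OF tr(1) state_limits(1)[of "\<lambda>_. x1", OF l ev]])
  show "corner_trace x1 u = (ls + lr) / 2"
    by (rule *[OF tr(2) state_limits(2)[of "\<lambda>_. x1", OF l ev]])
  show "corner_trace x1 zf = (ls - lr) / (2 * m)"
    using m_pos by (intro *[OF zt] tendsto_divide tendsto_diff l tendsto_const) auto
qed

lemma reflected_leg:
  assumes X: "reflected_characteristic x0 x1 cf \<tau> u n X t" and k: "k < n"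
  shows "leg k X (t k) (t (Suc k))"
proof -
  have tpos: "0 \<le> t j" if "j \<le> n" for j
    using that
  proof (induction j)
    case 0
    then show ?case using X by (simp add: reflected_characteristic_def)
  next
    case (Suc j)
    then have "t j < t (Suc j)" using X by (simp add: reflected_characteristic_def)
    with Suc show ?case by simp
  qed
  have "{t k<..<t (Suc k)} \<subseteq> {0<..}" using tpos[of k] k by auto
  note ch = characteristic_iff[OF this]
  have "characteristic x0 x1 cf (if even k then - 1 else 1) {t k<..<t (Suc k)} X"
    using X k unfolding reflected_characteristic_def by blast
  note this[unfolded ch]
  moreover have "t k < t (Suc k)" "continuous_on {t k..t (Suc k)} X"
    "X (t k) = (if even k then x1 else x0)" "X (t (Suc k)) = (if even (Suc k) then x1 else x0)"
    using X k unfolding reflected_characteristic_def by auto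
  ultimately show ?thesis by (auto simp: leg_def)
qed

text \<open>The trace clauses of \<open>reflected_characteristic\<close> make the first leg start
  with the corner value \<open>lr\<close> of \<open>r\<close> even if a fan opens there. Being
  constant on the leg, \<open>r\<close> has this value also at \<open>(x0, t 1)\<close>, and the
  rest follows from the two reflection laws.\<close>

lemma zeta_eq:
  assumes X: "reflected_characteristic x0 x1 cf \<tau> u 1 X t"
  shows "m * (Lim (at_right x0) (\<lambda>x. zf x (t 1)) - (Q - 1) / (Q + 1) * corner_trace x1 zf)
    = (1 + (Q - 1) / (Q + 1)) / 2 * (invA - invB)"
proof -
  let ?\<eta> = "(Q - 1) / (Q + 1)"
  note mid = regions_in(2) order_refl x01
  obtain ls lr where l: "((\<lambda>t. ss x1 t) \<longlongrightarrow> ls) (at_right 0)" "((\<lambda>t. rs x1 t) \<longlongrightarrow> lr) (at_right 0)"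
    "lr < ls" "lr = - ?\<eta> * ls + (1 + ?\<eta>) * invB" by (rule x1_limits)
  note corner = corner_traces[OF l(1-3)]
  have leg: "leg 0 X 0 (t 1)"
    using reflected_leg[OF X, of 0] X by (simp add: reflected_characteristic_def)
  then have t1: "0 < t 1" by (simp add: leg_def)
  have lim: "((\<lambda>s. \<tau> (X s) s) \<longlongrightarrow> tau_of_w ((ls - lr) / 2)) (at_right 0)" "((\<lambda>s. u (X s) s) \<longlongrightarrow> (ls + lr) / 2) (at_right 0)"
    using X by (auto simp: reflected_characteristic_def corner)
  have half: "0 < (ls - lr) / 2" using l(3) by simp
  have "((\<lambda>s. u (X s) s - riemann_w K \<gamma> cv Sm (\<tau> (X s) s)) \<longlongrightarrow>
      (ls + lr) / 2 - riemann_w K \<gamma> cv Sm (tau_of_w ((ls - lr) / 2))) (at_right 0)"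
    by (intro tendsto_diff tendsto_riemann_w lim riemann_w_tau_of_w(1) half)
  then have "((\<lambda>s. u (X s) s - riemann_w K \<gamma> cv Sm (\<tau> (X s) s)) \<longlongrightarrow> lr) (at_right 0)"
    unfolding riemann_w_tau_of_w(2)[OF half] by (simp add: field_simps)
  moreover have "\<forall>\<^sub>F s in at_right 0. s \<in> {0<..<t 1}" using t1 by (intro eventually_at_right_real) auto
  then have "\<forall>\<^sub>F s in at_right 0. u (X s) s - riemann_w K \<gamma> cv Sm (\<tau> (X s) s) = rs x0 (t 1)"
  proof eventually_elim
    case (elim s)
    then have "x0 < X s" "X s < x1" using leg by (auto simp: leg_def)
    then show ?case using back_leg_const[OF leg, of s] elim by (simp add: inside)
  qed
  then have "((\<lambda>s. u (X s) s - riemann_w K \<gamma> cv Sm (\<tau> (X s) s)) \<longlongrightarrow> rs x0 (t 1)) (at_right 0)"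
    by (rule tendsto_eventually)
  ultimately have rs1: "rs x0 (t 1) = lr" using tendsto_unique[OF trivial_limit_at_right_real] by blast
  have z1: "Lim (at_right x0) (\<lambda>x. zf x (t 1)) = ws x0 (t 1) / m"
  proof (rule tendsto_Lim)
    have "((\<lambda>x. riemann_w K \<gamma> cv Sm (\<tau> x (t 1)) / m) \<longlongrightarrow> ws x0 (t 1) / m) (at_right x0)"
      unfolding ws_def using m_pos
      by (intro tendsto_divide tendsto_const tendsto_riemann_w traces[OF mid t1] extend_pos[OF mid t1]) simp
    then show "((\<lambda>x. zf x (t 1)) \<longlongrightarrow> ws x0 (t 1) / m) (at_right x0)"
      using m_pos by (simp add: riemann_w_def)
  qed simp
  define e where "e = ?\<eta>"
  note l4 = l(4)[folded e_def] and s1 = bc0[OF t1, folded e_def, unfolded rs1]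
  have w1: "ws x0 (t 1) = (1 + e) / 2 * (invA - lr)"
    unfolding ws_eq s1 rs1 by (simp add: field_simps)
  have w0: "ls - lr = (1 + e) * (ls - invB)" unfolding l4 by (simp add: algebra_simps)
  have "m * (ws x0 (t 1) / m - e * ((ls - lr) / (2 * m))) = ws x0 (t 1) - e * ((ls - lr) / 2)"
    using m_pos by (simp add: field_simps)
  also have "\<dots> = (1 + e) / 2 * (invA - lr - e * (ls - invB))"
    unfolding w1 w0 by (simp add: field_simps)
  \<comment> \<open>Here the corner values cancel, by the law at \<open>x1\<close>.\<close>
  also have "invA - lr - e * (ls - invB) = invA - invB" unfolding l4 by (simp add: algebra_simps)
  finally show ?thesis unfolding z1 corner(3) e_def .
qed

lemma not_infinitely_reflected:
  assumes "invA < invB"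
  shows "\<not> infinitely_reflected x0 x1 cf \<tau> u"
proof
  assume "infinitely_reflected x0 x1 cf \<tau> u"
  then obtain X t where X: "\<And>n. reflected_characteristic x0 x1 cf \<tau> u n X t"
    by (auto simp: infinitely_reflected_def)
  have "t 0 = 0" using X[of 0] by (simp add: reflected_characteristic_def)
  then show False
    by (rule no_infinite_reflection[OF assms]) (rule reflected_leg[OF X lessI])
qed

lemma is_infinitely_reflected:
  assumes "invB \<le> invA"
  shows "infinitely_reflected x0 x1 cf \<tau> u"
proof -
  obtain X t ls' lr' where t: "t 0 = 0" "\<forall>k. leg k X (t k) (t (Suc k))" "filterlim t at_top sequentially"
    and l': "((\<lambda>t. ss x1 t) \<longlongrightarrow> ls') (at_right 0)" "((\<lambda>t. rs x1 t) \<longlongrightarrow> lr') (at_right 0)"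
      "((\<lambda>t. ss (X t) t) \<longlongrightarrow> ls') (at_right 0)" "((\<lambda>t. rs (X t) t) \<longlongrightarrow> lr') (at_right 0)"
    by (rule infinite_reflection[OF assms])
  obtain ls lr where l: "((\<lambda>t. ss x1 t) \<longlongrightarrow> ls) (at_right 0)" "((\<lambda>t. rs x1 t) \<longlongrightarrow> lr) (at_right 0)"
    "lr < ls" "lr = - ((Q - 1) / (Q + 1)) * ls + (1 + (Q - 1) / (Q + 1)) * invB" by (rule x1_limits)
  \<comment> \<open>Identifying the limits brings in \<open>lr < ls\<close>, which
    \<open>infinite_reflection\<close> does not state.\<close>
  have eq: "ls' = ls" "lr' = lr"
    using tendsto_unique[OF trivial_limit_at_right_real l'(1) l(1)]
      tendsto_unique[OF trivial_limit_at_right_real l'(2) l(2)] .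
  note lX = state_limits[OF l'(3,4)[unfolded eq] l(3) eventually_at_right_less]
  have t_less: "t k < t (Suc k)" for k using t(2) by (simp add: leg_def)
  then have "strict_mono t" by (rule strict_mono_Suc_iff[THEN iffD2, rule_format])
  then have tpos: "0 \<le> t k" for k using strict_mono_less_eq[of t 0 k] t(1) by simp
  have "\<forall>\<^sub>F s in at_right 0. s \<in> {0<..<t 1}" using t_less[of 0] t(1) by (intro eventually_at_right_real) auto
  then have ev: "\<forall>\<^sub>F s in at_right 0. ts (X s) s = \<tau> (X s) s \<and> us (X s) s = u (X s) s"
  proof eventually_elim
    case (elim s)
    then have "x0 < X s" "X s < x1" using t(2)[rule_format, of 0] t(1) by (auto simp: leg_def)
    then show ?case by simp
  qed
  have lim: "((\<lambda>s. \<tau> (X s) s) \<longlongrightarrow> corner_trace x1 \<tau>) (at_right 0)" "((\<lambda>s. u (X s) s) \<longlongrightarrow> corner_trace x1 u) (at_right 0)"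
    unfolding corner_traces[OF l(1-3)]
    by (rule Lim_transform_eventually[OF lX(1)], use ev in \<open>auto elim: eventually_mono\<close>)
      (rule Lim_transform_eventually[OF lX(2)], use ev in \<open>auto elim: eventually_mono\<close>)
  have "reflected_characteristic x0 x1 cf \<tau> u n X t" for n
    unfolding reflected_characteristic_def
  proof (intro conjI allI impI lim)
    show "t 0 = 0" by (rule t(1))
    show "X (t k) = (if even k then x1 else x0)" for k using t(2) by (simp add: leg_def)
    fix k
    show "t k < t (Suc k)" by (rule t_less)
    show "continuous_on {t k..t (Suc k)} X" using t(2) by (simp add: leg_def)
    have "{t k<..<t (Suc k)} \<subseteq> {0<..}" using tpos[of k] by auto
    then show "characteristic x0 x1 cf (if even k then - 1 else 1) {t k<..<t (Suc k)} X"
      using t(2)[rule_format, of k] by (simp only: characteristic_iff) (auto simp: leg_def)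
  qed
  then show ?thesis unfolding infinitely_reflected_def using t(3) by blast
qed

text \<open>A trapped characteristic is monotone and bounded, so it has a vertical asymptote; for
  \<open>invB \<le> invA\<close> the bound on crossing times admits no trapped one.\<close>

lemma asymptotic_vacuum_iff: "asymptotic_vacuum x0 x1 cf \<longleftrightarrow> invA < invB"
proof
  assume "invA < invB"
  then obtain \<sigma> X t0 where \<sigma>: "\<sigma> \<in> {-1, 1}" and t0: "0 < t0" and X: "\<And>t. t0 < t \<Longrightarrow>
      x0 < X t \<and> X t < x1 \<and> (X has_real_derivative \<sigma> * c (X t) t) (at t)"
    using trapped_characteristic by blast
  have "characteristic x0 x1 cf \<sigma> {t0<..} X"
    by (subst characteristic_iff) (use t0 X in auto)
  moreover have "\<exists>l. ((\<lambda>t. \<sigma> * X t) \<longlongrightarrow> l) at_top"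
  proof (rule increasing_bounded_tendsto)
    fix s t assume st: "t0 < s" "s \<le> t"
    show "\<sigma> * X s \<le> \<sigma> * X t"
    proof (rule DERIV_nonneg_imp_nondecreasing[OF st(2)])
      fix q assume "s \<le> q" "q \<le> t"
      then have q: "t0 < q" using st by simp
      have "0 \<le> \<sigma> * (\<sigma> * c (X q) q)" using \<sigma> c_pos[of q "X q"] q t0 by auto
      then show "\<exists>y. ((\<lambda>t. \<sigma> * X t) has_real_derivative y) (at q) \<and> 0 \<le> y"
        using DERIV_cmult X[OF q] by blast
    qed
  next
    show "\<sigma> * X t \<le> \<bar>x0\<bar> + \<bar>x1\<bar>" if "t0 < t" for t using X[OF that] \<sigma> by auto
  qed
  then obtain l where "((\<lambda>t. \<sigma> * X t) \<longlongrightarrow> l) at_top" by blast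
  then have "((\<lambda>t. \<sigma> * (\<sigma> * X t)) \<longlongrightarrow> \<sigma> * l) at_top" by (intro tendsto_mult tendsto_const)
  then have "(X \<longlongrightarrow> \<sigma> * l) at_top" using \<sigma> by auto
  ultimately show "asymptotic_vacuum x0 x1 cf"
    unfolding asymptotic_vacuum_def using \<sigma> t0 by (meson less_imp_le)
next
  assume "asymptotic_vacuum x0 x1 cf"
  then obtain \<sigma> X T where \<sigma>: "\<sigma> \<in> {-1, 1}" and T: "0 \<le> T" and X: "characteristic x0 x1 cf \<sigma> {T<..} X"
    unfolding asymptotic_vacuum_def by blast
  have "{T<..} \<subseteq> {0<..}" using T by auto
  note X = X[unfolded characteristic_iff[OF this]]
  show "invA < invB"
  proof (rule ccontr)
    assume "\<not> invA < invB"
    then show False using untrapped[OF _ T \<sigma>, of X] X by auto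
  qed
qed

text \<open>Time \<open>0\<close> is included because \<open>reflected_nonvacuum\<close> asks for
  bounds from the start; the data are limits of later values.\<close>

lemma gap_lower:
  assumes x: "x0 < x" "x < x1" and t: "0 \<le> t"
  shows "invA - invB \<le> ss x t - rs x t"
proof (cases "t = 0")
  case False
  then show ?thesis using s_gt_A[of t x] r_lt_B[of t x] x t by auto
next
  case True
  have xin: "x \<in> {x0<..<x1}" using x by simp
  have f: "filterlim (\<lambda>t. (x, t)) (at (x, 0) within UNIV \<times> {0<..}) (at_right 0)"
    by (rule filterlim_at_withinI)
      (auto intro!: tendsto_intros always_eventually simp: eventually_at_filter)
  have "((\<lambda>t. ss x t - rs x t) \<longlongrightarrow> ss x 0 - rs x 0) (at_right 0)"
    using tendsto_diff[OF filterlim_compose[OF initial_limits(1)[OF xin] f]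
        filterlim_compose[OF initial_limits(2)[OF xin] f]] by simp
  then have "invA - invB \<le> ss x 0 - rs x 0"
  proof (rule tendsto_lowerbound)
    show "\<forall>\<^sub>F t in at_right 0. invA - invB \<le> ss x t - rs x t"
      using eventually_at_right_less[of "0::real"]
    proof eventually_elim
      case (elim t)
      then show ?case using s_gt_A[of t x] r_lt_B[of t x] x by auto
    qed
  qed simp
  then show ?thesis by (simp only: True)
qed

lemma is_reflected_nonvacuum:
  assumes "invB < invA"
  shows "reflected_nonvacuum x0 x1 cf \<tau> u"
proof -
  let ?d = "d_exp \<gamma>"
  have d: "1 < ?d" by (rule d_exp_gt_1[OF \<gamma>])
  define z0 where "z0 = (invA - invB) / (2 * m)"
  have z0: "0 < z0" using assms m_pos by (simp add: z0_def)
  \<comment> \<open>For \<open>z \<ge> z0\<close> these are lower bounds of \<open>c = m z^d\<close>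
    and of \<open>1 / \<tau> = (d - 1) z^(d - 1)\<close>.\<close>
  define \<epsilon> where "\<epsilon> = min (m * z0 powr ?d) ((?d - 1) * z0 powr (?d - 1))"
  have "0 < \<epsilon>" using z0 m_pos d by (simp add: \<epsilon>_def)
  moreover have "\<epsilon> \<le> cf x t \<and> \<epsilon> \<le> 1 / \<tau> x t" if x: "x0 < x" "x < x1" and t: "0 \<le> t" for x t
  proof -
    have pos: "0 < \<tau> x t" using tau_pos[of x t] x t by auto
    have z: "z0 \<le> zf x t" unfolding zf_eq[OF x] z0_def
      using gap_lower[OF x t] m_pos by (intro divide_right_mono) auto
    have "m * z0 powr ?d \<le> cf x t"
      using z z0 d m_pos region_entropy[OF regions_in(2), of x] x
      by (simp add: sound_speed_eq[OF \<gamma> K pos] powr_mono2)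
    moreover have "1 / \<tau> x t = (?d - 1) * zf x t powr (?d - 1)"
    proof -
      have "1 / \<tau> x t = (?d - 1) / zf x t powr (1 - ?d)"
        using specific_volume_eq[OF \<gamma> pos] by (metis divide_divide_eq_right mult_1)
      also have "\<dots> = (?d - 1) * zf x t powr (- (1 - ?d))" by (simp only: powr_minus divide_inverse)
      finally show ?thesis by simp
    qed
    then have "(?d - 1) * z0 powr (?d - 1) \<le> 1 / \<tau> x t"
      using z z0 d by (simp add: powr_mono2)
    ultimately show ?thesis by (auto simp: \<epsilon>_def)
  qed
  ultimately show ?thesis
    unfolding reflected_nonvacuum_def using is_infinitely_reflected assms by (meson less_imp_le)
qed

lemma is_reflected_to_vacuum:
  assumes "invA = invB"
  shows "reflected_to_vacuum x0 x1 cf zf \<tau> u"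
  unfolding reflected_to_vacuum_def
proof
  show "infinitely_reflected x0 x1 cf \<tau> u" by (rule is_infinitely_reflected) (use assms in simp)
  show "uniform_limit {x0<..<x1} (\<lambda>t x. zf x t) (\<lambda>x. 0) at_top"
    unfolding uniform_limit_iff
  proof (intro allI impI)
    fix e :: real assume e: "0 < e"
    then have "0 < m * e" using m_pos by simp
    then obtain T where T: "0 < T" "\<And>t x. T \<le> t \<Longrightarrow> x \<in> {x0..x1} \<Longrightarrow> ss x t - rs x t \<le> m * e"
      using decay[OF assms, of "m * e"] by metis
    show "\<forall>\<^sub>F t in at_top. \<forall>x\<in>{x0<..<x1}. dist (zf x t) 0 < e"
      using eventually_ge_at_top[of T]
    proof (eventually_elim, intro ballI)
      fix t x assume t: "T \<le> t" and x: "x \<in> {x0<..<x1}"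
      then have x': "x0 < x" "x < x1" by auto
      have "0 < zf x t" by (rule z_var_pos[OF \<gamma>]) (use tau_pos[of x t] x t T in auto)
      moreover have "zf x t \<le> m * e / (2 * m)"
        unfolding zf_eq[OF x'] by (intro divide_right_mono T(2)[OF t]) (use x m_pos in auto)
      ultimately show "dist (zf x t) 0 < e" using e m_pos by simp
    qed
  qed
qed

text \<open>Since \<open>c = m z^d\<close>, a positive lower bound on \<open>c\<close> at one point
  of the strip already contradicts the decay of \<open>z\<close> there.\<close>

lemma vacuum_exclusive: "\<not> (reflected_to_vacuum x0 x1 cf zf \<tau> u \<and> reflected_nonvacuum x0 x1 cf \<tau> u)"
proof
  assume *: "reflected_to_vacuum x0 x1 cf zf \<tau> u \<and> reflected_nonvacuum x0 x1 cf \<tau> u"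
  define x where "x = (x0 + x1) / 2"
  have x: "x0 < x" "x < x1" using x01 by (auto simp: x_def)
  have d: "1 < d_exp \<gamma>" by (rule d_exp_gt_1[OF \<gamma>])
  from * obtain \<epsilon> where \<epsilon>: "0 < \<epsilon>" "\<And>t. 0 \<le> t \<Longrightarrow> \<epsilon> \<le> cf x t"
    unfolding reflected_nonvacuum_def using x by blast
  from * have "((\<lambda>t. zf x t) \<longlongrightarrow> 0) at_top"
    unfolding reflected_to_vacuum_def
    using tendsto_uniform_limitI[where f = "\<lambda>t x. zf x t" and x = x and S = "{x0<..<x1}"] x by auto
  then have "((\<lambda>t. zf x t powr d_exp \<gamma>) \<longlongrightarrow> 0) at_top"
    by (rule tendsto_zero_powrI[OF _ tendsto_const]) (use d in \<open>simp_all add: z_var_def C_z_def\<close>)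
  then have "((\<lambda>t. m * zf x t powr d_exp \<gamma>) \<longlongrightarrow> m * 0) at_top" by (intro tendsto_mult tendsto_const)
  moreover have "\<forall>\<^sub>F t in at_top. \<epsilon> \<le> m * zf x t powr d_exp \<gamma>"
    using eventually_ge_at_top[of "0::real"]
  proof eventually_elim
    case (elim t)
    have "0 < \<tau> x t" using tau_pos[of x t] x elim by auto
    then show ?case
      using \<epsilon>(2)[OF elim] region_entropy[OF regions_in(2), of x] x by (simp add: sound_speed_eq[OF \<gamma> K])
  qed
  ultimately have "\<epsilon> \<le> m * 0" by (rule tendsto_lowerbound) simp
  with \<epsilon>(1) show False by simp
qed

lemma reflected_to_vacuum_iff: "reflected_to_vacuum x0 x1 cf zf \<tau> u \<longleftrightarrow> invA = invB"
  and reflected_nonvacuum_iff: "reflected_nonvacuum x0 x1 cf \<tau> u \<longleftrightarrow> invB < invA"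
proof -
  consider "invA < invB" | "invA = invB" | "invB < invA" by linarith
  then have "(reflected_to_vacuum x0 x1 cf zf \<tau> u \<longleftrightarrow> invA = invB) \<and> (reflected_nonvacuum x0 x1 cf \<tau> u \<longleftrightarrow> invB < invA)"
  proof cases
    case 1
    then show ?thesis using not_infinitely_reflected[OF 1]
      by (auto simp: reflected_to_vacuum_def reflected_nonvacuum_def)
  next
    case 2
    then show ?thesis using is_reflected_to_vacuum[OF 2] vacuum_exclusive by auto
  next
    case 3
    then show ?thesis using is_reflected_nonvacuum[OF 3] vacuum_exclusive by auto
  qed
  then show "reflected_to_vacuum x0 x1 cf zf \<tau> u \<longleftrightarrow> invA = invB" "reflected_nonvacuum x0 x1 cf \<tau> u \<longleftrightarrow> invB < invA"
    by auto
qed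

end

theorem theorem3:
  fixes K \<gamma> cv x0 x1 Sl Sm Sr Q \<eta> :: real
    and S :: "real \<Rightarrow> real"
    and \<tau> u z c :: "real \<Rightarrow> real \<Rightarrow> real"
  assumes "\<gamma> > 1" and "K > 0" and "cv > 0" and "x0 < x1"
    and S: "S = entropy_profile x0 x1 Sl Sm Sr"
    and "Q > 1"
    and "contact_strength \<gamma> (entropy_var K \<gamma> cv Sl) (entropy_var K \<gamma> cv Sm) = Q"
    and "contact_strength \<gamma> (entropy_var K \<gamma> cv Sm) (entropy_var K \<gamma> cv Sr) = 1 / Q"
    and \<eta>: "\<eta> = (Q - 1) / (Q + 1)"
    and "euler_solution K \<gamma> cv x0 x1 S \<tau> u"
    and "smooth_data_between x0 x1 (\<lambda>x. \<tau> x 0) (\<lambda>x. u x 0)"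
    and "rarefactive_data K \<gamma> cv x0 x1 S (\<lambda>x. \<tau> x 0) (\<lambda>x. u x 0)"
    and z: "z = (\<lambda>x t. z_var \<gamma> (\<tau> x t))"
    and c: "c = (\<lambda>x t. sound_speed K \<gamma> cv (S x) (\<tau> x t))"
  shows
    "(asymptotic_vacuum x0 x1 c \<or> reflected_to_vacuum x0 x1 c z \<tau> u \<or>
       reflected_nonvacuum x0 x1 c \<tau> u) \<and>
     \<not> (asymptotic_vacuum x0 x1 c \<and> reflected_to_vacuum x0 x1 c z \<tau> u) \<and>
     \<not> (asymptotic_vacuum x0 x1 c \<and> reflected_nonvacuum x0 x1 c \<tau> u) \<and>
     \<not> (reflected_to_vacuum x0 x1 c z \<tau> u \<and> reflected_nonvacuum x0 x1 c \<tau> u) \<and>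
     (\<forall>X t. reflected_characteristic x0 x1 c \<tau> u 1 X t \<longrightarrow>
       (let z0 = corner_trace x1 z;
            z1 = Lim (at_right x0) (\<lambda>x. z x (t 1));
            \<zeta> = z1 - \<eta> * z0
        in (asymptotic_vacuum x0 x1 c \<longleftrightarrow> \<zeta> < 0) \<and>
           (reflected_to_vacuum x0 x1 c z \<tau> u \<longleftrightarrow> \<zeta> = 0) \<and>
           (reflected_nonvacuum x0 x1 c \<tau> u \<longleftrightarrow> \<zeta> > 0))) \<and>
     ((\<nexists>X t. reflected_characteristic x0 x1 c \<tau> u 1 X t) \<longrightarrow> asymptotic_vacuum x0 x1 c)"
proof -
  interpret G: two_contacts K \<gamma> cv x0 x1 Sl Sm Sr Q S \<tau> u
    by unfold_locales (use assms in auto)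
  have AV: "asymptotic_vacuum x0 x1 c \<longleftrightarrow> G.invA < G.invB"
    unfolding c by (rule G.asymptotic_vacuum_iff)
  have RV: "reflected_to_vacuum x0 x1 c z \<tau> u \<longleftrightarrow> G.invA = G.invB"
    unfolding c z by (rule G.reflected_to_vacuum_iff)
  have RN: "reflected_nonvacuum x0 x1 c \<tau> u \<longleftrightarrow> G.invB < G.invA"
    unfolding c by (rule G.reflected_nonvacuum_iff)
  \<comment> \<open>By \<open>zeta_eq\<close>, \<open>\<zeta>\<close> is a positive multiple of
    \<open>invA - invB\<close>.\<close>
  have sign: "(G.invA < G.invB \<longleftrightarrow> \<zeta> < 0) \<and> (G.invA = G.invB \<longleftrightarrow> \<zeta> = 0) \<and> (G.invB < G.invA \<longleftrightarrow> \<zeta> > 0)"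
    if X: "reflected_characteristic x0 x1 c \<tau> u 1 X t"
      and \<zeta>: "\<zeta> = Lim (at_right x0) (\<lambda>x. z x (t 1)) - \<eta> * corner_trace x1 z" for X t \<zeta>
  proof -
    have eq: "G.m * \<zeta> = (1 + \<eta>) / 2 * (G.invA - G.invB)"
      unfolding \<zeta> z \<eta> by (rule G.zeta_eq) (use X c in simp)
    have \<eta>0: "0 < (1 + \<eta>) / 2" using \<open>Q > 1\<close> by (simp add: \<eta> add_pos_pos)
    have "\<zeta> < 0 \<longleftrightarrow> G.m * \<zeta> < 0" "\<zeta> = 0 \<longleftrightarrow> G.m * \<zeta> = 0" "\<zeta> > 0 \<longleftrightarrow> G.m * \<zeta> > 0"
      using G.m_pos by (auto simp: mult_less_0_iff zero_less_mult_iff)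
    moreover have "(1 + \<eta>) / 2 * (G.invA - G.invB) < 0 \<longleftrightarrow> G.invA < G.invB"
      "(1 + \<eta>) / 2 * (G.invA - G.invB) = 0 \<longleftrightarrow> G.invA = G.invB"
      "(1 + \<eta>) / 2 * (G.invA - G.invB) > 0 \<longleftrightarrow> G.invB < G.invA"
      using \<eta>0 mult_less_0_iff[of "(1 + \<eta>) / 2" "G.invA - G.invB"]
        zero_less_mult_iff[of "(1 + \<eta>) / 2" "G.invA - G.invB"]
        mult_eq_0_iff[of "(1 + \<eta>) / 2" "G.invA - G.invB"] by linarith+
    ultimately show ?thesis by (simp only: eq)
  qed
  \<comment> \<open>If the first leg never arrives, \<open>\<zeta>\<close> has no meaning. This can
    happen only for \<open>invA < invB\<close>, as otherwise an infinitely reflected characteristic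
    exists, whose first leg does arrive.\<close>
  have none: "G.invA < G.invB" if no: "\<nexists>X t. reflected_characteristic x0 x1 c \<tau> u 1 X t"
  proof (rule ccontr)
    assume "\<not> G.invA < G.invB"
    then have "infinitely_reflected x0 x1 c \<tau> u" unfolding c by (intro G.is_infinitely_reflected) simp
    with no show False unfolding infinitely_reflected_def by blast
  qed
  show ?thesis
    unfolding AV RV RN Let_def
  proof (intro conjI allI impI)
    fix X t assume "reflected_characteristic x0 x1 c \<tau> u 1 X t"
    from sign[OF this refl] show
      "G.invA < G.invB \<longleftrightarrow> Lim (at_right x0) (\<lambda>x. z x (t 1)) - \<eta> * corner_trace x1 z < 0"
      "G.invA = G.invB \<longleftrightarrow> Lim (at_right x0) (\<lambda>x. z x (t 1)) - \<eta> * corner_trace x1 z = 0"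
      "G.invB < G.invA \<longleftrightarrow> 0 < Lim (at_right x0) (\<lambda>x. z x (t 1)) - \<eta> * corner_trace x1 z"
      by blast+
  qed (use none in auto)
qed

end
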